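(* Let $G$ be a finite group acting admissibly on a triangulated category $\mathcal C$, and assume that $|G|$ is invertible in $\mathcal C$. Then $\mathcal C^G$, endowed with its canonical pre-triangulation, is a triangulated category. A triangle in $\mathcal C^G$ is distinguished if and only if its image under the forgetful functor $\omega:\mathcal C^G\to\mathcal C$ is distinguished.
   Context: A pre-triangulation is a class of distinguished triangles on an additive category with suspension satisfying Verdier's axioms TR1--TR3; it is a triangulation (and the category is triangulated) if it also satisfies the octahedral axiom TR4. An admissible action of a finite group $G$ on a triangulated category $(\mathcal C,\Sigma)$ (right-action convention) consists of exact autoequivalences $(F_g,\theta_g)$, $g\in G$, with $\theta_g:F_g\Sigma\xrightarrow{\sim}\Sigma F_g$, and natural isomorphisms $\delta_{g,h}:F_gF_h\xrightarrow{\sim}F_{hg}$ such that $\delta_{hg,\ell}\circ(\delta_{g,h}F_\ell)=\delta_{g,\ell h}\circ(F_g\delta_{h,\ell})$ and $\theta_{hg}\circ(\delta_{g,h}\Sigma)=(\Sigma\delta_{g,h})\circ(\theta_gF_h)\circ(F_g\theta_h)$. An equivariant object is a pair $(X,\{\varphi_g^X\}_{g\in G})$ with isomorphisms $\varphi_g^X:F_g(X)\xrightarrow{\sim}X$ satisfying $\varphi_g^X\circ F_g(\varphi_h^X)=\varphi_{hg}^X\circ\delta_{g,h,X}$. An equivariant morphism $a:X\to Y$ satisfies $a\circ\varphi_g^X=\varphi_g^Y\circ F_g(a)$ for all $g\in G$. These form the category $\mathcal C^G$, with forgetful functor $\omega:\mathcal C^G\to\mathcal C$. Its suspension sends $(X,\{\varphi^X_g\})$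 to $(\Sigma X,\{\Sigma(\varphi_g^X)\circ\theta_{g,X}\})$. When $|G|$ is invertible in $\mathcal C$, the candidate triangles of $\mathcal C^G$ whose images under $\omega$ are distinguished form a pre-triangulation (Sun), called the canonical pre-triangulation, and $\omega$ is exact. An integer $n$ is invertible in an additive category $\mathcal C$ if multiplication by $n$ is an automorphism of $\mathcal C(X,Y)$ for all $X,Y\in\mathcal C$. *)

theory Defs
  imports "HOL-Algebra.Group" "HOL-Algebra.Coset"
begin

section \<open>Additive categories\<close>

record ('o, 'm) cat =
  Obj :: "'o set"
  Arr :: "'m set"
  Dom :: "'m \<Rightarrow> 'o"
  Cod :: "'m \<Rightarrow> 'o"
  Idn :: "'o \<Rightarrow> 'm"
  Cmp :: "'m \<Rightarrow> 'm \<Rightarrow> 'm"  (infixl "\<cdot>\<index>" 70)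

definition Hom :: "('o, 'm, 'x) cat_scheme \<Rightarrow> 'o \<Rightarrow> 'o \<Rightarrow> 'm set" where
  "Hom C X Y = {f \<in> Arr C. Dom C f = X \<and> Cod C f = Y}"

locale category =
  fixes C :: "('o, 'm, 'x) cat_scheme" (structure)
  assumes Dom_in_Obj: "f \<in> Arr C \<Longrightarrow> Dom C f \<in> Obj C"
    and Cod_in_Obj: "f \<in> Arr C \<Longrightarrow> Cod C f \<in> Obj C"
    and Idn_in_Hom: "X \<in> Obj C \<Longrightarrow> Idn C X \<in> Hom C X X"
    and Cmp_in_Hom: "\<lbrakk>f \<in> Hom C X Y; g \<in> Hom C Y Z\<rbrakk> \<Longrightarrow> g \<cdot> f \<in> Hom C X Z"
    and Cmp_Idn_right: "f \<in> Hom C X Y \<Longrightarrow> f \<cdot> Idn C X = f"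
    and Cmp_Idn_left: "f \<in> Hom C X Y \<Longrightarrow> Idn C Y \<cdot> f = f"
    and Cmp_assoc:
      "\<lbrakk>f \<in> Hom C W X; g \<in> Hom C X Y; h \<in> Hom C Y Z\<rbrakk> \<Longrightarrow> (h \<cdot> g) \<cdot> f = h \<cdot> (g \<cdot> f)"

definition is_iso :: "('o, 'm, 'x) cat_scheme \<Rightarrow> 'm \<Rightarrow> bool" where
  "is_iso C f \<longleftrightarrow> f \<in> Arr C \<and>
     (\<exists>g \<in> Hom C (Cod C f) (Dom C f).
        g \<cdot>\<^bsub>C\<^esub> f = Idn C (Dom C f) \<and> f \<cdot>\<^bsub>C\<^esub> g = Idn C (Cod C f))"

text \<open>Zero morphisms are indexed by source and target; \<open>Add\<close> is only meaningful on parallel arrows.\<close>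

record ('o, 'm) additive_cat = "('o, 'm) cat" +
  Zero :: "'o \<Rightarrow> 'o \<Rightarrow> 'm"
  Add :: "'m \<Rightarrow> 'm \<Rightarrow> 'm"

text \<open>The additive group \<open>C(X, Y)\<close>, written multiplicatively as a library monoid: the library's
  \<open>inv\<close> is negation and \<open>[^]\<close> is the formation of integer multiples.\<close>

definition hom_group :: "('o, 'm, 'x) additive_cat_scheme \<Rightarrow> 'o \<Rightarrow> 'o \<Rightarrow> 'm monoid" where
  "hom_group C X Y = \<lparr>carrier = Hom C X Y, mult = Add C, one = Zero C X Y\<rparr>"

definition Neg :: "('o, 'm, 'x) additive_cat_scheme \<Rightarrow> 'm \<Rightarrow> 'm" where
  "Neg C f = inv\<^bsub>hom_group C (Dom C f) (Cod C f)\<^esub> f"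

locale preadditive_category = category C
  for C :: "('o, 'm, 'x) additive_cat_scheme" (structure) +
  assumes hom_comm_group:
      "\<lbrakk>X \<in> Obj C; Y \<in> Obj C\<rbrakk> \<Longrightarrow> comm_group (hom_group C X Y)"
    and postcomp_additive:
      "\<lbrakk>X \<in> Obj C; g \<in> Hom C Y Z\<rbrakk> \<Longrightarrow> (\<lambda>f. g \<cdot> f) \<in> hom (hom_group C X Y) (hom_group C X Z)"
    and precomp_additive:
      "\<lbrakk>Z \<in> Obj C; f \<in> Hom C X Y\<rbrakk> \<Longrightarrow> (\<lambda>g. g \<cdot> f) \<in> hom (hom_group C Y Z) (hom_group C X Z)"

definition zero_object :: "('o, 'm, 'x) cat_scheme \<Rightarrow> 'o \<Rightarrow> bool" where
  "zero_object C Z \<longleftrightarrow> Z \<in> Obj C \<and>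
     (\<forall>X \<in> Obj C. (\<exists>!f. f \<in> Hom C X Z) \<and> (\<exists>!f. f \<in> Hom C Z X))"

definition is_biproduct ::
  "('o, 'm, 'x) additive_cat_scheme \<Rightarrow> 'o \<Rightarrow> 'o \<Rightarrow> 'o \<Rightarrow> 'm \<Rightarrow> 'm \<Rightarrow> 'm \<Rightarrow> 'm \<Rightarrow> bool" where
  "is_biproduct C X Y P i j p q \<longleftrightarrow>
     P \<in> Obj C \<and> i \<in> Hom C X P \<and> j \<in> Hom C Y P \<and> p \<in> Hom C P X \<and> q \<in> Hom C P Y \<and>
     p \<cdot>\<^bsub>C\<^esub> i = Idn C X \<and> q \<cdot>\<^bsub>C\<^esub> j = Idn C Y \<and>
     q \<cdot>\<^bsub>C\<^esub> i = Zero C X Y \<and> p \<cdot>\<^bsub>C\<^esub> j = Zero C Y X \<and>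
     Add C (i \<cdot>\<^bsub>C\<^esub> p) (j \<cdot>\<^bsub>C\<^esub> q) = Idn C P"

locale additive_category = preadditive_category +
  assumes zero_object_exists: "\<exists>Z. zero_object C Z"
    and biproduct_exists:
      "\<lbrakk>X \<in> Obj C; Y \<in> Obj C\<rbrakk> \<Longrightarrow> \<exists>P i j p q. is_biproduct C X Y P i j p q"

definition int_invertible :: "('o, 'm, 'x) additive_cat_scheme \<Rightarrow> int \<Rightarrow> bool" where
  "int_invertible C n \<longleftrightarrow>
     (\<forall>X \<in> Obj C. \<forall>Y \<in> Obj C.
        (\<lambda>f. f [^]\<^bsub>hom_group C X Y\<^esub> n) \<in> iso (hom_group C X Y) (hom_group C X Y))"

section \<open>Functors\<close>

record ('o1, 'm1, 'o2, 'm2) func =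
  FObj :: "'o1 \<Rightarrow> 'o2"
  FArr :: "'m1 \<Rightarrow> 'm2"

definition is_functor ::
  "('o1, 'm1, 'x1) cat_scheme \<Rightarrow> ('o2, 'm2, 'x2) cat_scheme \<Rightarrow> ('o1, 'm1, 'o2, 'm2) func \<Rightarrow> bool" where
  "is_functor C D F \<longleftrightarrow>
     (\<forall>X \<in> Obj C. FObj F X \<in> Obj D) \<and>
     (\<forall>f \<in> Arr C. FArr F f \<in> Hom D (FObj F (Dom C f)) (FObj F (Cod C f))) \<and>
     (\<forall>X \<in> Obj C. FArr F (Idn C X) = Idn D (FObj F X)) \<and>
     (\<forall>f \<in> Arr C. \<forall>g \<in> Arr C. Cod C f = Dom C g \<longrightarrow>
        FArr F (g \<cdot>\<^bsub>C\<^esub> f) = FArr F g \<cdot>\<^bsub>D\<^esub> FArr F f)"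

definition id_func :: "('o, 'm, 'o, 'm) func" where
  "id_func = \<lparr>FObj = (\<lambda>X. X), FArr = (\<lambda>f. f)\<rparr>"

definition comp_func ::
  "('o2, 'm2, 'o3, 'm3) func \<Rightarrow> ('o1, 'm1, 'o2, 'm2) func \<Rightarrow> ('o1, 'm1, 'o3, 'm3) func" where
  "comp_func H F = \<lparr>FObj = FObj H \<circ> FObj F, FArr = FArr H \<circ> FArr F\<rparr>"

definition is_nat_iso ::
  "('o1, 'm1, 'x1) cat_scheme \<Rightarrow> ('o2, 'm2, 'x2) cat_scheme \<Rightarrow>
   ('o1, 'm1, 'o2, 'm2) func \<Rightarrow> ('o1, 'm1, 'o2, 'm2) func \<Rightarrow> ('o1 \<Rightarrow> 'm2) \<Rightarrow> bool" where
  "is_nat_iso C D F H \<eta> \<longleftrightarrow>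
     (\<forall>X \<in> Obj C. \<eta> X \<in> Hom D (FObj F X) (FObj H X) \<and> is_iso D (\<eta> X)) \<and>
     (\<forall>f \<in> Arr C. \<eta> (Cod C f) \<cdot>\<^bsub>D\<^esub> FArr F f = FArr H f \<cdot>\<^bsub>D\<^esub> \<eta> (Dom C f))"

definition is_equivalence ::
  "('o1, 'm1, 'x1) cat_scheme \<Rightarrow> ('o2, 'm2, 'x2) cat_scheme \<Rightarrow> ('o1, 'm1, 'o2, 'm2) func \<Rightarrow> bool" where
  "is_equivalence C D F \<longleftrightarrow> is_functor C D F \<and>
     (\<exists>H \<eta> \<epsilon>. is_functor D C H \<and>
        is_nat_iso C C id_func (comp_func H F) \<eta> \<and> is_nat_iso D D (comp_func F H) id_func \<epsilon>)"

definition is_additive_functor ::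
  "('o1, 'm1, 'x1) additive_cat_scheme \<Rightarrow> ('o2, 'm2, 'x2) additive_cat_scheme \<Rightarrow>
   ('o1, 'm1, 'o2, 'm2) func \<Rightarrow> bool" where
  "is_additive_functor C D F \<longleftrightarrow> is_functor C D F \<and>
     (\<forall>X \<in> Obj C. \<forall>Y \<in> Obj C.
        FArr F \<in> hom (hom_group C X Y) (hom_group D (FObj F X) (FObj F Y)))"

section \<open>Triangulated categories\<close>

text \<open>A triangle \<open>X \<rightarrow> Y \<rightarrow> Z \<rightarrow> \<Sigma>X\<close> is the triple of its arrows; its objects are recovered from them.\<close>

type_synonym 'm triangle = "'m \<times> 'm \<times> 'm"

definition is_triangle ::
  "('o, 'm, 'x) cat_scheme \<Rightarrow> ('o, 'm, 'o, 'm) func \<Rightarrow> 'm triangle \<Rightarrow> bool" where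
  "is_triangle C S = (\<lambda>(u, v, w).
     u \<in> Arr C \<and> v \<in> Arr C \<and> w \<in> Arr C \<and>
     Cod C u = Dom C v \<and> Cod C v = Dom C w \<and> Cod C w = FObj S (Dom C u))"

definition is_triangle_morphism ::
  "('o, 'm, 'x) cat_scheme \<Rightarrow> ('o, 'm, 'o, 'm) func \<Rightarrow>
   'm triangle \<Rightarrow> 'm triangle \<Rightarrow> 'm \<times> 'm \<times> 'm \<Rightarrow> bool" where
  "is_triangle_morphism C S = (\<lambda>(u, v, w) (u', v', w') (a, b, c).
     a \<in> Hom C (Dom C u) (Dom C u') \<and>
     b \<in> Hom C (Dom C v) (Dom C v') \<and>
     c \<in> Hom C (Dom C w) (Dom C w') \<and>
     b \<cdot>\<^bsub>C\<^esub> u = u' \<cdot>\<^bsub>C\<^esub> a \<and>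
     c \<cdot>\<^bsub>C\<^esub> v = v' \<cdot>\<^bsub>C\<^esub> b \<and>
     FArr S a \<cdot>\<^bsub>C\<^esub> w = w' \<cdot>\<^bsub>C\<^esub> c)"

definition is_triangle_iso ::
  "('o, 'm, 'x) cat_scheme \<Rightarrow> ('o, 'm, 'o, 'm) func \<Rightarrow>
   'm triangle \<Rightarrow> 'm triangle \<Rightarrow> 'm \<times> 'm \<times> 'm \<Rightarrow> bool" where
  "is_triangle_iso C S t t' = (\<lambda>(a, b, c).
     is_triangle_morphism C S t t' (a, b, c) \<and> is_iso C a \<and> is_iso C b \<and> is_iso C c)"

text \<open>The suspension is required to be an autoequivalence, not necessarily an automorphism.\<close>

locale pre_triangulated_category = additive_category C
  for C :: "('o, 'm, 'x) additive_cat_scheme" (structure)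
    and S :: "('o, 'm, 'o, 'm) func"
    and \<T> :: "'m triangle set" +
  assumes susp_equivalence: "is_equivalence C C S"
    and susp_additive: "is_additive_functor C C S"
    and dist_triangle: "t \<in> \<T> \<Longrightarrow> is_triangle C S t"
    and TR1_iso:
      "\<lbrakk>t \<in> \<T>; is_triangle C S t'; is_triangle_iso C S t t' m\<rbrakk> \<Longrightarrow> t' \<in> \<T>"
    and TR1_id:
      "\<lbrakk>X \<in> Obj C; zero_object C Z\<rbrakk> \<Longrightarrow> (Idn C X, Zero C X Z, Zero C Z (FObj S X)) \<in> \<T>"
    and TR1_cone:
      "u \<in> Arr C \<Longrightarrow> \<exists>v w. (u, v, w) \<in> \<T>"
    and TR2:
      "is_triangle C S (u, v, w) \<Longrightarrow> (u, v, w) \<in> \<T> \<longleftrightarrow> (v, w, Neg C (FArr S u)) \<in> \<T>"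
    and TR3:
      "\<lbrakk>(u, v, w) \<in> \<T>; (u', v', w') \<in> \<T>;
        a \<in> Hom C (Dom C u) (Dom C u'); b \<in> Hom C (Cod C u) (Cod C u'); b \<cdot> u = u' \<cdot> a\<rbrakk>
       \<Longrightarrow> \<exists>c. is_triangle_morphism C S (u, v, w) (u', v', w') (a, b, c)"

text \<open>In \<open>TR4\<close> the triangles starting at \<open>u: X \<rightarrow> Y\<close>, \<open>v: Y \<rightarrow> Z\<close> and \<open>vu\<close> have third objects
  \<open>Z'\<close>, \<open>X'\<close> and \<open>Y'\<close>; the new triangle is \<open>Z' \<rightarrow> Y' \<rightarrow> X' \<rightarrow> \<Sigma>Z'\<close>.\<close>

locale triangulated_category = pre_triangulated_category +
  assumes TR4:
    "\<lbrakk>u \<in> Hom C X Y; v \<in> Hom C Y Z;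
      (u, i, i') \<in> \<T>; (v, j, j') \<in> \<T>; (v \<cdot> u, k, k') \<in> \<T>\<rbrakk>
     \<Longrightarrow> \<exists>f g.
           is_triangle_morphism C S (u, i, i') (v \<cdot> u, k, k') (Idn C X, v, f) \<and>
           is_triangle_morphism C S (v \<cdot> u, k, k') (v, j, j') (u, Idn C Z, g) \<and>
           (f, g, FArr S i \<cdot> j') \<in> \<T>"

text \<open>The image of a triangle under a functor \<open>F\<close> to \<open>D\<close> with connecting isomorphism
  \<open>\<theta>: F\<Sigma> \<rightarrow> \<Sigma>F\<close> is \<open>(F u, F v, \<theta>\<^sub>X \<circ> F w)\<close>, where \<open>X\<close> is the first object.\<close>

definition triangle_image ::
  "('o1, 'm1, 'x1) cat_scheme \<Rightarrow> ('o2, 'm2, 'x2) cat_scheme \<Rightarrow>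
   ('o1, 'm1, 'o2, 'm2) func \<Rightarrow> ('o1 \<Rightarrow> 'm2) \<Rightarrow> 'm1 triangle \<Rightarrow> 'm2 triangle" where
  "triangle_image C D F \<theta> = (\<lambda>(u, v, w). (FArr F u, FArr F v, \<theta> (Dom C u) \<cdot>\<^bsub>D\<^esub> FArr F w))"

definition is_exact_functor ::
  "('o1, 'm1, 'x1) additive_cat_scheme \<Rightarrow> ('o1, 'm1, 'o1, 'm1) func \<Rightarrow> 'm1 triangle set \<Rightarrow>
   ('o2, 'm2, 'x2) additive_cat_scheme \<Rightarrow> ('o2, 'm2, 'o2, 'm2) func \<Rightarrow> 'm2 triangle set \<Rightarrow>
   ('o1, 'm1, 'o2, 'm2) func \<Rightarrow> ('o1 \<Rightarrow> 'm2) \<Rightarrow> bool" where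
  "is_exact_functor C S \<T> D S' \<T>' F \<theta> \<longleftrightarrow>
     is_additive_functor C D F \<and>
     is_nat_iso C D (comp_func F S) (comp_func S' F) \<theta> \<and>
     (\<forall>t \<in> \<T>. triangle_image C D F \<theta> t \<in> \<T>')"

section \<open>Admissible actions and equivariant objects\<close>

text \<open>Right-action convention: \<open>\<delta> g h: F\<^sub>g F\<^sub>h \<rightarrow> F\<^sub>h\<^sub>g\<close>.\<close>

locale admissible_action = triangulated_category C S \<T> + group G
  for C :: "('o, 'm, 'x) additive_cat_scheme" (structure)
    and S :: "('o, 'm, 'o, 'm) func"
    and \<T> :: "'m triangle set"
    and G :: "('g, 'y) monoid_scheme"
    and F :: "'g \<Rightarrow> ('o, 'm, 'o, 'm) func"
    and \<theta> :: "'g \<Rightarrow> 'o \<Rightarrow> 'm"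
    and \<delta> :: "'g \<Rightarrow> 'g \<Rightarrow> 'o \<Rightarrow> 'm" +
  assumes F_exact: "g \<in> carrier G \<Longrightarrow> is_exact_functor C S \<T> C S \<T> (F g) (\<theta> g)"
    and F_equivalence: "g \<in> carrier G \<Longrightarrow> is_equivalence C C (F g)"
    and \<delta>_nat_iso:
      "\<lbrakk>g \<in> carrier G; h \<in> carrier G\<rbrakk>
       \<Longrightarrow> is_nat_iso C C (comp_func (F g) (F h)) (F (h \<otimes>\<^bsub>G\<^esub> g)) (\<delta> g h)"
    and \<delta>_coherence:
      "\<lbrakk>g \<in> carrier G; h \<in> carrier G; l \<in> carrier G; X \<in> Obj C\<rbrakk>
       \<Longrightarrow> \<delta> (h \<otimes>\<^bsub>G\<^esub> g) l X \<cdot>\<^bsub>C\<^esub> \<delta> g h (FObj (F l) X)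
           = \<delta> g (l \<otimes>\<^bsub>G\<^esub> h) X \<cdot>\<^bsub>C\<^esub> FArr (F g) (\<delta> h l X)"
    and \<theta>_\<delta>_compat:
      "\<lbrakk>g \<in> carrier G; h \<in> carrier G; X \<in> Obj C\<rbrakk>
       \<Longrightarrow> \<theta> (h \<otimes>\<^bsub>G\<^esub> g) X \<cdot>\<^bsub>C\<^esub> \<delta> g h (FObj S X)
           = FArr S (\<delta> g h X) \<cdot>\<^bsub>C\<^esub> \<theta> g (FObj (F h) X) \<cdot>\<^bsub>C\<^esub> FArr (F g) (\<theta> h X)"

text \<open>The families \<open>\<phi>\<close> are extensional on the carrier of \<open>G\<close>, so that equality of equivariant
  objects is equality of their structure maps.  Arrows of the equivariant category carry their
  source and target, because one arrow of \<open>C\<close> may be equivariant for several structures.\<close>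

type_synonym ('g, 'o, 'm) eqv_obj = "'o \<times> ('g \<Rightarrow> 'm)"
type_synonym ('g, 'o, 'm) eqv_arr = "('g, 'o, 'm) eqv_obj \<times> 'm \<times> ('g, 'o, 'm) eqv_obj"

definition equivariant_objects ::
  "('o, 'm, 'x) cat_scheme \<Rightarrow> ('g, 'y) monoid_scheme \<Rightarrow> ('g \<Rightarrow> ('o, 'm, 'o, 'm) func) \<Rightarrow>
   ('g \<Rightarrow> 'g \<Rightarrow> 'o \<Rightarrow> 'm) \<Rightarrow> ('g, 'o, 'm) eqv_obj set" where
  "equivariant_objects C G F \<delta> = {(X, \<phi>).
     X \<in> Obj C \<and>
     \<phi> \<in> (\<Pi>\<^sub>E g \<in> carrier G. {f \<in> Hom C (FObj (F g) X) X. is_iso C f}) \<and>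
     (\<forall>g \<in> carrier G. \<forall>h \<in> carrier G.
        \<phi> g \<cdot>\<^bsub>C\<^esub> FArr (F g) (\<phi> h) = \<phi> (h \<otimes>\<^bsub>G\<^esub> g) \<cdot>\<^bsub>C\<^esub> \<delta> g h X)}"

definition equivariant_arrows ::
  "('o, 'm, 'x) cat_scheme \<Rightarrow> ('g, 'y) monoid_scheme \<Rightarrow> ('g \<Rightarrow> ('o, 'm, 'o, 'm) func) \<Rightarrow>
   ('g \<Rightarrow> 'g \<Rightarrow> 'o \<Rightarrow> 'm) \<Rightarrow> ('g, 'o, 'm) eqv_arr set" where
  "equivariant_arrows C G F \<delta> = {((X, \<phi>), a, (Y, \<psi>)).
     (X, \<phi>) \<in> equivariant_objects C G F \<delta> \<and> (Y, \<psi>) \<in> equivariant_objects C G F \<delta> \<and>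
     a \<in> Hom C X Y \<and> (\<forall>g \<in> carrier G. a \<cdot>\<^bsub>C\<^esub> \<phi> g = \<psi> g \<cdot>\<^bsub>C\<^esub> FArr (F g) a)}"

definition equivariant_category ::
  "('o, 'm, 'x) additive_cat_scheme \<Rightarrow> ('g, 'y) monoid_scheme \<Rightarrow> ('g \<Rightarrow> ('o, 'm, 'o, 'm) func) \<Rightarrow>
   ('g \<Rightarrow> 'g \<Rightarrow> 'o \<Rightarrow> 'm) \<Rightarrow> (('g, 'o, 'm) eqv_obj, ('g, 'o, 'm) eqv_arr) additive_cat" where
  "equivariant_category C G F \<delta> =
     \<lparr>Obj = equivariant_objects C G F \<delta>,
      Arr = equivariant_arrows C G F \<delta>,
      Dom = (\<lambda>(A, a, B). A),
      Cod = (\<lambda>(A, a, B). B),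
      Idn = (\<lambda>A. (A, Idn C (fst A), A)),
      Cmp = (\<lambda>(B', b, D) (A, a, B). (A, b \<cdot>\<^bsub>C\<^esub> a, D)),
      Zero = (\<lambda>A B. (A, Zero C (fst A) (fst B), B)),
      Add = (\<lambda>(A, a, B) (A', a', B'). (A, Add C a a', B))\<rparr>"

definition forgetful :: "(('g, 'o, 'm) eqv_obj, ('g, 'o, 'm) eqv_arr, 'o, 'm) func" where
  "forgetful = \<lparr>FObj = (\<lambda>(X, \<phi>). X), FArr = (\<lambda>(A, a, B). a)\<rparr>"

definition equivariant_susp_obj ::
  "('o, 'm, 'x) cat_scheme \<Rightarrow> ('o, 'm, 'o, 'm) func \<Rightarrow> ('g, 'y) monoid_scheme \<Rightarrow>
   ('g \<Rightarrow> 'o \<Rightarrow> 'm) \<Rightarrow> ('g, 'o, 'm) eqv_obj \<Rightarrow> ('g, 'o, 'm) eqv_obj" where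
  "equivariant_susp_obj C S G \<theta> =
     (\<lambda>(X, \<phi>). (FObj S X, \<lambda>g \<in> carrier G. FArr S (\<phi> g) \<cdot>\<^bsub>C\<^esub> \<theta> g X))"

definition equivariant_susp ::
  "('o, 'm, 'x) cat_scheme \<Rightarrow> ('o, 'm, 'o, 'm) func \<Rightarrow> ('g, 'y) monoid_scheme \<Rightarrow>
   ('g \<Rightarrow> 'o \<Rightarrow> 'm) \<Rightarrow>
   (('g, 'o, 'm) eqv_obj, ('g, 'o, 'm) eqv_arr, ('g, 'o, 'm) eqv_obj, ('g, 'o, 'm) eqv_arr) func" where
  "equivariant_susp C S G \<theta> =
     \<lparr>FObj = equivariant_susp_obj C S G \<theta>,
      FArr = (\<lambda>(A, a, B).
        (equivariant_susp_obj C S G \<theta> A, FArr S a, equivariant_susp_obj C S G \<theta> B))\<rparr>"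

text \<open>The forgetful functor commutes strictly with the suspensions, so its connecting
  isomorphism is the identity.\<close>

definition forgetful_image ::
  "('o, 'm, 'x) additive_cat_scheme \<Rightarrow> ('o, 'm, 'o, 'm) func \<Rightarrow> ('g, 'y) monoid_scheme \<Rightarrow>
   ('g \<Rightarrow> ('o, 'm, 'o, 'm) func) \<Rightarrow> ('g \<Rightarrow> 'g \<Rightarrow> 'o \<Rightarrow> 'm) \<Rightarrow>
   ('g, 'o, 'm) eqv_arr triangle \<Rightarrow> 'm triangle" where
  "forgetful_image C S G F \<delta> =
     triangle_image (equivariant_category C G F \<delta>) C forgetful
       (\<lambda>A. Idn C (FObj S (FObj forgetful A)))"

definition canonical_triangles ::
  "('o, 'm, 'x) additive_cat_scheme \<Rightarrow> ('o, 'm, 'o, 'm) func \<Rightarrow> 'm triangle set \<Rightarrow>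
   ('g, 'y) monoid_scheme \<Rightarrow> ('g \<Rightarrow> ('o, 'm, 'o, 'm) func) \<Rightarrow> ('g \<Rightarrow> 'o \<Rightarrow> 'm) \<Rightarrow>
   ('g \<Rightarrow> 'g \<Rightarrow> 'o \<Rightarrow> 'm) \<Rightarrow> ('g, 'o, 'm) eqv_arr triangle set" where
  "canonical_triangles C S \<T> G F \<theta> \<delta> =
     {t. is_triangle (equivariant_category C G F \<delta>) (equivariant_susp C S G \<theta>) t \<and>
         forgetful_image C S G F \<delta> t \<in> \<T>}"

end

theory Submission
  imports Defs "HOL-Algebra.FiniteProduct"
begin

text \<open>
  Conjugation by the structure maps makes \<open>G\<close> act on \<open>C(X, Y)\<close> for equivariant \<open>X\<close> and \<open>Y\<close>; the
  fixed points are the equivariant maps, and averaging over \<open>G\<close> projects onto them.  Averaging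
  gives TR3 at once, and it also repairs the non-coherent structure maps that TR3 in \<open>C\<close> provides on
  the cone of an equivariant map.

  An average of octahedra need not be an octahedron, because distinguished triangles are not closed
  under averaging.  For TR4 the third object is therefore chosen as the cone of
  \<open>(v, -i): Y \<rightarrow> Z \<oplus> Z'\<close>, formed equivariantly.  Two maps of the octahedron are then equivariant for
  free, and each of the other two is known to become equivariant after composition with two
  equivariant maps.  This forces products of differences of its conjugates to vanish, so that the comparison
  maps between the conjugate triangles average to a unipotent map, and the average of the conjugate
  triangles is again distinguished.
\<close>

section \<open>Means in abelian groups\<close>

text \<open>TR3 gives a third map without uniqueness, so nothing built from it respects the action
  by itself. What replaces uniqueness: two third maps over the same pair differ by a map that
  factors through the connecting map of the source and is killed by that of the target. A composite
  of two such differences is zero, so coherence of repaired structure maps meets no terms of higher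
  order.

  For the octahedron, let \<open>t\<close> be the map from \<open>Z \<oplus> Z'\<close> to the
  chosen cone. For each of the two doubtful maps \<open>g\<close>, both \<open>g t\<close> and some
  \<open>m g\<close> are equivariant, where \<open>m\<close> follows a map \<open>g t y\<close> in a
  distinguished triangle. The difference between a conjugate of \<open>g\<close> and
  \<open>g\<close> is killed by \<open>m\<close>, so it equals \<open>g t y e\<close> and lifts
  along \<open>g\<close> to \<open>t y e\<close>; every such difference also kills \<open>t\<close>.
  Hence the products vanish. Fixing one cone loses nothing, since cones of one map are isomorphic
  and octahedra can be transported along the isomorphism.\<close>

context comm_group
begin

text \<open>Hom groups are written multiplicatively as library monoids, so the
  \<open>card I\<close>-th root of a product stands for a sum divided by \<open>card I\<close>. No
  inverse scalar is at hand; the root is picked by description and is meaningful under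
  \<open>divisible_by\<close>.\<close>

definition mean :: "'i set \<Rightarrow> ('i \<Rightarrow> 'a) \<Rightarrow> 'a" where
  "mean I f = (THE x. x \<in> carrier G \<and> x [^] card I = finprod G f I)"

definition divisible_by :: "nat \<Rightarrow> bool" where
  "divisible_by n \<longleftrightarrow> bij_betw (\<lambda>x. x [^] n) (carrier G) (carrier G)"

lemma mean_unique_root:
  assumes "divisible_by (card I)" "f \<in> I \<rightarrow> carrier G"
  shows "\<exists>!x. x \<in> carrier G \<and> x [^] card I = finprod G f I"
proof -
  have "finprod G f I \<in> carrier G" using assms(2) by (rule finprod_closed)
  then show ?thesis
    using assms(1) unfolding divisible_by_def bij_betw_def inj_on_def by (metis (no_types, lifting) imageE)
qed

lemma mean_closed [intro]:
  assumes "divisible_by (card I)" "f \<in> I \<rightarrow> carrier G"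
  shows "mean I f \<in> carrier G"
  using theI'[OF mean_unique_root[OF assms]] unfolding mean_def by blast

lemma mean_pow:
  assumes "divisible_by (card I)" "f \<in> I \<rightarrow> carrier G"
  shows "mean I f [^] card I = finprod G f I"
  using theI'[OF mean_unique_root[OF assms]] unfolding mean_def by blast

lemma mean_eqI:
  assumes "divisible_by (card I)" "f \<in> I \<rightarrow> carrier G"
    and "x \<in> carrier G" "x [^] card I = finprod G f I"
  shows "mean I f = x"
  using mean_unique_root[OF assms(1,2)] mean_closed[OF assms(1,2)] mean_pow[OF assms(1,2)] assms(3,4)
  by blast

lemma mean_const:
  assumes "divisible_by (card I)" "x \<in> carrier G"
  shows "mean I (\<lambda>_. x) = x"
  using assms by (intro mean_eqI) (auto simp: finprod_const)

lemma mean_mult: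
  assumes "divisible_by (card I)" "f \<in> I \<rightarrow> carrier G" "g \<in> I \<rightarrow> carrier G"
  shows "mean I (\<lambda>i. f i \<otimes> g i) = mean I f \<otimes> mean I g"
proof (rule mean_eqI)
  show "(mean I f \<otimes> mean I g) [^] card I = finprod G (\<lambda>i. f i \<otimes> g i) I"
    using assms by (simp add: finprod_multf mean_pow pow_mult_distrib mean_closed m_comm)
qed (use assms in \<open>auto simp: mean_closed\<close>)

lemma mean_cong:
  assumes "\<And>i. i \<in> I \<Longrightarrow> f i = g i" "g \<in> I \<rightarrow> carrier G"
  shows "mean I f = mean I g"
proof -
  have "finprod G f I = finprod G g I"
    using assms by (intro finprod_cong') auto
  then show ?thesis by (simp add: mean_def)
qed

lemma mean_reindex:
  assumes "bij_betw s I I" "f \<in> I \<rightarrow> carrier G"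
  shows "mean I (\<lambda>i. f (s i)) = mean I f"
proof -
  have "finprod G (\<lambda>i. f (s i)) I = finprod G f I"
    using assms finprod_reindex[of f s I] by (auto simp: bij_betw_def)
  then show ?thesis by (simp add: mean_def)
qed

text \<open>A homomorphism sends the root to a root of the image product, and unique divisibility of
  the target identifies that root with the mean there. Compatibility of averages with composition,
  additive functors and conjugation specialises this.\<close>

lemma mean_hom:
  assumes "comm_group H" "divisible_by (card I)" "comm_group.divisible_by H (card I)"
    and f: "f \<in> I \<rightarrow> carrier G" and h: "h \<in> hom G H" and "finite I"
  shows "h (mean I f) = comm_group.mean H I (\<lambda>i. h (f i))"
proof -
  interpret H: comm_group H by fact
  interpret h: group_hom G H h by unfold_locales (rule h)
  have hf: "(\<lambda>i. h (f i)) \<in> I \<rightarrow> carrier H" using f h.hom_closed by (auto simp: Pi_iff)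
  have "h (finprod G f I) = finprod H (\<lambda>i. h (f i)) I"
    using \<open>finite I\<close> f
    by (induction I rule: finite_induct) (auto simp: Pi_iff)
  then show ?thesis
    using assms hf by (intro H.mean_eqI[symmetric]) (auto simp: h.hom_nat_pow[symmetric] mean_closed mean_pow)
qed

end

section \<open>Categories and preadditive categories\<close>

text \<open>As a simp rule this dissolves Hom-sets into conditions on \<open>Arr\<close>,
  \<open>Dom\<close> and \<open>Cod\<close>, the form in which most later simp rules state their
  typing hypotheses.\<close>

lemma mem_Hom_iff [simp]: "f \<in> Hom C X Y \<longleftrightarrow> f \<in> Arr C \<and> Dom C f = X \<and> Cod C f = Y"
  by (auto simp: Hom_def)

context category
begin

lemma Idn_simps [simp]:
  assumes "X \<in> Obj C"
  shows "Idn C X \<in> Arr C" "Dom C (Idn C X) = X" "Cod C (Idn C X) = X"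
  using Idn_in_Hom[OF assms] by auto

lemma Cmp_simps [simp]:
  assumes "f \<in> Arr C" "g \<in> Arr C" "Cod C f = Dom C g"
  shows "g \<cdot> f \<in> Arr C" "Dom C (g \<cdot> f) = Dom C f" "Cod C (g \<cdot> f) = Cod C g"
  using Cmp_in_Hom[of f "Dom C f" "Cod C f" g "Cod C g"] assms by auto

lemma Obj_simps [simp]:
  assumes "f \<in> Arr C"
  shows "Dom C f \<in> Obj C" "Cod C f \<in> Obj C"
  using assms Dom_in_Obj Cod_in_Obj by auto

lemma Cmp_Idn [simp]:
  assumes "f \<in> Arr C"
  shows "Dom C f = X \<Longrightarrow> f \<cdot> Idn C X = f" "Cod C f = X \<Longrightarrow> Idn C X \<cdot> f = f"
  using assms Cmp_Idn_left[of f] Cmp_Idn_right[of f] by auto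

lemma Cmp_assoc_simp [simp]:
  assumes "f \<in> Arr C" "g \<in> Arr C" "h \<in> Arr C" "Cod C f = Dom C g" "Cod C g = Dom C h"
  shows "(h \<cdot> g) \<cdot> f = h \<cdot> (g \<cdot> f)"
  using assms Cmp_assoc[of f "Dom C f" "Cod C f" g "Cod C g" h "Cod C h"] by auto

text \<open>The simp normal form nests composites to the right, which hides the factor
  \<open>h \<cdot> g\<close>. An equation for it has to be given in this extended form to rewrite
  the head of a longer composite.\<close>

lemma Cmp_reassoc:
  assumes "h \<cdot> g = k" "f \<in> Arr C" "g \<in> Arr C" "h \<in> Arr C" "Cod C f = Dom C g" "Cod C g = Dom C h"
  shows "h \<cdot> (g \<cdot> f) = k \<cdot> f"
  using assms Cmp_assoc_simp by metis

definition Inv :: "'m \<Rightarrow> 'm" where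
  "Inv f = (THE g. g \<in> Hom C (Cod C f) (Dom C f) \<and>
      g \<cdot> f = Idn C (Dom C f) \<and> f \<cdot> g = Idn C (Cod C f))"

lemma is_iso_Arr: "is_iso C f \<Longrightarrow> f \<in> Arr C"
  by (simp add: is_iso_def)

lemma is_isoI:
  assumes "f \<in> Arr C" "g \<in> Arr C" "Dom C g = Cod C f" "Cod C g = Dom C f"
    and "g \<cdot> f = Idn C (Dom C f)" "f \<cdot> g = Idn C (Cod C f)"
  shows "is_iso C f"
  using assms by (auto simp: is_iso_def)

lemma Inv_simps:
  assumes "is_iso C f"
  shows Inv_Arr: "Inv f \<in> Arr C" and Dom_Inv: "Dom C (Inv f) = Cod C f"
    and Cod_Inv: "Cod C (Inv f) = Dom C f"
    and Inv_left: "Inv f \<cdot> f = Idn C (Dom C f)" and Inv_right: "f \<cdot> Inv f = Idn C (Cod C f)"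
proof -
  obtain g where g: "g \<in> Hom C (Cod C f) (Dom C f)"
      "g \<cdot> f = Idn C (Dom C f)" "f \<cdot> g = Idn C (Cod C f)"
    and f: "f \<in> Arr C"
    using assms unfolding is_iso_def by blast
  have "h = g" if h: "h \<in> Hom C (Cod C f) (Dom C f)" "h \<cdot> f = Idn C (Dom C f)" for h
  proof -
    have "h = h \<cdot> (f \<cdot> g)" using h g f by simp
    also have "\<dots> = (h \<cdot> f) \<cdot> g" using h(1) g f by simp
    also have "\<dots> = g" using h g(1) f by simp
    finally show ?thesis .
  qed
  then have "\<exists>!g. g \<in> Hom C (Cod C f) (Dom C f) \<and> g \<cdot> f = Idn C (Dom C f) \<and> f \<cdot> g = Idn C (Cod C f)"
    using g by blast
  from theI'[OF this, folded Inv_def]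
  show "Inv f \<in> Arr C" "Dom C (Inv f) = Cod C f" "Cod C (Inv f) = Dom C f"
    "Inv f \<cdot> f = Idn C (Dom C f)" "f \<cdot> Inv f = Idn C (Cod C f)"
    by auto
qed

lemmas Inv_type [simp] = Inv_Arr Dom_Inv Cod_Inv

lemma Inv_cancel [simp]:
  assumes "is_iso C f"
  shows "Dom C f = X \<Longrightarrow> Inv f \<cdot> f = Idn C X" "Cod C f = X \<Longrightarrow> f \<cdot> Inv f = Idn C X"
    "h \<in> Arr C \<Longrightarrow> Cod C h = Dom C f \<Longrightarrow> Inv f \<cdot> (f \<cdot> h) = h"
    "h \<in> Arr C \<Longrightarrow> Cod C h = Cod C f \<Longrightarrow> f \<cdot> (Inv f \<cdot> h) = h"
proof -
  note [simp] = Inv_simps[OF assms] is_iso_Arr[OF assms]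
  show "Dom C f = X \<Longrightarrow> Inv f \<cdot> f = Idn C X" "Cod C f = X \<Longrightarrow> f \<cdot> Inv f = Idn C X"
    by auto
  show "h \<in> Arr C \<Longrightarrow> Cod C h = Dom C f \<Longrightarrow> Inv f \<cdot> (f \<cdot> h) = h"
    by (subst Cmp_assoc_simp[symmetric]) auto
  show "h \<in> Arr C \<Longrightarrow> Cod C h = Cod C f \<Longrightarrow> f \<cdot> (Inv f \<cdot> h) = h"
    by (subst Cmp_assoc_simp[symmetric]) auto
qed

lemma is_iso_Inv: "is_iso C f \<Longrightarrow> is_iso C (Inv f)"
  by (rule is_isoI[of _ f]) (auto simp: is_iso_Arr)

lemma is_iso_Idn: "X \<in> Obj C \<Longrightarrow> is_iso C (Idn C X)"
  by (rule is_isoI[of _ "Idn C X"]) auto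

lemma is_iso_Cmp:
  assumes "is_iso C f" "is_iso C g" "Cod C f = Dom C g"
  shows "is_iso C (g \<cdot> f)"
  using assms by (intro is_isoI[of _ "Inv f \<cdot> Inv g"]) (auto simp: is_iso_Arr)

lemma iso_cancel_left:
  assumes "is_iso C f" "f \<cdot> a = f \<cdot> b" "a \<in> Arr C" "b \<in> Arr C" "Cod C a = Dom C f" "Cod C b = Dom C f"
  shows "a = b"
  using assms Inv_cancel(3) by metis

lemma iso_cancel_right:
  assumes "is_iso C f" "a \<cdot> f = b \<cdot> f" "a \<in> Arr C" "b \<in> Arr C" "Dom C a = Cod C f" "Dom C b = Cod C f"
  shows "a = b"
proof -
  have "a = (a \<cdot> f) \<cdot> Inv f" "b = (b \<cdot> f) \<cdot> Inv f"
    using assms(1,3-) is_iso_Arr[OF assms(1)] by simp_all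
  then show ?thesis using assms(2) by metis
qed

text \<open>One composite yields a left inverse of \<open>f\<close>, the other a right inverse, and
  the two coincide. It serves when maps compose with \<open>f\<close> to isomorphisms without being
  inverse to it.\<close>

lemma is_isoI_two_sided:
  assumes [simp]: "f \<in> Arr C" "l \<in> Arr C" "r \<in> Arr C" "Dom C l = Cod C f" "Cod C r = Dom C f"
    and lf: "is_iso C (l \<cdot> f)" and fr: "is_iso C (f \<cdot> r)"
  shows "is_iso C f"
proof -
  define l' r' where "l' = Inv (l \<cdot> f) \<cdot> l" and "r' = r \<cdot> Inv (f \<cdot> r)"
  have [simp]: "l' \<in> Arr C" "r' \<in> Arr C" "Dom C l' = Cod C f" "Cod C l' = Dom C f"
     "Dom C r' = Cod C f" "Cod C r' = Dom C f"
    using lf fr by (auto simp: l'_def r'_def)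
  have l: "l' \<cdot> f = Idn C (Dom C f)" using lf Inv_left[OF lf] by (simp add: l'_def)
  have r: "f \<cdot> r' = Idn C (Cod C f)"
    using fr Inv_right[OF fr] by (simp add: r'_def Cmp_assoc_simp[symmetric] del: Cmp_assoc_simp)
  have "l' = l' \<cdot> (f \<cdot> r')" by (simp add: r)
  also have "\<dots> = (l' \<cdot> f) \<cdot> r'" by (subst Cmp_assoc_simp) auto
  also have "\<dots> = r'" by (simp add: l)
  finally show ?thesis using l r by (intro is_isoI[of _ l']) auto
qed

end

section \<open>Additive calculus of morphisms\<close>

context preadditive_category
begin

abbreviation add (infixl "\<oplus>" 65) where "f \<oplus> g \<equiv> Add C f g"
abbreviation sub (infixl "\<ominus>" 65) where "f \<ominus> g \<equiv> Add C f (Neg C g)"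

lemma hom_group_simps [simp]:
  "carrier (hom_group C X Y) = Hom C X Y" "mult (hom_group C X Y) = Add C"
  "one (hom_group C X Y) = Zero C X Y"
  by (auto simp: hom_group_def)

lemma Add_simps [simp]:
  assumes "f \<in> Arr C" "g \<in> Arr C" "Dom C f = Dom C g" "Cod C f = Cod C g"
  shows "f \<oplus> g \<in> Arr C" "Dom C (f \<oplus> g) = Dom C g" "Cod C (f \<oplus> g) = Cod C g"
proof -
  interpret comm_group "hom_group C (Dom C f) (Cod C f)" using assms by (intro hom_comm_group) auto
  have "f \<oplus> g \<in> Hom C (Dom C f) (Cod C f)"
    using m_closed[of f g] assms by simp
  then show "f \<oplus> g \<in> Arr C" "Dom C (f \<oplus> g) = Dom C g" "Cod C (f \<oplus> g) = Cod C g"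
    using assms by auto
qed

lemma Zero_simps [simp]:
  assumes "X \<in> Obj C" "Y \<in> Obj C"
  shows "Zero C X Y \<in> Arr C" "Dom C (Zero C X Y) = X" "Cod C (Zero C X Y) = Y"
proof -
  interpret comm_group "hom_group C X Y" using assms by (intro hom_comm_group) auto
  show "Zero C X Y \<in> Arr C" "Dom C (Zero C X Y) = X" "Cod C (Zero C X Y) = Y"
    using one_closed by auto
qed

lemma Neg_simps [simp]:
  assumes "f \<in> Arr C"
  shows "Neg C f \<in> Arr C" "Dom C (Neg C f) = Dom C f" "Cod C (Neg C f) = Cod C f"
proof -
  interpret comm_group "hom_group C (Dom C f) (Cod C f)" using assms by (intro hom_comm_group) auto
  have "Neg C f \<in> Hom C (Dom C f) (Cod C f)"
    using inv_closed[of f] assms unfolding Neg_def by simp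
  then show "Neg C f \<in> Arr C" "Dom C (Neg C f) = Dom C f" "Cod C (Neg C f) = Cod C f"
    using assms by auto
qed

lemma Add_Zero [simp]:
  assumes "f \<in> Arr C" "Dom C f = X" "Cod C f = Y"
  shows "f \<oplus> Zero C X Y = f" "Zero C X Y \<oplus> f = f"
proof -
  interpret comm_group "hom_group C X Y" using assms by (intro hom_comm_group) auto
  show "f \<oplus> Zero C X Y = f" "Zero C X Y \<oplus> f = f"
    using r_one[of f] l_one[of f] assms by auto
qed

lemma Add_comm:
  assumes "f \<in> Arr C" "g \<in> Arr C" "Dom C f = Dom C g" "Cod C f = Cod C g"
  shows "f \<oplus> g = g \<oplus> f"
proof -
  interpret comm_group "hom_group C (Dom C f) (Cod C f)" using assms by (intro hom_comm_group) auto
  show ?thesis using m_comm[of f g] assms by simp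
qed

lemma Add_assoc:
  assumes "f \<in> Arr C" "g \<in> Arr C" "h \<in> Arr C" "Dom C f = Dom C g" "Cod C f = Cod C g"
    "Dom C h = Dom C g" "Cod C h = Cod C g"
  shows "(f \<oplus> g) \<oplus> h = f \<oplus> (g \<oplus> h)"
proof -
  interpret comm_group "hom_group C (Dom C f) (Cod C f)" using assms by (intro hom_comm_group) auto
  show ?thesis using m_assoc[of f g h] assms by simp
qed

lemma Add_lcomm:
  assumes "f \<in> Arr C" "g \<in> Arr C" "h \<in> Arr C" "Dom C f = Dom C g" "Cod C f = Cod C g"
    "Dom C h = Dom C g" "Cod C h = Cod C g"
  shows "f \<oplus> (g \<oplus> h) = g \<oplus> (f \<oplus> h)"
proof -
  interpret comm_group "hom_group C (Dom C f) (Cod C f)" using assms by (intro hom_comm_group) auto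
  show ?thesis using m_lcomm[of f g h] assms by simp
qed

lemma Add_Neg [simp]:
  assumes "f \<in> Arr C"
  shows "f \<ominus> f = Zero C (Dom C f) (Cod C f)" "Neg C f \<oplus> f = Zero C (Dom C f) (Cod C f)"
proof -
  interpret comm_group "hom_group C (Dom C f) (Cod C f)" using assms by (intro hom_comm_group) auto
  show "f \<ominus> f = Zero C (Dom C f) (Cod C f)" "Neg C f \<oplus> f = Zero C (Dom C f) (Cod C f)"
    using l_inv[of f] r_inv[of f] assms by (auto simp: Neg_def)
qed

lemma Add_Neg_cancel [simp]:
  assumes "f \<in> Arr C" "g \<in> Arr C" "Dom C f = Dom C g" "Cod C f = Cod C g"
  shows "f \<oplus> (Neg C f \<oplus> g) = g" "Neg C f \<oplus> (f \<oplus> g) = g"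
  using assms by (simp_all add: Add_assoc[symmetric])

lemma Neg_unique:
  assumes "f \<in> Arr C" "g \<in> Arr C" "Dom C f = Dom C g" "Cod C f = Cod C g"
    and "f \<oplus> g = Zero C (Dom C f) (Cod C f)"
  shows "Neg C f = g"
proof -
  have "g = Neg C f \<oplus> (f \<oplus> g)" using assms(1-4) by simp
  also have "\<dots> = Neg C f" using assms by simp
  finally show ?thesis ..
qed

lemma sub_eq_ZeroD:
  assumes "f \<ominus> g = Zero C X Y" "f \<in> Arr C" "g \<in> Arr C" "Dom C f = X" "Dom C g = X" "Cod C f = Y" "Cod C g = Y"
  shows "f = g"
proof -
  have "f = (f \<ominus> g) \<oplus> g" using assms(2-) by (subst Add_assoc) auto
  also have "\<dots> = g" using assms by simp
  finally show ?thesis .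
qed

lemma Neg_Neg [simp]: "f \<in> Arr C \<Longrightarrow> Neg C (Neg C f) = f"
  by (rule Neg_unique) auto

lemma Neg_Zero [simp]: "X \<in> Obj C \<Longrightarrow> Y \<in> Obj C \<Longrightarrow> Neg C (Zero C X Y) = Zero C X Y"
  by (rule Neg_unique) auto

lemma Neg_Add:
  assumes "f \<in> Arr C" "g \<in> Arr C" "Dom C f = Dom C g" "Cod C f = Cod C g"
  shows "Neg C (f \<oplus> g) = Neg C f \<oplus> Neg C g"
proof (rule Neg_unique)
  have "(f \<oplus> g) \<oplus> (Neg C f \<oplus> Neg C g) = f \<oplus> (Neg C f \<oplus> (g \<oplus> Neg C g))"
    using assms by (simp add: Add_assoc Add_lcomm)
  then show "f \<oplus> g \<oplus> (Neg C f \<oplus> Neg C g) = Zero C (Dom C (f \<oplus> g)) (Cod C (f \<oplus> g))"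
    using assms by (simp del: Add_Neg_cancel)
qed (use assms in auto)

lemma Cmp_Add:
  assumes "f \<in> Arr C" "g \<in> Arr C" "Dom C f = Dom C g" "Cod C f = Cod C g" "h \<in> Arr C" "Cod C g = Dom C h"
  shows "h \<cdot> (f \<oplus> g) = h \<cdot> f \<oplus> h \<cdot> g"
  using hom_mult[OF postcomp_additive[of "Dom C f" h "Dom C h" "Cod C h"], of f g] assms by simp

lemma Add_Cmp:
  assumes "f \<in> Arr C" "g \<in> Arr C" "Dom C f = Dom C g" "Cod C f = Cod C g" "h \<in> Arr C" "Cod C h = Dom C g"
  shows "(f \<oplus> g) \<cdot> h = f \<cdot> h \<oplus> g \<cdot> h"
  using hom_mult[OF precomp_additive[of "Cod C f" h "Dom C h" "Cod C h"], of f g] assms by simp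

lemma Cmp_Zero [simp]:
  assumes "h \<in> Arr C" "X \<in> Obj C" "Dom C h = Y"
  shows "h \<cdot> Zero C X Y = Zero C X (Cod C h)"
proof -
  interpret A: comm_group "hom_group C X Y" using assms by (intro hom_comm_group) auto
  interpret B: comm_group "hom_group C X (Cod C h)" using assms by (intro hom_comm_group) auto
  interpret group_hom "hom_group C X Y" "hom_group C X (Cod C h)" "\<lambda>f. h \<cdot> f"
    using assms by unfold_locales (intro postcomp_additive, auto)
  show ?thesis using hom_one by simp
qed

lemma Zero_Cmp [simp]:
  assumes "h \<in> Arr C" "X \<in> Obj C" "Cod C h = Y"
  shows "Zero C Y X \<cdot> h = Zero C (Dom C h) X"
proof -
  interpret A: comm_group "hom_group C Y X" using assms by (intro hom_comm_group) auto
  interpret B: comm_group "hom_group C (Dom C h) X" using assms by (intro hom_comm_group) auto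
  interpret group_hom "hom_group C Y X" "hom_group C (Dom C h) X" "\<lambda>f. f \<cdot> h"
    using assms by unfold_locales (intro precomp_additive, auto)
  show ?thesis using hom_one by simp
qed

lemma Cmp_Neg [simp]:
  assumes "f \<in> Arr C" "h \<in> Arr C" "Cod C f = Dom C h"
  shows "h \<cdot> Neg C f = Neg C (h \<cdot> f)"
  using assms by (intro Neg_unique[symmetric]) (auto simp: Cmp_Add[symmetric])

lemma Neg_Cmp [simp]:
  assumes "f \<in> Arr C" "h \<in> Arr C" "Cod C f = Dom C h"
  shows "Neg C h \<cdot> f = Neg C (h \<cdot> f)"
  using assms by (intro Neg_unique[symmetric]) (auto simp: Add_Cmp[symmetric])

text \<open>The geometric series for the inverse stops at \<open>1 - a + a\<^sup>2\<close>. The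
  exponent three is the one that averaging of distinguished triangles produces; square-zero maps are
  covered as well.\<close>

lemma nilpotent_unipotent_iso:
  assumes [simp]: "a \<in> Arr C" "Dom C a = X" "Cod C a = X"
    and a3: "a \<cdot> (a \<cdot> a) = Zero C X X"
  shows "is_iso C (Idn C X \<oplus> a)"
proof -
  have [simp]: "X \<in> Obj C" using Dom_in_Obj[of a] by simp
  let ?b = "Idn C X \<oplus> (a \<cdot> a \<ominus> a)"
  have 2: "(a \<cdot> a \<ominus> a) \<oplus> (a \<ominus> a \<cdot> a) = Zero C X X"
    by (simp add: Add_assoc)
  show ?thesis
  proof (rule is_isoI[of _ ?b])
    show "?b \<cdot> (Idn C X \<oplus> a) = Idn C (Dom C (Idn C X \<oplus> a))"
      using 2 by (simp add: Cmp_Add Add_Cmp a3 Neg_Add Add_assoc Add_lcomm Add_comm)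
    show "(Idn C X \<oplus> a) \<cdot> ?b = Idn C (Cod C (Idn C X \<oplus> a))"
      using 2 by (simp add: Cmp_Add Add_Cmp a3 Neg_Add Add_assoc Add_lcomm Add_comm)
  qed auto
qed

end

section \<open>Functors and equivalences\<close>

lemma functor_simps:
  assumes "is_functor C D F"
  shows "X \<in> Obj C \<Longrightarrow> FObj F X \<in> Obj D"
    and "f \<in> Arr C \<Longrightarrow> FArr F f \<in> Arr D"
    and "f \<in> Arr C \<Longrightarrow> Dom D (FArr F f) = FObj F (Dom C f)"
    and "f \<in> Arr C \<Longrightarrow> Cod D (FArr F f) = FObj F (Cod C f)"
    and "X \<in> Obj C \<Longrightarrow> FArr F (Idn C X) = Idn D (FObj F X)"
    and "f \<in> Arr C \<Longrightarrow> g \<in> Arr C \<Longrightarrow> Cod C f = Dom C g \<Longrightarrow>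
      FArr F (g \<cdot>\<^bsub>C\<^esub> f) = FArr F g \<cdot>\<^bsub>D\<^esub> FArr F f"
  using assms by (auto simp: is_functor_def)

lemma functor_is_iso:
  assumes "category C" "category D" "is_functor C D F" "is_iso C f"
  shows "is_iso D (FArr F f)"
proof -
  interpret C: category C by fact
  interpret D: category D by fact
  note [simp] = functor_simps[OF assms(3)] C.is_iso_Arr[OF assms(4)]
  show ?thesis
    using assms(4) by (intro D.is_isoI[of _ "FArr F (C.Inv f)"]) (simp_all flip: functor_simps(6)[OF assms(3)])
qed

lemma comp_func_simps [simp]:
  "FObj (comp_func H F) X = FObj H (FObj F X)" "FArr (comp_func H F) f = FArr H (FArr F f)"
  by (auto simp: comp_func_def)

lemma id_func_simps [simp]: "FObj id_func X = X" "FArr id_func f = f"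
  by (auto simp: id_func_def)

lemma nat_isoD:
  assumes "is_nat_iso C D F H \<eta>"
  shows "X \<in> Obj C \<Longrightarrow> \<eta> X \<in> Arr D" "X \<in> Obj C \<Longrightarrow> Dom D (\<eta> X) = FObj F X"
    "X \<in> Obj C \<Longrightarrow> Cod D (\<eta> X) = FObj H X" "X \<in> Obj C \<Longrightarrow> is_iso D (\<eta> X)"
    "f \<in> Arr C \<Longrightarrow> \<eta> (Cod C f) \<cdot>\<^bsub>D\<^esub> FArr F f = FArr H f \<cdot>\<^bsub>D\<^esub> \<eta> (Dom C f)"
  using assms by (auto simp: is_nat_iso_def)

lemma additive_functor_simps:
  assumes "preadditive_category C" "preadditive_category D" "is_additive_functor C D F"
  shows "f \<in> Arr C \<Longrightarrow> g \<in> Arr C \<Longrightarrow> Dom C f = Dom C g \<Longrightarrow> Cod C f = Cod C g \<Longrightarrow>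
      FArr F (Add C f g) = Add D (FArr F f) (FArr F g)" (is "PROP ?add")
    and "X \<in> Obj C \<Longrightarrow> Y \<in> Obj C \<Longrightarrow> FArr F (Zero C X Y) = Zero D (FObj F X) (FObj F Y)" (is "PROP ?zero")
    and "f \<in> Arr C \<Longrightarrow> FArr F (Neg C f) = Neg D (FArr F f)" (is "PROP ?neg")
proof -
  interpret C: preadditive_category C by fact
  interpret D: preadditive_category D by fact
  have F: "is_functor C D F" using assms(3) by (simp add: is_additive_functor_def)
  note [simp] = functor_simps[OF F]
  have hom: "FArr F \<in> hom (hom_group C X Y) (hom_group D (FObj F X) (FObj F Y))"
    if "X \<in> Obj C" "Y \<in> Obj C" for X Y
    using assms(3) that by (simp add: is_additive_functor_def)
  have add: "FArr F (Add C f g) = Add D (FArr F f) (FArr F g)"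
    if "f \<in> Arr C" "g \<in> Arr C" "Dom C f = Dom C g" "Cod C f = Cod C g" for f g
    using hom_mult[OF hom[of "Dom C f" "Cod C f"], of f g] that by simp
  have zero: "FArr F (Zero C X Y) = Zero D (FObj F X) (FObj F Y)" if "X \<in> Obj C" "Y \<in> Obj C" for X Y
  proof -
    interpret A: comm_group "hom_group C X Y" by (intro C.hom_comm_group that)
    interpret B: comm_group "hom_group D (FObj F X) (FObj F Y)"
      using that by (intro D.hom_comm_group) auto
    interpret group_hom "hom_group C X Y" "hom_group D (FObj F X) (FObj F Y)" "FArr F"
      using that by unfold_locales (rule hom)
    show ?thesis using hom_one by simp
  qed
  show "PROP ?add" by (rule add)
  show "PROP ?zero" by (rule zero)
  show "PROP ?neg"
    by (intro D.Neg_unique[symmetric]) (simp_all flip: add add: zero)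
qed

text \<open>A quasi-inverse is built by choosing a preimage of each object and lifting maps along
  the chosen isomorphisms. Full faithfulness makes lifts unique, and the laws in \<open>C\<close>
  are checked after applying \<open>F\<close>.\<close>

lemma is_equivalenceI:
  assumes C: "category C" and D: "category D" and F: "is_functor C D F"
    and faithful: "\<And>f g. f \<in> Arr C \<Longrightarrow> g \<in> Arr C \<Longrightarrow> Dom C f = Dom C g \<Longrightarrow> Cod C f = Cod C g \<Longrightarrow>
      FArr F f = FArr F g \<Longrightarrow> f = g"
    and full: "\<And>X Y h. X \<in> Obj C \<Longrightarrow> Y \<in> Obj C \<Longrightarrow> h \<in> Hom D (FObj F X) (FObj F Y) \<Longrightarrow>
      \<exists>f\<in>Hom C X Y. FArr F f = h"
    and surj: "\<And>Y. Y \<in> Obj D \<Longrightarrow> \<exists>X\<in>Obj C. \<exists>e\<in>Hom D (FObj F X) Y. is_iso D e"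
  shows "is_equivalence C D F"
proof -
  interpret C: category C by fact
  interpret D: category D by fact
  note [simp] = functor_simps[OF F]
  obtain H \<epsilon> where H: "\<And>Y. Y \<in> Obj D \<Longrightarrow> H Y \<in> Obj C"
      "\<And>Y. Y \<in> Obj D \<Longrightarrow> \<epsilon> Y \<in> Hom D (FObj F (H Y)) Y" "\<And>Y. Y \<in> Obj D \<Longrightarrow> is_iso D (\<epsilon> Y)"
    using surj by metis
  note [simp] = H(1,3) H(2)[unfolded mem_Hom_iff, THEN conjunct1]
    H(2)[unfolded mem_Hom_iff, THEN conjunct2, THEN conjunct1]
    H(2)[unfolded mem_Hom_iff, THEN conjunct2, THEN conjunct2]
  define lift where "lift X Y h = (THE f. f \<in> Hom C X Y \<and> FArr F f = h)" for X Y h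
  have lift: "lift X Y h \<in> Hom C X Y" "FArr F (lift X Y h) = h"
    if "X \<in> Obj C" "Y \<in> Obj C" "h \<in> Hom D (FObj F X) (FObj F Y)" for X Y h
  proof -
    have "\<exists>!f. f \<in> Hom C X Y \<and> FArr F f = h"
      using full[OF that] by (auto intro: faithful)
    from theI'[OF this, folded lift_def]
    show "lift X Y h \<in> Hom C X Y" "FArr F (lift X Y h) = h" by auto
  qed
  define K where "K = \<lparr>FObj = H, FArr = (\<lambda>f. lift (H (Dom D f)) (H (Cod D f))
      (D.Inv (\<epsilon> (Cod D f)) \<cdot>\<^bsub>D\<^esub> (f \<cdot>\<^bsub>D\<^esub> \<epsilon> (Dom D f))))\<rparr>"
  have K_obj [simp]: "FObj K Y = H Y" for Y by (simp add: K_def)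
  have K_arr [simp]: "FArr K f \<in> Arr C" "Dom C (FArr K f) = H (Dom D f)" "Cod C (FArr K f) = H (Cod D f)"
      and FK [simp]: "FArr F (FArr K f) = D.Inv (\<epsilon> (Cod D f)) \<cdot>\<^bsub>D\<^esub> (f \<cdot>\<^bsub>D\<^esub> \<epsilon> (Dom D f))"
    if "f \<in> Arr D" for f
    using lift[of "H (Dom D f)" "H (Cod D f)" "D.Inv (\<epsilon> (Cod D f)) \<cdot>\<^bsub>D\<^esub> (f \<cdot>\<^bsub>D\<^esub> \<epsilon> (Dom D f))"] that
    by (simp_all add: K_def)
  have "is_functor D C K"
    unfolding is_functor_def by (intro conjI ballI impI) (auto intro!: faithful)
  define \<eta> where "\<eta> X = lift X (H (FObj F X)) (D.Inv (\<epsilon> (FObj F X)))" for X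
  have \<eta> [simp]: "\<eta> X \<in> Arr C" "Dom C (\<eta> X) = X" "Cod C (\<eta> X) = H (FObj F X)"
      and F\<eta> [simp]: "FArr F (\<eta> X) = D.Inv (\<epsilon> (FObj F X))" if "X \<in> Obj C" for X
    using lift[of X "H (FObj F X)" "D.Inv (\<epsilon> (FObj F X))"] that by (simp_all add: \<eta>_def)
  have \<eta>_iso: "is_iso C (\<eta> X)" if [simp]: "X \<in> Obj C" for X
  proof -
    let ?g = "lift (H (FObj F X)) X (\<epsilon> (FObj F X))"
    have [simp]: "?g \<in> Arr C" "Dom C ?g = H (FObj F X)" "Cod C ?g = X" "FArr F ?g = \<epsilon> (FObj F X)"
      using lift[of "H (FObj F X)" X "\<epsilon> (FObj F X)"] by simp_all
    show ?thesis by (rule C.is_isoI[of _ ?g]) (auto intro!: faithful)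
  qed
  have "is_nat_iso C C id_func (comp_func K F) \<eta>"
    unfolding is_nat_iso_def using \<eta>_iso by (auto intro!: faithful)
  moreover have "is_nat_iso D D (comp_func F K) id_func \<epsilon>"
    unfolding is_nat_iso_def by auto
  ultimately show ?thesis
    using F \<open>is_functor D C K\<close> unfolding is_equivalence_def by blast
qed

lemma is_equivalenceD:
  assumes "category C" "category D" "is_equivalence C D F"
  shows equivalence_faithful: "\<And>f g. f \<in> Arr C \<Longrightarrow> g \<in> Arr C \<Longrightarrow> Dom C f = Dom C g \<Longrightarrow>
      Cod C f = Cod C g \<Longrightarrow> FArr F f = FArr F g \<Longrightarrow> f = g"
    and equivalence_full: "\<And>X Y h. X \<in> Obj C \<Longrightarrow> Y \<in> Obj C \<Longrightarrow> h \<in> Hom D (FObj F X) (FObj F Y) \<Longrightarrow>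
      \<exists>f\<in>Hom C X Y. FArr F f = h"
    and equivalence_surj: "\<And>Y. Y \<in> Obj D \<Longrightarrow> \<exists>X\<in>Obj C. \<exists>e\<in>Hom D (FObj F X) Y. is_iso D e"
proof -
  interpret C: category C by fact
  interpret D: category D by fact
  obtain H \<eta> \<epsilon> where F: "is_functor C D F" and H: "is_functor D C H"
    and \<eta>: "is_nat_iso C C id_func (comp_func H F) \<eta>" and \<epsilon>: "is_nat_iso D D (comp_func F H) id_func \<epsilon>"
    using assms(3) unfolding is_equivalence_def by blast
  note [simp] = functor_simps[OF F] functor_simps[OF H] nat_isoD(1-4)[OF \<eta>] nat_isoD(1-4)[OF \<epsilon>]
  have \<eta>_nat: "\<eta> (Cod C f) \<cdot>\<^bsub>C\<^esub> f = FArr H (FArr F f) \<cdot>\<^bsub>C\<^esub> \<eta> (Dom C f)" if "f \<in> Arr C" for f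
    using nat_isoD(5)[OF \<eta>, of f] that by simp
  have \<epsilon>_nat: "\<epsilon> (Cod D f) \<cdot>\<^bsub>D\<^esub> FArr F (FArr H f) = f \<cdot>\<^bsub>D\<^esub> \<epsilon> (Dom D f)" if "f \<in> Arr D" for f
    using nat_isoD(5)[OF \<epsilon>, of f] that by simp
  \<comment> \<open>Fullness of \<open>F\<close> needs the quasi-inverse to be faithful: the
    candidate preimage is known to have the right image only after a further application of
    \<open>H\<close>.\<close>
  have H_faithful: "f = g" if "f \<in> Arr D" "g \<in> Arr D" "Dom D f = Dom D g" "Cod D f = Cod D g"
    "FArr H f = FArr H g" for f g
  proof -
    have "f \<cdot>\<^bsub>D\<^esub> \<epsilon> (Dom D f) = g \<cdot>\<^bsub>D\<^esub> \<epsilon> (Dom D f)"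
      using \<epsilon>_nat[OF that(1)] \<epsilon>_nat[OF that(2)] that by metis
    then show ?thesis by (rule D.iso_cancel_right[rotated]) (use that in auto)
  qed
  show faithful: "f = g" if "f \<in> Arr C" "g \<in> Arr C" "Dom C f = Dom C g" "Cod C f = Cod C g"
    "FArr F f = FArr F g" for f g
  proof -
    have "\<eta> (Cod C f) \<cdot>\<^bsub>C\<^esub> f = \<eta> (Cod C f) \<cdot>\<^bsub>C\<^esub> g"
      using \<eta>_nat[OF that(1)] \<eta>_nat[OF that(2)] that by metis
    then show ?thesis by (rule C.iso_cancel_left[rotated]) (use that in auto)
  qed
  show "\<exists>f\<in>Hom C X Y. FArr F f = h"
    if [simp]: "X \<in> Obj C" "Y \<in> Obj C" and h: "h \<in> Hom D (FObj F X) (FObj F Y)" for X Y h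
  proof
    have [simp]: "h \<in> Arr D" "Dom D h = FObj F X" "Cod D h = FObj F Y" using h by auto
    define f where "f = C.Inv (\<eta> Y) \<cdot>\<^bsub>C\<^esub> (FArr H h \<cdot>\<^bsub>C\<^esub> \<eta> X)"
    have f [simp]: "f \<in> Arr C" "Dom C f = X" "Cod C f = Y" by (auto simp: f_def)
    show "f \<in> Hom C X Y" by simp
    have "FArr H (FArr F f) \<cdot>\<^bsub>C\<^esub> \<eta> X = \<eta> Y \<cdot>\<^bsub>C\<^esub> f"
      using \<eta>_nat[OF f(1)] f by simp
    also have "\<dots> = FArr H h \<cdot>\<^bsub>C\<^esub> \<eta> X" by (simp add: f_def)
    finally have "FArr H (FArr F f) = FArr H h"
      by (rule C.iso_cancel_right[rotated]) auto
    then show "FArr F f = h" by (rule H_faithful[rotated 4]) auto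
  qed
  show "\<exists>X\<in>Obj C. \<exists>e\<in>Hom D (FObj F X) Y. is_iso D e" if "Y \<in> Obj D" for Y
    using that by (intro bexI[of _ "FObj H Y"] bexI[of _ "\<epsilon> Y"]) auto
qed

section \<open>Averages of morphisms\<close>

locale averaging_category = preadditive_category C
  for C :: "('o, 'm, 'x) additive_cat_scheme" (structure) +
  fixes I :: "'i set"
  assumes finite_index: "finite I"
    and card_divides: "X \<in> Obj C \<Longrightarrow> Y \<in> Obj C \<Longrightarrow> comm_group.divisible_by (hom_group C X Y) (card I)"
begin

text \<open>The endpoints are explicit because they select the Hom group in which the mean is
  formed.\<close>

definition avg :: "'o \<Rightarrow> 'o \<Rightarrow> ('i \<Rightarrow> 'm) \<Rightarrow> 'm" where
  "avg X Y f = comm_group.mean (hom_group C X Y) I f"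

context
  fixes X Y f
  assumes XY [simp]: "X \<in> Obj C" "Y \<in> Obj C" and f: "\<And>i. i \<in> I \<Longrightarrow> f i \<in> Hom C X Y"
begin

interpretation XY: comm_group "hom_group C X Y" using XY by (rule hom_comm_group)

lemma avg_simps: "avg X Y f \<in> Arr C" "Dom C (avg X Y f) = X" "Cod C (avg X Y f) = Y"
proof -
  have "avg X Y f \<in> carrier (hom_group C X Y)"
    unfolding avg_def by (rule XY.mean_closed) (use f card_divides in auto)
  then show "avg X Y f \<in> Arr C" "Dom C (avg X Y f) = X" "Cod C (avg X Y f) = Y" by auto
qed

lemma avg_hom:
  assumes "X' \<in> Obj C" "Y' \<in> Obj C" "h \<in> hom (hom_group C X Y) (hom_group C X' Y')"
  shows "h (avg X Y f) = avg X' Y' (\<lambda>i. h (f i))"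
  unfolding avg_def
  by (rule XY.mean_hom) (use f assms card_divides finite_index in \<open>auto simp: hom_comm_group\<close>)

lemma Cmp_avg:
  assumes "h \<in> Arr C" "Dom C h = Y" "Cod C h = Z"
  shows "h \<cdot> avg X Y f = avg X Z (\<lambda>i. h \<cdot> f i)"
  using avg_hom[of X Z "\<lambda>a. h \<cdot> a"] postcomp_additive[of X h Y Z] assms by auto

lemma avg_Cmp:
  assumes "h \<in> Arr C" "Cod C h = X" "Dom C h = W"
  shows "avg X Y f \<cdot> h = avg W Y (\<lambda>i. f i \<cdot> h)"
  using avg_hom[of W Y "\<lambda>a. a \<cdot> h"] precomp_additive[of Y h W X] assms by auto

lemma functor_avg:
  assumes "is_additive_functor C C F"
  shows "FArr F (avg X Y f) = avg (FObj F X) (FObj F Y) (\<lambda>i. FArr F (f i))"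
  using assms by (intro avg_hom) (auto simp: is_additive_functor_def is_functor_def)

lemma avg_reindex:
  assumes "bij_betw s I I"
  shows "avg X Y (\<lambda>i. f (s i)) = avg X Y f"
  unfolding avg_def by (rule XY.mean_reindex) (use assms f in auto)

lemma avg_cong:
  assumes "\<And>i. i \<in> I \<Longrightarrow> f' i = f i"
  shows "avg X Y f' = avg X Y f"
  unfolding avg_def by (rule XY.mean_cong) (use assms f in auto)

lemma avg_Add:
  assumes "\<And>i. i \<in> I \<Longrightarrow> f' i \<in> Hom C X Y"
  shows "avg X Y (\<lambda>i. f i \<oplus> f' i) = avg X Y f \<oplus> avg X Y f'"
  using XY.mean_mult[of I f f'] f assms card_divides by (auto simp: avg_def)

end

lemma avg_const:
  assumes "f \<in> Arr C" "Dom C f = X" "Cod C f = Y"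
  shows "avg X Y (\<lambda>_. f) = f"
proof -
  interpret XY: comm_group "hom_group C X Y" using assms by (intro hom_comm_group) auto
  have "X \<in> Obj C" "Y \<in> Obj C" using assms by auto
  then show ?thesis using XY.mean_const[of I f] card_divides assms by (auto simp: avg_def)
qed

text \<open>With \<open>Cmp_avg\<close> and \<open>avg_Cmp\<close> this shows that affine conditions
  survive averaging: if all members of a family have the same composite with a fixed map, so does
  the average.\<close>

lemma avg_constI:
  assumes "f \<in> Arr C" "Dom C f = X" "Cod C f = Y" "\<And>i. i \<in> I \<Longrightarrow> f' i = f"
  shows "avg X Y f' = f"
proof -
  have "avg X Y f' = avg X Y (\<lambda>_. f)" using assms by (intro avg_cong) auto
  then show ?thesis using avg_const assms by simp
qed

end

section \<open>Pre-triangulated categories\<close>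

text \<open>Every map into or out of \<open>Z\<close> factors through its identity. Additive
  functors preserve the equation between identity and zero, which is how suspensions and translates
  of zero objects are recognised.\<close>

lemma zero_objectI:
  assumes "preadditive_category C" "Z \<in> Obj C" "Idn C Z = Zero C Z Z"
  shows "zero_object C Z"
proof -
  interpret preadditive_category C by fact
  note [simp] = assms(2)
  have "f = Zero C X Z" if "f \<in> Hom C X Z" for f X
  proof -
    have "f = Idn C Z \<cdot>\<^bsub>C\<^esub> f" using that by simp
    then show ?thesis using that by (simp add: assms(3))
  qed
  moreover have "f = Zero C Z X" if "f \<in> Hom C Z X" for f X
  proof -
    have "f = f \<cdot>\<^bsub>C\<^esub> Idn C Z" using that by simp
    then show ?thesis using that by (simp add: assms(3))
  qed
  ultimately show ?thesis
    unfolding zero_object_def using assms(2) Zero_simps by (auto; metis)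
qed

context preadditive_category
begin

lemma zero_object_Obj: "zero_object C Z \<Longrightarrow> Z \<in> Obj C"
  by (simp add: zero_object_def)

lemma zero_object_eq_Zero:
  assumes "zero_object C Z" "f \<in> Arr C"
  shows "Cod C f = Z \<Longrightarrow> f = Zero C (Dom C f) Z" "Dom C f = Z \<Longrightarrow> f = Zero C Z (Cod C f)"
proof -
  note [simp] = zero_object_Obj[OF assms(1)]
  have "\<And>a b. a \<in> Hom C (Dom C f) Z \<Longrightarrow> b \<in> Hom C (Dom C f) Z \<Longrightarrow> a = b"
       "\<And>a b. a \<in> Hom C Z (Cod C f) \<Longrightarrow> b \<in> Hom C Z (Cod C f) \<Longrightarrow> a = b"
    using assms unfolding zero_object_def by (metis Dom_in_Obj, metis Cod_in_Obj)
  then show "Cod C f = Z \<Longrightarrow> f = Zero C (Dom C f) Z" "Dom C f = Z \<Longrightarrow> f = Zero C Z (Cod C f)"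
    using assms(2) by auto
qed

lemma zero_object_Idn: "zero_object C Z \<Longrightarrow> Idn C Z = Zero C Z Z"
  using zero_object_eq_Zero(1)[of Z "Idn C Z"] zero_object_Obj[of Z] by simp

lemma is_iso_Neg: "is_iso C f \<Longrightarrow> is_iso C (Neg C f)"
  by (rule is_isoI[of _ "Neg C (Inv f)"]) (auto simp: is_iso_Arr)

lemma is_biproductD:
  assumes "is_biproduct C X Y P i j p q"
  shows "X \<in> Obj C" "Y \<in> Obj C" "P \<in> Obj C" "i \<in> Arr C" "j \<in> Arr C" "p \<in> Arr C" "q \<in> Arr C"
    and "Dom C i = X" "Cod C i = P" "Dom C j = Y" "Cod C j = P" "Dom C p = P" "Cod C p = X"
    and "Dom C q = P" "Cod C q = Y"
    and "p \<cdot> i = Idn C X" "q \<cdot> j = Idn C Y" "q \<cdot> i = Zero C X Y" "p \<cdot> j = Zero C Y X"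
    and "(i \<cdot> p) \<oplus> (j \<cdot> q) = Idn C P"
proof -
  show a: "P \<in> Obj C" "i \<in> Arr C" "j \<in> Arr C" "p \<in> Arr C" "q \<in> Arr C"
    "Dom C i = X" "Cod C i = P" "Dom C j = Y" "Cod C j = P" "Dom C p = P" "Cod C p = X"
    "Dom C q = P" "Cod C q = Y"
    "p \<cdot> i = Idn C X" "q \<cdot> j = Idn C Y" "q \<cdot> i = Zero C X Y" "p \<cdot> j = Zero C Y X"
    "(i \<cdot> p) \<oplus> (j \<cdot> q) = Idn C P"
    using assms by (auto simp: is_biproduct_def)
  show "X \<in> Obj C" "Y \<in> Obj C" using a Dom_in_Obj by metis+
qed

lemma biproduct_simps:
  assumes "is_biproduct C X Y P i j p q"
  shows "X \<in> Obj C" "Y \<in> Obj C" "P \<in> Obj C" "i \<in> Arr C" "j \<in> Arr C" "p \<in> Arr C" "q \<in> Arr C"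
    and "Dom C i = X" "Cod C i = P" "Dom C j = Y" "Cod C j = P" "Dom C p = P" "Cod C p = X"
    and "Dom C q = P" "Cod C q = Y"
    and "p \<cdot> i = Idn C X" "q \<cdot> j = Idn C Y" "q \<cdot> i = Zero C X Y" "p \<cdot> j = Zero C Y X"
    and "f \<in> Arr C \<Longrightarrow> Cod C f = X \<Longrightarrow> p \<cdot> (i \<cdot> f) = f"
    and "f \<in> Arr C \<Longrightarrow> Cod C f = Y \<Longrightarrow> q \<cdot> (j \<cdot> f) = f"
    and "f \<in> Arr C \<Longrightarrow> Cod C f = X \<Longrightarrow> q \<cdot> (i \<cdot> f) = Zero C (Dom C f) Y"
    and "f \<in> Arr C \<Longrightarrow> Cod C f = Y \<Longrightarrow> p \<cdot> (j \<cdot> f) = Zero C (Dom C f) X"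
proof -
  note [simp] = is_biproductD[OF assms]
  show "X \<in> Obj C" "Y \<in> Obj C" "P \<in> Obj C" "i \<in> Arr C" "j \<in> Arr C" "p \<in> Arr C" "q \<in> Arr C"
    "Dom C i = X" "Cod C i = P" "Dom C j = Y" "Cod C j = P" "Dom C p = P" "Cod C p = X"
    "Dom C q = P" "Cod C q = Y"
    "p \<cdot> i = Idn C X" "q \<cdot> j = Idn C Y" "q \<cdot> i = Zero C X Y" "p \<cdot> j = Zero C Y X"
    by simp_all
  show "f \<in> Arr C \<Longrightarrow> Cod C f = X \<Longrightarrow> p \<cdot> (i \<cdot> f) = f"
    "f \<in> Arr C \<Longrightarrow> Cod C f = Y \<Longrightarrow> q \<cdot> (j \<cdot> f) = f"
    "f \<in> Arr C \<Longrightarrow> Cod C f = X \<Longrightarrow> q \<cdot> (i \<cdot> f) = Zero C (Dom C f) Y"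
    "f \<in> Arr C \<Longrightarrow> Cod C f = Y \<Longrightarrow> p \<cdot> (j \<cdot> f) = Zero C (Dom C f) X"
    by (simp_all flip: Cmp_assoc_simp)
qed

lemma biproduct_eqI:
  assumes "is_biproduct C X Y P i j p q"
    and [simp]: "f \<in> Arr C" "g \<in> Arr C" "Cod C f = P" "Cod C g = P" "Dom C f = Dom C g"
    and "p \<cdot> f = p \<cdot> g" "q \<cdot> f = q \<cdot> g"
  shows "f = g"
proof -
  note [simp] = biproduct_simps[OF assms(1)]
  have id: "h = i \<cdot> (p \<cdot> h) \<oplus> j \<cdot> (q \<cdot> h)" if "h \<in> Arr C" "Cod C h = P" for h
    using Add_Cmp[of "i \<cdot> p" "j \<cdot> q" h] is_biproductD(20)[OF assms(1)] that by simp
  show ?thesis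
    using id[of f] id[of g] assms(7,8) by simp
qed

lemma biproduct_eqI':
  assumes "is_biproduct C X Y P i j p q"
    and [simp]: "f \<in> Arr C" "g \<in> Arr C" "Dom C f = P" "Dom C g = P" "Cod C f = Cod C g"
    and "f \<cdot> i = g \<cdot> i" "f \<cdot> j = g \<cdot> j"
  shows "f = g"
proof -
  note [simp] = biproduct_simps[OF assms(1)]
  have id: "h = (h \<cdot> i) \<cdot> p \<oplus> (h \<cdot> j) \<cdot> q" if "h \<in> Arr C" "Dom C h = P" for h
    using Cmp_Add[of "i \<cdot> p" "j \<cdot> q" h] is_biproductD(20)[OF assms(1)] that by simp
  show ?thesis
    using id[OF assms(2,4)] id[OF assms(3,5)] assms(7,8) by simp
qed

lemma is_biproduct_swap:
  assumes "is_biproduct C X Y P i j p q"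
  shows "is_biproduct C Y X P j i q p"
  using is_biproductD[OF assms] by (auto simp: is_biproduct_def Add_comm)

end

section \<open>Consequences of TR1 to TR3: exactness, five lemma, split triangles\<close>

context pre_triangulated_category
begin

lemma S_is_functor: "is_functor C C S"
  using susp_additive by (simp add: is_additive_functor_def)

lemmas S_simps [simp] = functor_simps[OF S_is_functor]
  additive_functor_simps[OF preadditive_category_axioms preadditive_category_axioms susp_additive]

lemmas S_faithful = equivalence_faithful[OF category_axioms category_axioms susp_equivalence]
lemmas S_full = equivalence_full[OF category_axioms category_axioms susp_equivalence]

lemma S_is_iso: "is_iso C f \<Longrightarrow> is_iso C (FArr S f)"
  by (rule functor_is_iso[OF category_axioms category_axioms S_is_functor])

lemma S_zero_object: "zero_object C Z \<Longrightarrow> zero_object C (FObj S Z)"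
  using zero_object_Idn[of Z] zero_object_Obj[of Z]
  by (intro zero_objectI preadditive_category_axioms) (simp_all flip: S_simps(5,8))

lemma dist_type:
  assumes "(u, v, w) \<in> \<T>"
  shows "u \<in> Arr C" "v \<in> Arr C" "w \<in> Arr C" "Dom C v = Cod C u" "Dom C w = Cod C v"
    "Cod C w = FObj S (Dom C u)"
  using dist_triangle[OF assms] by (auto simp: is_triangle_def)

lemma rotate: "(u, v, w) \<in> \<T> \<Longrightarrow> (v, w, Neg C (FArr S u)) \<in> \<T>"
  using TR2 dist_triangle by blast

lemma unrotate:
  assumes "(v, w, Neg C (FArr S u)) \<in> \<T>" "u \<in> Arr C" "Cod C u = Dom C v" "Cod C w = FObj S (Dom C u)"
  shows "(u, v, w) \<in> \<T>"
  using TR2[of u v w] dist_type[OF assms(1)] assms by (simp add: is_triangle_def)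

lemma triangle_morphismD:
  assumes "is_triangle_morphism C S (u, v, w) (u', v', w') (a, b, c)"
  shows "a \<in> Arr C" "b \<in> Arr C" "c \<in> Arr C" "Dom C a = Dom C u" "Cod C a = Dom C u'"
    "Dom C b = Dom C v" "Cod C b = Dom C v'" "Dom C c = Dom C w" "Cod C c = Dom C w'"
    "b \<cdot> u = u' \<cdot> a" "c \<cdot> v = v' \<cdot> b" "FArr S a \<cdot> w = w' \<cdot> c"
  using assms by (auto simp: is_triangle_morphism_def)

lemma obtain_zero_object:
  obtains Z where "zero_object C Z" "Z \<in> Obj C"
  using zero_object_exists zero_object_Obj by blast

text \<open>TR3 maps the trivial triangle on \<open>Dom C u\<close> to \<open>(u, v, w)\<close>
  along \<open>(1, u)\<close>; the second square equates \<open>v \<cdot> u\<close> with a map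
  through a zero object.\<close>

lemma dist_Cmp_12:
  assumes uvw: "(u, v, w) \<in> \<T>"
  shows "v \<cdot> u = Zero C (Dom C u) (Cod C v)"
proof -
  note [simp] = dist_type[OF uvw]
  obtain Z where Z: "zero_object C Z" and [simp]: "Z \<in> Obj C" by (rule obtain_zero_object)
  have "(Idn C (Dom C u), Zero C (Dom C u) Z, Zero C Z (FObj S (Dom C u))) \<in> \<T>"
    using Z by (intro TR1_id) auto
  from TR3[OF this uvw, of "Idn C (Dom C u)" u] obtain c
    where "is_triangle_morphism C S (Idn C (Dom C u), Zero C (Dom C u) Z, Zero C Z (FObj S (Dom C u)))
       (u, v, w) (Idn C (Dom C u), u, c)" by auto
  note c = triangle_morphismD[OF this]
  then show ?thesis by simp
qed

lemma dist_Cmp_23: "(u, v, w) \<in> \<T> \<Longrightarrow> w \<cdot> v = Zero C (Cod C u) (FObj S (Dom C u))"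
  using dist_Cmp_12[OF rotate] by (simp add: dist_type)

text \<open>The extension of \<open>x\<close> along \<open>v\<close> is the third component of a
  morphism to the triangle \<open>0 \<rightarrow> T \<rightarrow> T \<rightarrow> 0\<close> with
  \<open>T = Cod C x\<close>.\<close>

lemma dist_coexact_1:
  assumes uvw: "(u, v, w) \<in> \<T>" and [simp]: "x \<in> Arr C" "Dom C x = Cod C u"
    and xu: "x \<cdot> u = Zero C (Dom C u) (Cod C x)"
  obtains y where "y \<in> Arr C" "Dom C y = Cod C v" "Cod C y = Cod C x" "y \<cdot> v = x"
proof -
  note [simp] = dist_type[OF uvw]
  obtain Z where Z: "zero_object C Z" and [simp]: "Z \<in> Obj C" by (rule obtain_zero_object)
  let ?T = "Cod C x"
  \<comment> \<open>The zero object is chosen as \<open>\<Sigma>Z\<close> so that this trivial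
    triangle has the shape of a rotation and can be unrotated to one that starts at
    \<open>Z\<close>.\<close>
  have "(Idn C ?T, Zero C ?T (FObj S Z), Zero C (FObj S Z) (FObj S ?T)) \<in> \<T>"
    using Z by (intro TR1_id S_zero_object) auto
  then have "(Zero C Z ?T, Idn C ?T, Zero C ?T (FObj S Z)) \<in> \<T>"
    by - (rule unrotate, auto)
  from TR3[OF uvw this, of "Zero C (Dom C u) Z" x] obtain c
    where "is_triangle_morphism C S (u, v, w) (Zero C Z ?T, Idn C ?T, Zero C ?T (FObj S Z))
       (Zero C (Dom C u) Z, x, c)" using xu by auto
  note c = triangle_morphismD[OF this]
  show thesis by (rule that[of c]) (use c in auto)
qed

lemma dist_coexact_2:
  assumes uvw: "(u, v, w) \<in> \<T>" and [simp]: "x \<in> Arr C" "Dom C x = Cod C v"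
    and "x \<cdot> v = Zero C (Cod C u) (Cod C x)"
  obtains y where "y \<in> Arr C" "Dom C y = FObj S (Dom C u)" "Cod C y = Cod C x" "y \<cdot> w = x"
proof -
  note [simp] = dist_type[OF uvw]
  show thesis
    by (rule dist_coexact_1[OF rotate[OF uvw], of x]) (use assms in \<open>auto intro: that\<close>)
qed

text \<open>A lift along \<open>u\<close> would be a first component, which TR3 does not supply.
  After one rotation of both triangles its suspension is a third component, and fullness of the
  suspension brings it back; the signs of the two rotations cancel.\<close>

lemma dist_exact_1:
  assumes uvw: "(u, v, w) \<in> \<T>" and [simp]: "x \<in> Arr C" "Cod C x = Cod C u"
    and vx: "v \<cdot> x = Zero C (Dom C x) (Cod C v)"
  obtains y where "y \<in> Arr C" "Cod C y = Dom C u" "Dom C y = Dom C x" "u \<cdot> y = x"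
proof -
  note [simp] = dist_type[OF uvw]
  obtain Z where Z: "zero_object C Z" and [simp]: "Z \<in> Obj C" by (rule obtain_zero_object)
  let ?T = "Dom C x"
  have "(Idn C ?T, Zero C ?T Z, Zero C Z (FObj S ?T)) \<in> \<T>"
    using Z by (intro TR1_id) auto
  then have "(Zero C ?T Z, Zero C Z (FObj S ?T), Neg C (Idn C (FObj S ?T))) \<in> \<T>"
    using rotate by fastforce
  from TR3[OF this rotate[OF uvw], of x "Zero C Z (Cod C v)"] obtain c
    where "is_triangle_morphism C S (Zero C ?T Z, Zero C Z (FObj S ?T), Neg C (Idn C (FObj S ?T)))
       (v, w, Neg C (FArr S u)) (x, Zero C Z (Cod C v), c)" using vx by auto
  note c = triangle_morphismD[OF this]
  obtain y where y: "y \<in> Hom C ?T (Dom C u)" "FArr S y = c"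
    using S_full[of ?T "Dom C u" c] c by auto
  have "Neg C (FArr S x) = Neg C (FArr S (u \<cdot> y))" using c y by simp
  then have "Neg C (Neg C (FArr S x)) = Neg C (Neg C (FArr S (u \<cdot> y)))" by simp
  then have "u \<cdot> y = x" using y by - (rule S_faithful, auto)
  then show thesis using y by (intro that[of y]) auto
qed

text \<open>The difference \<open>n = c - 1\<close> kills \<open>v\<close>, so it factors through
  \<open>w\<close>, and \<open>w \<cdot> n = 0\<close>. Hence \<open>n\<close> has square zero and
  \<open>1 + n\<close> is invertible. This takes the place of long exact sequences in the five lemma
  below.\<close>

lemma endomorphism_over_identity_iso:
  assumes uvw: "(u, v, w) \<in> \<T>" and [simp]: "c \<in> Arr C" "Dom C c = Cod C v" "Cod C c = Cod C v"
    and "c \<cdot> v = v" "w \<cdot> c = w"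
  shows "is_iso C c"
proof -
  note [simp] = dist_type[OF uvw]
  define n where "n = c \<ominus> Idn C (Cod C v)"
  have [simp]: "n \<in> Arr C" "Dom C n = Cod C v" "Cod C n = Cod C v" by (simp_all add: n_def)
  have c: "c = Idn C (Cod C v) \<oplus> n" by (simp add: n_def Add_lcomm)
  have "n \<cdot> v = Zero C (Cod C u) (Cod C v)" and wn: "w \<cdot> n = Zero C (Cod C v) (FObj S (Dom C u))"
    using assms by (simp_all add: n_def Add_Cmp Cmp_Add)
  then obtain n' where [simp]: "n' \<in> Arr C" "Dom C n' = FObj S (Dom C u)" "Cod C n' = Cod C v"
      and n': "n' \<cdot> w = n"
    using dist_coexact_2[OF uvw, of n] by auto
  have "n \<cdot> n = (n' \<cdot> w) \<cdot> n" by (simp only: n')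
  also have "\<dots> = n' \<cdot> (w \<cdot> n)" by simp
  finally have "n \<cdot> n = n' \<cdot> (w \<cdot> n)" .
  then have "n \<cdot> n = Zero C (Cod C v) (Cod C v)" by (simp add: wn)
  then show ?thesis unfolding c by (intro nilpotent_unipotent_iso) auto
qed

text \<open>TR3 gives some \<open>c'\<close> over the inverses of \<open>a\<close> and
  \<open>b\<close>. It need not invert \<open>c\<close>, but both composites lie over identities and
  are therefore invertible, which suffices.\<close>

lemma triangle_morphism_iso_3:
  assumes t: "(u, v, w) \<in> \<T>" and t': "(u', v', w') \<in> \<T>"
    and m: "is_triangle_morphism C S (u, v, w) (u', v', w') (a, b, c)"
    and a: "is_iso C a" and b: "is_iso C b"
  shows "is_iso C c"
proof -
  note [simp] = dist_type[OF t] dist_type[OF t'] triangle_morphismD(1-9)[OF m] and mD = triangle_morphismD(10-12)[OF m]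
  have "Inv b \<cdot> u' = u \<cdot> Inv a"
    by (rule iso_cancel_left[OF b], rule iso_cancel_right[OF a]) (use a b mD in auto)
  then obtain c' where m': "is_triangle_morphism C S (u', v', w') (u, v, w) (Inv a, Inv b, c')"
    using TR3[OF t' t, of "Inv a" "Inv b"] a b by auto
  have [simp]: "c' \<in> Arr C" "Dom C c' = Cod C v'" "Cod C c' = Cod C v"
    using triangle_morphismD(1-9)[OF m'] by simp_all
  note m'D = triangle_morphismD(10-12)[OF m']
  have "FArr S (Inv a) \<cdot> FArr S a = Idn C (FObj S (Dom C u))" "FArr S a \<cdot> FArr S (Inv a) = Idn C (FObj S (Dom C u'))"
    using a by (simp_all flip: S_simps(5,6))
  note SI = this this[THEN Cmp_reassoc]
  have "is_iso C (c' \<cdot> c)"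
  proof (rule endomorphism_over_identity_iso[OF t])
    have "c' \<cdot> (c \<cdot> v) = (c' \<cdot> v') \<cdot> b" by (simp add: mD)
    also have "\<dots> = v" using b by (simp add: m'D)
    finally show "c' \<cdot> c \<cdot> v = v" by simp
    have "(w \<cdot> c') \<cdot> c = FArr S (Inv a) \<cdot> (w' \<cdot> c)" using a by (simp flip: m'D)
    also have "\<dots> = w" using a by (simp flip: mD) (simp add: SI)
    finally show "w \<cdot> (c' \<cdot> c) = w" by simp
  qed auto
  moreover have "is_iso C (c \<cdot> c')"
  proof (rule endomorphism_over_identity_iso[OF t'])
    have "c \<cdot> (c' \<cdot> v') = (c \<cdot> v) \<cdot> Inv b" using b by (simp add: m'D)
    also have "\<dots> = v'" using b by (simp add: mD)
    finally show "c \<cdot> c' \<cdot> v' = v'" by simp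
    have "(w' \<cdot> c) \<cdot> c' = FArr S a \<cdot> (w \<cdot> c')" using a by (simp flip: mD)
    also have "\<dots> = w'" using a by (simp flip: m'D) (simp add: SI)
    finally show "w' \<cdot> (c \<cdot> c') = w'" by simp
  qed auto
  ultimately show ?thesis by (intro is_isoI_two_sided[of c c' c']) auto
qed

text \<open>Two rotations put \<open>c\<close> and \<open>a\<close> in the first two places. TR3
  then supplies the missing map as a third component between suspensions, and full faithfulness of
  the suspension descends it together with its squares.\<close>

lemma TR3_middle:
  assumes t: "(u, v, w) \<in> \<T>" and t': "(u', v', w') \<in> \<T>"
    and a [simp]: "a \<in> Arr C" "Dom C a = Dom C u" "Cod C a = Dom C u'"
    and c [simp]: "c \<in> Arr C" "Dom C c = Cod C v" "Cod C c = Cod C v'"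
    and eq: "FArr S a \<cdot> w = w' \<cdot> c"
  obtains b where "is_triangle_morphism C S (u, v, w) (u', v', w') (a, b, c)"
proof -
  note [simp] = dist_type[OF t] dist_type[OF t']
  obtain \<beta> where m: "is_triangle_morphism C S (w, Neg C (FArr S u), Neg C (FArr S v))
      (w', Neg C (FArr S u'), Neg C (FArr S v')) (c, FArr S a, \<beta>)"
    using TR3[OF rotate[OF rotate[OF t]] rotate[OF rotate[OF t']], of c "FArr S a"] eq by auto
  have [simp]: "\<beta> \<in> Arr C" "Dom C \<beta> = FObj S (Cod C u)" "Cod C \<beta> = FObj S (Cod C u')"
    using triangle_morphismD(1-9)[OF m] by simp_all
  obtain b where b: "b \<in> Hom C (Cod C u) (Cod C u')" "FArr S b = \<beta>"
    using S_full[of "Cod C u" "Cod C u'" \<beta>] by auto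
  then have [simp]: "b \<in> Arr C" "Dom C b = Cod C u" "Cod C b = Cod C u'" by auto
  have "Neg C (FArr S (b \<cdot> u)) = Neg C (FArr S (u' \<cdot> a))" "Neg C (FArr S (c \<cdot> v)) = Neg C (FArr S (v' \<cdot> b))"
    using triangle_morphismD(10-12)[OF m] b by simp_all
  then have "Neg C (Neg C (FArr S (b \<cdot> u))) = Neg C (Neg C (FArr S (u' \<cdot> a)))"
     "Neg C (Neg C (FArr S (c \<cdot> v))) = Neg C (Neg C (FArr S (v' \<cdot> b)))" by simp_all
  then have "FArr S (b \<cdot> u) = FArr S (u' \<cdot> a)" "FArr S (c \<cdot> v) = FArr S (v' \<cdot> b)"
    by (simp_all del: S_simps(6))
  then have "b \<cdot> u = u' \<cdot> a" "c \<cdot> v = v' \<cdot> b" by - (rule S_faithful, auto simp del: S_simps(6))+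
  then show thesis using eq by (intro that[of b]) (auto simp: is_triangle_morphism_def)
qed

text \<open>The cone of the split monomorphism \<open>j\<close> is the complementary summand: its
  connecting map vanishes, and the map \<open>h\<close> from the cone to \<open>X\<close> induced by
  \<open>p\<close> has inverse \<open>c \<cdot> i\<close>.\<close>

lemma biproduct_dist:
  assumes P: "is_biproduct C X Y P i j p q"
  shows "(j, p, Zero C X (FObj S Y)) \<in> \<T>"
proof -
  note [simp] = biproduct_simps[OF P]
  obtain c d where t: "(j, c, d) \<in> \<T>" using TR1_cone[of j] by auto
  note [simp] = dist_type[OF t, simplified]
  have cj: "c \<cdot> j = Zero C Y (Cod C c)" using dist_Cmp_12[OF t] by simp
  \<comment> \<open>Rotation shows that \<open>FArr S j\<close> kills \<open>d\<close>, and
    \<open>FArr S j\<close> has the left inverse \<open>FArr S q\<close>.\<close>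
  have d: "d = Zero C (Cod C c) (FObj S Y)"
  proof -
    have "FArr S j \<cdot> d = Zero C (Cod C c) (FObj S P)"
      using arg_cong[OF dist_Cmp_23[OF rotate[OF t]], of "Neg C"] by simp
    then have "FArr S q \<cdot> (FArr S j \<cdot> d) = Zero C (Cod C c) (FObj S Y)" by simp
    then show ?thesis by (simp flip: Cmp_assoc_simp S_simps(6))
  qed
  obtain h where [simp]: "h \<in> Arr C" "Dom C h = Cod C c" "Cod C h = X" and h: "h \<cdot> c = p"
    using dist_coexact_1[OF t, of p] by auto
  have hci: "h \<cdot> (c \<cdot> i) = Idn C X" by (simp add: h flip: Cmp_assoc_simp)
  \<comment> \<open>Compared on the summands: on \<open>j\<close> both sides vanish, on
    \<open>i\<close> both give \<open>c \<cdot> i\<close>. The resulting difference from the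
    identity factors through \<open>d = 0\<close>.\<close>
  have "(c \<cdot> (i \<cdot> h)) \<cdot> c = c"
    by (rule biproduct_eqI'[OF P]) (auto simp: cj hci h)
  then have "(c \<cdot> (i \<cdot> h) \<ominus> Idn C (Cod C c)) \<cdot> c = Zero C P (Cod C c)"
    by (simp add: Add_Cmp)
  then obtain y where y: "y \<in> Arr C" "Dom C y = FObj S Y" "Cod C y = Cod C c"
      "y \<cdot> d = c \<cdot> (i \<cdot> h) \<ominus> Idn C (Cod C c)"
    using dist_coexact_2[OF t, of "c \<cdot> (i \<cdot> h) \<ominus> Idn C (Cod C c)"] by auto
  then have "c \<cdot> (i \<cdot> h) \<ominus> Idn C (Cod C c) = Zero C (Cod C c) (Cod C c)" by (simp add: d)
  then have "c \<cdot> (i \<cdot> h) = Idn C (Cod C c)" by (rule sub_eq_ZeroD) auto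
  then have "is_iso C h" using hci by (intro is_isoI[of _ "c \<cdot> i"]) auto
  then show ?thesis
    by (intro TR1_iso[OF t, of _ "(Idn C Y, Idn C P, h)"])
      (auto simp: is_triangle_def is_triangle_iso_def is_triangle_morphism_def d is_iso_Idn h)
qed

text \<open>TR4 quantifies over every cone of \<open>v \<cdot> u\<close>, whereas a construction
  yields one of them. Two cones are related by an isomorphism \<open>\<beta>\<close> over
  identities, and an octahedron is carried along it by composing \<open>f\<close> with
  \<open>\<beta>\<close> and \<open>g\<close> with its inverse.\<close>

lemma TR4_change_third:
  assumes u: "u \<in> Hom C X Y" and v: "v \<in> Hom C Y Z"
    and t1: "(u, i, i') \<in> \<T>" and t2: "(v, j, j') \<in> \<T>"
    and t3: "(v \<cdot> u, k, k') \<in> \<T>" and t4: "(v \<cdot> u, l, l') \<in> \<T>"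
    and m1: "is_triangle_morphism C S (u, i, i') (v \<cdot> u, l, l') (Idn C X, v, f)"
    and m2: "is_triangle_morphism C S (v \<cdot> u, l, l') (v, j, j') (u, Idn C Z, g)"
    and fg: "(f, g, FArr S i \<cdot> j') \<in> \<T>"
  shows "\<exists>f g. is_triangle_morphism C S (u, i, i') (v \<cdot> u, k, k') (Idn C X, v, f) \<and>
           is_triangle_morphism C S (v \<cdot> u, k, k') (v, j, j') (u, Idn C Z, g) \<and>
           (f, g, FArr S i \<cdot> j') \<in> \<T>"
proof -
  have [simp]: "u \<in> Arr C" "Dom C u = X" "Cod C u = Y" "v \<in> Arr C" "Dom C v = Y" "Cod C v = Z"
    using u v by auto
  have [simp]: "X \<in> Obj C" "Y \<in> Obj C" "Z \<in> Obj C"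
    using Dom_in_Obj[of u] Cod_in_Obj[of u] Cod_in_Obj[of v] by auto
  note [simp] = dist_type[OF t1, simplified] dist_type[OF t2, simplified]
    dist_type[OF t3, simplified] dist_type[OF t4, simplified]
    triangle_morphismD(3,8,9)[OF m1, simplified] triangle_morphismD(3,8,9)[OF m2, simplified]
  note e1 = triangle_morphismD(11-12)[OF m1, simplified]
    and e2 = triangle_morphismD(11-12)[OF m2, simplified]
  obtain \<beta> where m: "is_triangle_morphism C S (v \<cdot> u, l, l') (v \<cdot> u, k, k') (Idn C X, Idn C Z, \<beta>)"
    using TR3[OF t4 t3, of "Idn C X" "Idn C Z"] by auto
  have iso: "is_iso C \<beta>"
    using triangle_morphism_iso_3[OF t4 t3 m] by (simp add: is_iso_Idn)
  note [simp] = triangle_morphismD(3,8,9)[OF m, simplified]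
  note e = triangle_morphismD(11-12)[OF m, simplified]
  have k: "Inv \<beta> \<cdot> k = l" using iso by (simp flip: e(1))
  have k': "l' \<cdot> Inv \<beta> = k'" using iso by (simp add: e(2))
  have "is_triangle_morphism C S (u, i, i') (v \<cdot> u, k, k') (Idn C X, v, \<beta> \<cdot> f)"
    using e1 by (auto simp: is_triangle_morphism_def Cmp_reassoc[OF e(1)] Cmp_reassoc[OF e(2)[symmetric]])
  moreover have "is_triangle_morphism C S (v \<cdot> u, k, k') (v, j, j') (u, Idn C Z, g \<cdot> Inv \<beta>)"
    using e2(1) iso k k' by (auto simp: is_triangle_morphism_def Cmp_reassoc[OF e2(2)[symmetric]])
  moreover have "(\<beta> \<cdot> f, g \<cdot> Inv \<beta>, FArr S i \<cdot> j') \<in> \<T>"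
    using iso
    by (intro TR1_iso[OF fg, of _ "(Idn C (Cod C i), \<beta>, Idn C (Cod C j))"])
      (auto simp: is_triangle_def is_triangle_iso_def is_triangle_morphism_def is_iso_Idn)
  ultimately show ?thesis by blast
qed

text \<open>The two triangles are isomorphic through the inverse of \<open>\<alpha>\<close> on the
  middle object. This reduces distinguishedness of an averaged triangle to invertibility of an
  averaged comparison map.\<close>

lemma dist_change_middle:
  assumes t: "(f, g, h) \<in> \<T>" and \<alpha>: "is_iso C \<alpha>" and [simp]: "Dom C \<alpha> = Cod C f" "Cod C \<alpha> = Cod C f"
    and f: "\<alpha> \<cdot> f = f" and g': "g' = g \<cdot> \<alpha>"
  shows "(f, g', h) \<in> \<T>"
proof -
  note [simp] = dist_type[OF t] is_iso_Arr[OF \<alpha>]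
  have "Inv \<alpha> \<cdot> f = f" using Inv_cancel(3)[OF \<alpha>, of f] by (simp add: f)
  then show ?thesis using \<alpha>
    by (intro TR1_iso[OF t, of _ "(Idn C (Dom C f), Inv \<alpha>, Idn C (Cod C g))"])
      (auto simp: is_triangle_def is_triangle_iso_def is_triangle_morphism_def is_iso_Idn is_iso_Inv g')
qed

end

section \<open>Octahedra on homotopy pushouts\<close>

context pre_triangulated_category
begin

text \<open>Negating the identity of the first object is an isomorphism of triangles, so the signs
  of the two maps adjacent to that object change together.\<close>

lemma dist_Neg_1:
  assumes t: "(u, v, w) \<in> \<T>"
  shows "(Neg C u, v, Neg C w) \<in> \<T>"
proof -
  note [simp] = dist_type[OF t]
  show ?thesis
    by (intro TR1_iso[OF t, of _ "(Neg C (Idn C (Dom C u)), Idn C (Cod C u), Idn C (Cod C v))"])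
      (auto simp: is_triangle_def is_triangle_iso_def is_triangle_morphism_def is_iso_Idn is_iso_Neg)
qed

end

context triangulated_category
begin

text \<open>The map \<open>(v, w)\<close> into \<open>Z \<oplus> W\<close> followed by the
  projection to \<open>Z\<close> is \<open>v\<close>. TR4 in \<open>C\<close> for this
  factorisation, with the split triangle of the biproduct as the cone of the projection, compares
  the cones of \<open>(v, w)\<close> and \<open>v\<close>; unrotating its new triangle exhibits the
  cone of \<open>t \<cdot> in\<^sub>2\<close>.\<close>

lemma homotopy_pushout_third:
  assumes P: "is_biproduct C Z W P in\<^sub>1 in\<^sub>2 p\<^sub>1 p\<^sub>2"
    and w [simp]: "w \<in> Arr C" "Dom C w = Dom C v" "Cod C w = W" and [simp]: "Cod C v = Z"
    and vj: "(v, j, j') \<in> \<T>" and st: "((in\<^sub>1 \<cdot> v) \<oplus> (in\<^sub>2 \<cdot> w), t, d) \<in> \<T>"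
  obtains g where "g \<in> Arr C" "Dom C g = Cod C t" "Cod C g = Cod C j"
    and "g \<cdot> t = j \<cdot> p\<^sub>1" "j' \<cdot> g = d" "(t \<cdot> in\<^sub>2, g, Neg C (FArr S w \<cdot> j')) \<in> \<T>"
proof -
  note [simp] = biproduct_simps[OF P] dist_type[OF vj, simplified]
  let ?s = "in\<^sub>1 \<cdot> v \<oplus> in\<^sub>2 \<cdot> w"
  note [simp] = dist_type(2-)[OF st, simplified]
  have p1s: "p\<^sub>1 \<cdot> ?s = v" and p2s: "p\<^sub>2 \<cdot> ?s = w" by (simp_all add: Cmp_Add)
  have "(p\<^sub>1, Zero C Z (FObj S W), Neg C (FArr S in\<^sub>2)) \<in> \<T>"
    using rotate[OF biproduct_dist[OF P]] by simp
  from TR4[OF _ _ st this, of "Dom C v" P Z j j'] obtain f g where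
    m1: "is_triangle_morphism C S (?s, t, d) (v, j, j') (Idn C (Dom C v), p\<^sub>1, f)" and
    m2: "is_triangle_morphism C S (v, j, j') (p\<^sub>1, Zero C Z (FObj S W), Neg C (FArr S in\<^sub>2)) (?s, Idn C Z, g)" and
    fg: "(f, g, FArr S t \<cdot> Neg C (FArr S in\<^sub>2)) \<in> \<T>"
    using vj by (auto simp: p1s)
  note [simp] = triangle_morphismD(3,8,9)[OF m1, simplified] triangle_morphismD(3,8,9)[OF m2, simplified]
  \<comment> \<open>TR4 asserts only that \<open>g\<close> exists, but its value is forced by the
    last square, because \<open>FArr S in\<^sub>2\<close> is split by
    \<open>FArr S p\<^sub>2\<close>.\<close>
  have "Neg C g = FArr S p\<^sub>2 \<cdot> Neg C (FArr S in\<^sub>2 \<cdot> g)"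
    by (simp flip: Cmp_assoc_simp S_simps(6))
  also have "\<dots> = FArr S p\<^sub>2 \<cdot> (FArr S ?s \<cdot> j')"
    using triangle_morphismD(12)[OF m2] by simp
  also have "\<dots> = FArr S (p\<^sub>2 \<cdot> ?s) \<cdot> j'"
    by simp
  finally have "Neg C (Neg C g) = Neg C (FArr S w \<cdot> j')" by (simp add: p2s)
  then have g: "g = Neg C (FArr S w \<cdot> j')" by simp
  have "(f, Neg C (FArr S w \<cdot> j'), Neg C (FArr S (t \<cdot> in\<^sub>2))) \<in> \<T>"
    using fg unfolding g by simp
  then have "(t \<cdot> in\<^sub>2, f, Neg C (FArr S w \<cdot> j')) \<in> \<T>"
    by (rule unrotate) auto
  then show thesis
    using triangle_morphismD(11-12)[OF m1, simplified] by (intro that[of f]) auto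
qed

text \<open>The preceding lemma is used once for each summand: for \<open>v\<close> with
  \<open>w = -i\<close> and, after swapping the biproduct, for \<open>-i\<close> with
  \<open>w = v\<close>. The shared connecting map \<open>d\<close> links the two results, and the
  sign of \<open>i\<close> lets \<open>FArr S i \<cdot> j'\<close> come out without a sign.\<close>

lemma octahedron_on_homotopy_pushout:
  assumes P: "is_biproduct C Z W P in\<^sub>1 in\<^sub>2 p\<^sub>1 p\<^sub>2"
    and Z: "Cod C u = Dom C v" "Cod C v = Z" "Cod C i = W"
    and ui: "(u, i, i') \<in> \<T>" and vj: "(v, j, j') \<in> \<T>"
    and st: "((in\<^sub>1 \<cdot> v) \<oplus> (in\<^sub>2 \<cdot> Neg C i), t, d) \<in> \<T>"
  obtains l' g where "(v \<cdot> u, t \<cdot> in\<^sub>1, l') \<in> \<T>" "(t \<cdot> in\<^sub>2, g, FArr S i \<cdot> j') \<in> \<T>"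
    and "l' \<cdot> t = i' \<cdot> p\<^sub>2" "FArr S u \<cdot> l' = d" "g \<cdot> t = j \<cdot> p\<^sub>1" "j' \<cdot> g = d"
proof -
  note [simp] = biproduct_simps[OF P] dist_type[OF ui, unfolded Z] dist_type[OF vj, unfolded Z] Z
  note [simp] = dist_type(2-)[OF st, simplified]
  obtain g where [simp]: "g \<in> Arr C" "Dom C g = Cod C t" "Cod C g = Cod C j"
    and g: "g \<cdot> t = j \<cdot> p\<^sub>1" "j' \<cdot> g = d" "(t \<cdot> in\<^sub>2, g, FArr S i \<cdot> j') \<in> \<T>"
    by (rule homotopy_pushout_third[OF P _ _ _ _ vj st]) auto
  \<comment> \<open>The second use needs a triangle on \<open>-i\<close>, so the sign of
    \<open>i\<close> and the one that rotation puts on \<open>\<Sigma>u\<close> are changed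
    together.\<close>
  have "(Neg C i, i', FArr S u) \<in> \<T>" using dist_Neg_1[OF rotate[OF ui]] by simp
  moreover have "(in\<^sub>2 \<cdot> Neg C i \<oplus> in\<^sub>1 \<cdot> v, t, d) \<in> \<T>"
    using st by (simp add: Add_comm[of "in\<^sub>1 \<cdot> v"])
  ultimately obtain l' where [simp]: "l' \<in> Arr C" "Dom C l' = Cod C t" "Cod C l' = FObj S (Dom C u)"
    and l: "l' \<cdot> t = i' \<cdot> p\<^sub>2" "FArr S u \<cdot> l' = d" and t: "(t \<cdot> in\<^sub>1, l', Neg C (FArr S v \<cdot> FArr S u)) \<in> \<T>"
    by (rule homotopy_pushout_third[OF is_biproduct_swap[OF P], rotated 4]) auto
  have "(v \<cdot> u, t \<cdot> in\<^sub>1, l') \<in> \<T>" by (rule unrotate) (use t in auto)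
  then show thesis using g l by (intro that) 
qed

end

section \<open>Averaging triangles that share their outer maps\<close>

locale averaging_pre_triangulated_category =
  pre_triangulated_category C S \<T> + averaging_category C I
  for C :: "('o, 'm, 'x) additive_cat_scheme" (structure)
    and S :: "('o, 'm, 'o, 'm) func"
    and \<T> :: "'m triangle set"
    and I :: "'i set"
begin

text \<open>The set of middle maps completing a given pair to a distinguished triangle need not be closed
  under averaging.  The condition on \<open>c\<close> says that the differences compose to zero through \<open>g\<close>,
  which makes the averaged comparison map unipotent.\<close>

lemma avg_dist_middle:
  assumes t: "(f, g, h) \<in> \<T>"
    and gs: "\<And>i. i \<in> I \<Longrightarrow> (f, gs i, h) \<in> \<T>"
    and c: "\<And>i. i \<in> I \<Longrightarrow> c i \<in> Hom C (Cod C f) (Cod C f)" "\<And>i. i \<in> I \<Longrightarrow> gs i \<ominus> g = g \<cdot> c i"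
    and cc: "\<And>i i'. i \<in> I \<Longrightarrow> i' \<in> I \<Longrightarrow> (gs i' \<ominus> g) \<cdot> c i = Zero C (Cod C f) (Cod C g)"
  shows "(f, avg (Cod C f) (Cod C g) gs, h) \<in> \<T>"
proof -
  let ?Y = "Cod C f" and ?Z = "Cod C g"
  note [simp] = dist_type[OF t]
  have gs_type [simp]: "gs i \<in> Arr C" "Dom C (gs i) = ?Y" "Cod C (gs i) = ?Z" if "i \<in> I" for i
    using dist_type[OF gs[OF that]] by simp_all
  have c_type [simp]: "c i \<in> Arr C" "Dom C (c i) = ?Y" "Cod C (c i) = ?Y" if "i \<in> I" for i
    using c(1)[OF that] by simp_all
  \<comment> \<open>Each \<open>gs i\<close> is \<open>g\<close> precomposed with an endomorphism
    \<open>b i\<close> that fixes \<open>f\<close>. TR3 gives no control over products of these;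
    that control comes from the family \<open>c\<close>.\<close>
  have "\<exists>b. b \<in> Hom C ?Y ?Y \<and> b \<cdot> f = f \<and> g \<cdot> b = gs i" if i [simp]: "i \<in> I" for i
  proof -
    obtain b where "is_triangle_morphism C S (f, gs i, h) (f, g, h) (Idn C (Dom C f), b, Idn C ?Z)"
      by (rule TR3_middle[OF gs[OF i] t, of "Idn C (Dom C f)" "Idn C ?Z"]) auto
    from triangle_morphismD[OF this] show ?thesis by (intro exI[of _ b]) auto
  qed
  then obtain b where b: "b i \<in> Hom C ?Y ?Y" "b i \<cdot> f = f" "g \<cdot> b i = gs i" if "i \<in> I" for i
    by metis
  define \<alpha> where "\<alpha> = avg ?Y ?Y b"
  define a where "a = \<alpha> \<ominus> Idn C ?Y"
  define d where "d = avg ?Y ?Z gs \<ominus> g"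
  have [simp]: "\<alpha> \<in> Arr C" "Dom C \<alpha> = ?Y" "Cod C \<alpha> = ?Y"
    using avg_simps[of ?Y ?Y b] b(1) by (simp_all add: \<alpha>_def)
  have [simp]: "avg ?Y ?Z gs \<in> Arr C" "Dom C (avg ?Y ?Z gs) = ?Y" "Cod C (avg ?Y ?Z gs) = ?Z"
    using avg_simps[of ?Y ?Z gs] by simp_all
  have [simp]: "a \<in> Arr C" "Dom C a = ?Y" "Cod C a = ?Y" "d \<in> Arr C" "Dom C d = ?Y" "Cod C d = ?Z"
    by (simp_all add: a_def d_def)
  have \<alpha>f: "\<alpha> \<cdot> f = f"
  proof -
    have "\<alpha> \<cdot> f = avg (Dom C f) ?Y (\<lambda>i. b i \<cdot> f)" unfolding \<alpha>_def using b(1) by (intro avg_Cmp) auto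
    then show ?thesis using b(2) by (simp add: avg_constI)
  qed
  have g\<alpha>: "g \<cdot> \<alpha> = avg ?Y ?Z gs"
  proof -
    have "g \<cdot> \<alpha> = avg ?Y ?Z (\<lambda>i. g \<cdot> b i)" unfolding \<alpha>_def using b(1) by (intro Cmp_avg) auto
    also have "\<dots> = avg ?Y ?Z gs" by (intro avg_cong) (auto simp: b(3))
    finally show ?thesis .
  qed
  have af: "a \<cdot> f = Zero C (Dom C f) ?Y" and ga: "g \<cdot> a = d"
    by (simp_all add: a_def d_def Add_Cmp Cmp_Add \<alpha>f g\<alpha>)
  have "d \<cdot> f = Zero C (Dom C f) ?Z"
    using arg_cong[OF ga, of "\<lambda>x. x \<cdot> f"] by (simp add: af)
  then obtain m where [simp]: "m \<in> Arr C" "Dom C m = ?Z" "Cod C m = ?Z" and m: "m \<cdot> g = d"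
    using dist_coexact_1[OF t, of d] by auto
  \<comment> \<open>Both \<open>c'\<close> and \<open>a\<close> lift \<open>d\<close> along
    \<open>g\<close>, but \<open>c'\<close> is in addition annihilated by \<open>d\<close>.\<close>
  define c' where "c' = avg ?Y ?Y c"
  have [simp]: "c' \<in> Arr C" "Dom C c' = ?Y" "Cod C c' = ?Y"
    using avg_simps[of ?Y ?Y c] by (simp_all add: c'_def)
  have d_avg: "d = avg ?Y ?Z (\<lambda>i. gs i \<ominus> g)"
    using avg_Add[of ?Y ?Z gs "\<lambda>_. Neg C g"] by (simp add: d_def avg_const)
  have "g \<cdot> c' = avg ?Y ?Z (\<lambda>i. g \<cdot> c i)" unfolding c'_def using c_type by (intro Cmp_avg) auto
  also have "\<dots> = d" unfolding d_avg by (intro avg_cong) (auto simp: c(2)[symmetric])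
  finally have gc: "g \<cdot> c' = d" .
  have "d \<cdot> c i = Zero C ?Y ?Z" if "i \<in> I" for i
  proof -
    have "d \<cdot> c i = avg ?Y ?Z (\<lambda>i'. (gs i' \<ominus> g) \<cdot> c i)"
      unfolding d_avg using that by (intro avg_Cmp) auto
    also have "\<dots> = Zero C ?Y ?Z" using cc that by (intro avg_constI) auto
    finally show ?thesis .
  qed
  moreover have "d \<cdot> c' = avg ?Y ?Z (\<lambda>i. d \<cdot> c i)" unfolding c'_def using c_type by (intro Cmp_avg) auto
  ultimately have dc: "d \<cdot> c' = Zero C ?Y ?Z" by (simp add: avg_constI)
  \<comment> \<open>As \<open>d\<close> factors through \<open>g\<close>, replacing \<open>a\<close>
    by \<open>c'\<close> does not change \<open>d \<cdot> a\<close>, so it is zero. Then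
    \<open>g\<close> kills \<open>a \<cdot> a\<close>, which therefore factors through
    \<open>f\<close>; since \<open>a\<close> kills \<open>f\<close>, the cube of \<open>a\<close>
    vanishes.\<close>
  have "d \<cdot> a = m \<cdot> (g \<cdot> a)" by (simp flip: m)
  also have "\<dots> = (m \<cdot> g) \<cdot> c'" by (simp add: ga flip: gc)
  also have "\<dots> = Zero C ?Y ?Z" by (simp only: m dc)
  finally have "g \<cdot> (a \<cdot> a) = Zero C ?Y ?Z" by (simp add: Cmp_reassoc[OF ga])
  then obtain y where [simp]: "y \<in> Arr C" "Cod C y = Dom C f" "Dom C y = ?Y" and y: "f \<cdot> y = a \<cdot> a"
    using dist_exact_1[OF t, of "a \<cdot> a"] by auto
  have "a \<cdot> (a \<cdot> a) = Zero C ?Y ?Y" by (simp add: Cmp_reassoc[OF af] flip: y)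
  then have "is_iso C (Idn C ?Y \<oplus> a)" by (intro nilpotent_unipotent_iso) auto
  then have "is_iso C \<alpha>" by (simp add: a_def Add_lcomm)
  then show ?thesis by (rule dist_change_middle[OF t]) (auto simp: \<alpha>f g\<alpha>)
qed

end

section \<open>The equivariant category\<close>

context admissible_action
begin

abbreviation EC where "EC \<equiv> equivariant_category C G F \<delta>"
abbreviation ES where "ES \<equiv> equivariant_susp C S G \<theta>"

lemma F_additive: "g \<in> carrier G \<Longrightarrow> is_additive_functor C C (F g)"
  using F_exact by (simp add: is_exact_functor_def)

lemma F_functor: "g \<in> carrier G \<Longrightarrow> is_functor C C (F g)"
  using F_additive by (simp add: is_additive_functor_def)

lemmas F_simps [simp] = functor_simps[OF F_functor]
  additive_functor_simps[OF preadditive_category_axioms preadditive_category_axioms F_additive]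

lemma F_is_iso [simp]: "g \<in> carrier G \<Longrightarrow> is_iso C f \<Longrightarrow> is_iso C (FArr (F g) f)"
  by (rule functor_is_iso[OF category_axioms category_axioms F_functor])

lemma \<theta>_nat_iso: "g \<in> carrier G \<Longrightarrow> is_nat_iso C C (comp_func (F g) S) (comp_func S (F g)) (\<theta> g)"
  using F_exact by (simp add: is_exact_functor_def)

lemmas \<theta>_simps [simp] = nat_isoD(1-4)[OF \<theta>_nat_iso, simplified]
lemmas \<delta>_simps [simp] = nat_isoD(1-4)[OF \<delta>_nat_iso, simplified]

lemma \<theta>_natural:
  assumes "g \<in> carrier G" "f \<in> Arr C"
  shows "\<theta> g (Cod C f) \<cdot> FArr (F g) (FArr S f) = FArr S (FArr (F g) f) \<cdot> \<theta> g (Dom C f)"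
  using nat_isoD(5)[OF \<theta>_nat_iso] assms by simp

lemma \<delta>_natural:
  assumes "g \<in> carrier G" "h \<in> carrier G" "f \<in> Arr C"
  shows "\<delta> g h (Cod C f) \<cdot> FArr (F g) (FArr (F h) f) = FArr (F (h \<otimes>\<^bsub>G\<^esub> g)) f \<cdot> \<delta> g h (Dom C f)"
  using nat_isoD(5)[OF \<delta>_nat_iso] assms by simp

lemma F_dist:
  assumes "(u, v, w) \<in> \<T>" "g \<in> carrier G"
  shows "(FArr (F g) u, FArr (F g) v, \<theta> g (Dom C u) \<cdot> FArr (F g) w) \<in> \<T>"
  using F_exact[OF assms(2)] assms(1) unfolding is_exact_functor_def triangle_image_def by fastforce

lemma EC_simps [simp]:
  "Dom EC (A, a, B) = A" "Cod EC (A, a, B) = B" "Idn EC A = (A, Idn C (fst A), A)"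
  "Cmp EC (B', b, D) (A, a, B) = (A, b \<cdot> a, D)" "Zero EC A B = (A, Zero C (fst A) (fst B), B)"
  "Add EC (A, a, B) (A', a', B') = (A, a \<oplus> a', B)"
  by (simp_all add: equivariant_category_def)

lemma Obj_EC_I:
  assumes "X \<in> Obj C"
    and "\<And>g. g \<in> carrier G \<Longrightarrow> \<phi> g \<in> Hom C (FObj (F g) X) X"
    and "\<And>g. g \<in> carrier G \<Longrightarrow> is_iso C (\<phi> g)"
    and "\<And>g h. g \<in> carrier G \<Longrightarrow> h \<in> carrier G \<Longrightarrow>
       \<phi> g \<cdot> FArr (F g) (\<phi> h) = \<phi> (h \<otimes>\<^bsub>G\<^esub> g) \<cdot> \<delta> g h X"
  shows "(X, restrict \<phi> (carrier G)) \<in> Obj EC"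
  using assms by (auto simp: equivariant_category_def equivariant_objects_def m_closed)

lemma Obj_EC_simps [simp]:
  assumes "A \<in> Obj EC"
  shows "fst A \<in> Obj C"
    and "g \<in> carrier G \<Longrightarrow> snd A g \<in> Arr C"
    and "g \<in> carrier G \<Longrightarrow> Dom C (snd A g) = FObj (F g) (fst A)"
    and "g \<in> carrier G \<Longrightarrow> Cod C (snd A g) = fst A"
    and "g \<in> carrier G \<Longrightarrow> is_iso C (snd A g)"
  using assms by (auto simp: equivariant_category_def equivariant_objects_def Pi_iff PiE_def)

lemma Obj_EC_coherence:
  assumes "A \<in> Obj EC" "g \<in> carrier G" "h \<in> carrier G"
  shows "snd A g \<cdot> FArr (F g) (snd A h) = snd A (h \<otimes>\<^bsub>G\<^esub> g) \<cdot> \<delta> g h (fst A)"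
  using assms by (auto simp: equivariant_category_def equivariant_objects_def)

lemma Arr_EC_iff:
  "(A, a, B) \<in> Arr EC \<longleftrightarrow> A \<in> Obj EC \<and> B \<in> Obj EC \<and> a \<in> Arr C \<and> Dom C a = fst A \<and> Cod C a = fst B \<and>
     (\<forall>g\<in>carrier G. a \<cdot> snd A g = snd B g \<cdot> FArr (F g) a)"
  by (cases A; cases B) (auto simp: equivariant_category_def equivariant_arrows_def)

lemma Arr_EC_D:
  assumes "(A, a, B) \<in> Arr EC"
  shows "A \<in> Obj EC" "B \<in> Obj EC" "a \<in> Arr C" "Dom C a = fst A" "Cod C a = fst B"
    and "g \<in> carrier G \<Longrightarrow> a \<cdot> snd A g = snd B g \<cdot> FArr (F g) a"
  using assms by (auto simp: Arr_EC_iff)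

lemma equivariant_is_iso:
  assumes "(A, a, B) \<in> Arr EC" "is_iso C a"
  shows "(B, Inv a, A) \<in> Arr EC"
proof -
  note [simp] = Arr_EC_D(1-5)[OF assms(1)] assms(2)
  have "Inv a \<cdot> snd B g = snd A g \<cdot> FArr (F g) (Inv a)" if [simp]: "g \<in> carrier G" for g
  proof (rule iso_cancel_left[OF assms(2)], rule iso_cancel_right[OF F_is_iso[OF \<open>g \<in> carrier G\<close> assms(2)]])
    have "a \<cdot> (snd A g \<cdot> (FArr (F g) (Inv a) \<cdot> FArr (F g) a)) = a \<cdot> snd A g"
      by (simp flip: F_simps(6))
    then show "(a \<cdot> (Inv a \<cdot> snd B g)) \<cdot> FArr (F g) a = (a \<cdot> (snd A g \<cdot> FArr (F g) (Inv a))) \<cdot> FArr (F g) a"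
      by (simp add: Arr_EC_D(6)[OF assms(1)])
  qed auto
  then show ?thesis by (simp add: Arr_EC_iff)
qed

section \<open>The equivariant category is additive\<close>

sublocale EC: category EC
proof
  fix f assume f: "f \<in> Arr EC"
  show "Dom EC f \<in> Obj EC" "Cod EC f \<in> Obj EC"
    by (cases f; use f in \<open>simp add: Arr_EC_iff\<close>)+
next
  fix A assume "A \<in> Obj EC"
  then show "Idn EC A \<in> Hom EC A A" by (simp add: Arr_EC_iff)
next
  fix f g A B D assume fg: "f \<in> Hom EC A B" "g \<in> Hom EC B D"
  obtain a b where ab [simp]: "f = (A, a, B)" "g = (B, b, D)"
    using fg by (cases f; cases g) auto
  have f: "(A, a, B) \<in> Arr EC" and g: "(B, b, D) \<in> Arr EC" using fg by auto
  note [simp] = Arr_EC_D(1-5)[OF f] Arr_EC_D(1-5)[OF g]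
  have "b \<cdot> (a \<cdot> snd A k) = snd D k \<cdot> (FArr (F k) b \<cdot> FArr (F k) a)" if [simp]: "k \<in> carrier G" for k
    using Arr_EC_D(6)[OF f, of k] Cmp_reassoc[OF Arr_EC_D(6)[OF g, of k]] by simp
  then show "Cmp EC g f \<in> Hom EC A D" by (simp add: Arr_EC_iff)
next
  fix f A B assume "f \<in> Hom EC A B"
  then show "Cmp EC f (Idn EC A) = f" "Cmp EC (Idn EC B) f = f"
    by (cases f; simp add: Arr_EC_iff)+
next
  fix f g h W A B D assume "f \<in> Hom EC W A" "g \<in> Hom EC A B" "h \<in> Hom EC B D"
  then show "Cmp EC (Cmp EC h g) f = Cmp EC h (Cmp EC g f)"
    by (cases f; cases g; cases h) (simp add: Arr_EC_iff)
qed

lemma Arr_EC_Add: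
  assumes "(A, a, B) \<in> Arr EC" "(A, a', B) \<in> Arr EC"
  shows "(A, a \<oplus> a', B) \<in> Arr EC"
  using assms by (simp add: Arr_EC_iff Cmp_Add Add_Cmp)

lemma Arr_EC_Zero: "A \<in> Obj EC \<Longrightarrow> B \<in> Obj EC \<Longrightarrow> (A, Zero C (fst A) (fst B), B) \<in> Arr EC"
  by (simp add: Arr_EC_iff)

lemma Arr_EC_Neg: "(A, a, B) \<in> Arr EC \<Longrightarrow> (A, Neg C a, B) \<in> Arr EC"
  by (simp add: Arr_EC_iff)

sublocale EC: preadditive_category EC
proof (intro preadditive_category.intro EC.category_axioms preadditive_category_axioms.intro)
  fix A B assume AB [simp]: "A \<in> Obj EC" "B \<in> Obj EC"
  have hom: "f \<in> carrier (hom_group EC A B) \<Longrightarrow> \<exists>a. f = (A, a, B) \<and> (A, a, B) \<in> Arr EC" for f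
    by (cases f) (auto simp: hom_group_def)
  show "comm_group (hom_group EC A B)"
  proof (rule comm_groupI)
    fix f assume "f \<in> carrier (hom_group EC A B)"
    then obtain a where [simp]: "f = (A, a, B)" and a: "(A, a, B) \<in> Arr EC" using hom by blast
    note [simp] = Arr_EC_D[OF a]
    show "\<exists>g\<in>carrier (hom_group EC A B). g \<otimes>\<^bsub>hom_group EC A B\<^esub> f = \<one>\<^bsub>hom_group EC A B\<^esub>"
      using Arr_EC_Neg[OF a] by (intro bexI[of _ "(A, Neg C a, B)"]) (simp_all add: hom_group_def)
    show "\<one>\<^bsub>hom_group EC A B\<^esub> \<otimes>\<^bsub>hom_group EC A B\<^esub> f = f"
      by (simp add: hom_group_def)
  next
    fix f g assume "f \<in> carrier (hom_group EC A B)" "g \<in> carrier (hom_group EC A B)"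
    then obtain a b where [simp]: "f = (A, a, B)" "g = (A, b, B)"
      and a: "(A, a, B) \<in> Arr EC" and b: "(A, b, B) \<in> Arr EC" using hom by metis
    note [simp] = Arr_EC_D(1-5)[OF a] Arr_EC_D(1-5)[OF b]
    show "f \<otimes>\<^bsub>hom_group EC A B\<^esub> g \<in> carrier (hom_group EC A B)"
      using Arr_EC_Add[OF a b] by (simp add: hom_group_def)
    show "f \<otimes>\<^bsub>hom_group EC A B\<^esub> g = g \<otimes>\<^bsub>hom_group EC A B\<^esub> f"
      by (simp add: hom_group_def Add_comm)
    fix h assume "h \<in> carrier (hom_group EC A B)"
    then obtain c where [simp]: "h = (A, c, B)" and c: "(A, c, B) \<in> Arr EC" using hom by blast
    note [simp] = Arr_EC_D(1-5)[OF c]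
    show "f \<otimes>\<^bsub>hom_group EC A B\<^esub> g \<otimes>\<^bsub>hom_group EC A B\<^esub> h = f \<otimes>\<^bsub>hom_group EC A B\<^esub> (g \<otimes>\<^bsub>hom_group EC A B\<^esub> h)"
      by (simp add: hom_group_def Add_assoc)
  next
    show "\<one>\<^bsub>hom_group EC A B\<^esub> \<in> carrier (hom_group EC A B)"
      using Arr_EC_Zero[of A B] by (simp add: hom_group_def)
  qed
next
  fix A g B D assume A: "A \<in> Obj EC" and g: "g \<in> Hom EC B D"
  show "(\<lambda>f. Cmp EC g f) \<in> hom (hom_group EC A B) (hom_group EC A D)"
  proof (rule homI)
    fix f assume "f \<in> carrier (hom_group EC A B)"
    then show "Cmp EC g f \<in> carrier (hom_group EC A D)"
      using g by (auto simp: hom_group_def)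
  next
    fix f f' assume "f \<in> carrier (hom_group EC A B)" "f' \<in> carrier (hom_group EC A B)"
    then show "Cmp EC g (f \<otimes>\<^bsub>hom_group EC A B\<^esub> f') = Cmp EC g f \<otimes>\<^bsub>hom_group EC A D\<^esub> Cmp EC g f'"
      using g by (cases f; cases f'; cases g) (auto simp: hom_group_def Arr_EC_iff Cmp_Add)
  qed
next
  fix A f B D assume A: "D \<in> Obj EC" and g: "f \<in> Hom EC A B"
  show "(\<lambda>g. Cmp EC g f) \<in> hom (hom_group EC B D) (hom_group EC A D)"
  proof (rule homI)
    fix h assume "h \<in> carrier (hom_group EC B D)"
    then show "Cmp EC h f \<in> carrier (hom_group EC A D)"
      using g by (auto simp: hom_group_def)
  next
    fix h h' assume "h \<in> carrier (hom_group EC B D)" "h' \<in> carrier (hom_group EC B D)"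
    then show "Cmp EC (h \<otimes>\<^bsub>hom_group EC B D\<^esub> h') f = Cmp EC h f \<otimes>\<^bsub>hom_group EC A D\<^esub> Cmp EC h' f"
      using g by (cases f; cases h; cases h') (auto simp: hom_group_def Arr_EC_iff Add_Cmp)
  qed
qed

lemma Neg_EC [simp]: "(A, a, B) \<in> Arr EC \<Longrightarrow> Neg EC (A, a, B) = (A, Neg C a, B)"
  by (rule EC.Neg_unique) (auto simp: Arr_EC_Neg Arr_EC_D)

lemma zero_object_EC_exists: "\<exists>A. zero_object EC A"
proof -
  obtain Z where Z: "zero_object C Z" and [simp]: "Z \<in> Obj C" by (rule obtain_zero_object)
  have F0: "zero_object C (FObj (F g) Z)" if "g \<in> carrier G" for g
    using zero_object_Idn[OF Z] that
    by (intro zero_objectI preadditive_category_axioms) (simp_all flip: F_simps(5,8))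
  define \<phi> where "\<phi> g = Zero C (FObj (F g) Z) Z" for g
  have "(Z, restrict \<phi> (carrier G)) \<in> Obj EC"
  proof (rule Obj_EC_I)
    fix g assume [simp]: "g \<in> carrier G"
    show "is_iso C (\<phi> g)"
      by (rule is_isoI[of _ "Zero C Z (FObj (F g) Z)"])
        (simp_all add: \<phi>_def zero_object_Idn[OF Z] zero_object_Idn[OF F0])
    fix h assume [simp]: "h \<in> carrier G"
    show "\<phi> g \<cdot> FArr (F g) (\<phi> h) = \<phi> (h \<otimes>\<^bsub>G\<^esub> g) \<cdot> \<delta> g h Z"
      by (simp add: \<phi>_def m_closed)
  qed (auto simp: \<phi>_def)
  then show ?thesis
    by (intro exI[of _ "(Z, restrict \<phi> (carrier G))"] zero_objectI EC.preadditive_category_axioms) (simp_all add: zero_object_Idn[OF Z])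
qed

text \<open>The structure map of the sum is diagonal with entries \<open>snd A g\<close> and
  \<open>snd B g\<close>. Additivity of \<open>F g\<close> makes the image of the biproduct a
  biproduct, so invertibility and coherence can be tested on components.\<close>

lemma biproduct_EC_exists:
  assumes A [simp]: "A \<in> Obj EC" and B [simp]: "B \<in> Obj EC"
  shows "\<exists>P i j p q. is_biproduct EC A B P i j p q"
proof -
  obtain P i j p q where P: "is_biproduct C (fst A) (fst B) P i j p q"
    using biproduct_exists by force
  note [simp] = biproduct_simps[OF P]
  define \<phi> where "\<phi> g = i \<cdot> (snd A g \<cdot> FArr (F g) p) \<oplus> j \<cdot> (snd B g \<cdot> FArr (F g) q)" for g
  define \<psi> where "\<psi> g = FArr (F g) i \<cdot> (Inv (snd A g) \<cdot> p) \<oplus> FArr (F g) j \<cdot> (Inv (snd B g) \<cdot> q)" for g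
  have \<phi> [simp]: "\<phi> g \<in> Arr C" "Dom C (\<phi> g) = FObj (F g) P" "Cod C (\<phi> g) = P" if "g \<in> carrier G" for g
    using that by (simp_all add: \<phi>_def)
  have \<psi> [simp]: "\<psi> g \<in> Arr C" "Dom C (\<psi> g) = P" "Cod C (\<psi> g) = FObj (F g) P" if "g \<in> carrier G" for g
    using that by (simp_all add: \<psi>_def)
  have FP: "is_biproduct C (FObj (F g) (fst A)) (FObj (F g) (fst B)) (FObj (F g) P)
      (FArr (F g) i) (FArr (F g) j) (FArr (F g) p) (FArr (F g) q)" if [simp]: "g \<in> carrier G" for g
    using is_biproductD(20)[OF P] unfolding is_biproduct_def by (simp flip: F_simps(5-8))
  have p\<phi>: "p \<cdot> \<phi> g = snd A g \<cdot> FArr (F g) p" and q\<phi>: "q \<cdot> \<phi> g = snd B g \<cdot> FArr (F g) q"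
    and \<phi>i: "\<phi> g \<cdot> FArr (F g) i = i \<cdot> snd A g" and \<phi>j: "\<phi> g \<cdot> FArr (F g) j = j \<cdot> snd B g"
    and p\<psi>: "FArr (F g) p \<cdot> \<psi> g = Inv (snd A g) \<cdot> p" and q\<psi>: "FArr (F g) q \<cdot> \<psi> g = Inv (snd B g) \<cdot> q"
    if [simp]: "g \<in> carrier G" for g
    using biproduct_simps[OF FP[OF that]] by (simp_all add: \<phi>_def \<psi>_def Cmp_Add Add_Cmp)
  let ?P = "(P, restrict \<phi> (carrier G))"
  have [simp]: "?P \<in> Obj EC"
  proof (rule Obj_EC_I)
    fix g assume [simp]: "g \<in> carrier G"
    show "is_iso C (\<phi> g)"
    proof (rule is_isoI[of _ "\<psi> g"])
      show "\<psi> g \<cdot> \<phi> g = Idn C (Dom C (\<phi> g))"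
        by (rule biproduct_eqI[OF FP[of g]])
          (simp_all add: Cmp_reassoc[OF p\<psi>] Cmp_reassoc[OF q\<psi>] p\<phi> q\<phi>)
      show "\<phi> g \<cdot> \<psi> g = Idn C (Cod C (\<phi> g))"
        by (rule biproduct_eqI[OF P])
          (simp_all add: Cmp_reassoc[OF p\<phi>] Cmp_reassoc[OF q\<phi>] p\<psi> q\<psi>)
    qed auto
    fix h assume [simp]: "h \<in> carrier G"
    have [simp]: "h \<otimes>\<^bsub>G\<^esub> g \<in> carrier G" by simp
    \<comment> \<open>A projection \<open>r\<close> intertwines \<open>\<phi>\<close> with the
      structure of its target \<open>D\<close>, so coherence of \<open>D\<close> and naturality of
      \<open>\<delta>\<close> give coherence of \<open>\<phi>\<close> after
      \<open>r\<close>.\<close>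
    have 1: "r \<cdot> (\<phi> g \<cdot> FArr (F g) (\<phi> h)) = r \<cdot> (\<phi> (h \<otimes>\<^bsub>G\<^esub> g) \<cdot> \<delta> g h P)"
      if r\<phi>: "\<And>g. g \<in> carrier G \<Longrightarrow> r \<cdot> \<phi> g = snd D g \<cdot> FArr (F g) r"
        and [simp]: "D \<in> Obj EC" "r \<in> Arr C" "Dom C r = P" "Cod C r = fst D" for r D
    proof -
      have "r \<cdot> (\<phi> g \<cdot> FArr (F g) (\<phi> h)) = snd D g \<cdot> FArr (F g) (r \<cdot> \<phi> h)"
        by (simp add: Cmp_reassoc[OF r\<phi>])
      also have "\<dots> = (snd D g \<cdot> FArr (F g) (snd D h)) \<cdot> FArr (F g) (FArr (F h) r)"
        by (simp add: r\<phi>)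
      also have "\<dots> = snd D (h \<otimes>\<^bsub>G\<^esub> g) \<cdot> (\<delta> g h (Cod C r) \<cdot> FArr (F g) (FArr (F h) r))"
        by (simp add: Obj_EC_coherence)
      also have "\<dots> = (snd D (h \<otimes>\<^bsub>G\<^esub> g) \<cdot> FArr (F (h \<otimes>\<^bsub>G\<^esub> g)) r) \<cdot> \<delta> g h (Dom C r)"
        by (subst \<delta>_natural) auto
      also have "\<dots> = r \<cdot> (\<phi> (h \<otimes>\<^bsub>G\<^esub> g) \<cdot> \<delta> g h P)"
        by (simp flip: r\<phi>)
      finally show ?thesis .
    qed
    show "\<phi> g \<cdot> FArr (F g) (\<phi> h) = \<phi> (h \<otimes>\<^bsub>G\<^esub> g) \<cdot> \<delta> g h P"
      by (rule biproduct_eqI[OF P]) (auto intro!: 1[OF p\<phi>] 1[OF q\<phi>])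
  qed auto
  have "is_biproduct EC A B ?P (A, i, ?P) (B, j, ?P) (?P, p, A) (?P, q, B)"
    using is_biproductD(20)[OF P] unfolding is_biproduct_def
    by (simp add: Arr_EC_iff p\<phi> q\<phi> \<phi>i \<phi>j)
  then show ?thesis by blast
qed

sublocale EC: additive_category EC
  using zero_object_EC_exists biproduct_EC_exists by unfold_locales

end

section \<open>The suspension of equivariant objects\<close>

context admissible_action
begin

lemma ES_simps [simp]:
  "fst (FObj ES A) = FObj S (fst A)"
  "g \<in> carrier G \<Longrightarrow> snd (FObj ES A) g = FArr S (snd A g) \<cdot> \<theta> g (fst A)"
  "FArr ES (A, a, B) = (FObj ES A, FArr S a, FObj ES B)"
  by (cases A; simp add: equivariant_susp_def equivariant_susp_obj_def)+

text \<open>Naturality of \<open>\<theta>\<close> separates the structure maps from the two copies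
  of \<open>\<theta>\<close>. Coherence of \<open>A\<close> handles the former, the compatibility of
  \<open>\<theta>\<close> with \<open>\<delta>\<close> the latter.\<close>

lemma ES_Obj [simp]:
  assumes [simp]: "A \<in> Obj EC"
  shows "FObj ES A \<in> Obj EC"
proof -
  let ?\<phi> = "\<lambda>g. FArr S (snd A g) \<cdot> \<theta> g (fst A)"
  have "(FObj S (fst A), restrict ?\<phi> (carrier G)) \<in> Obj EC"
  proof (rule Obj_EC_I)
    fix g assume [simp]: "g \<in> carrier G"
    show "is_iso C (?\<phi> g)" by (intro is_iso_Cmp S_is_iso) auto
    fix h assume [simp]: "h \<in> carrier G"
    have [simp]: "h \<otimes>\<^bsub>G\<^esub> g \<in> carrier G" by simp
    have "?\<phi> g \<cdot> FArr (F g) (?\<phi> h)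
        = FArr S (snd A g) \<cdot> ((\<theta> g (Cod C (snd A h)) \<cdot> FArr (F g) (FArr S (snd A h))) \<cdot> FArr (F g) (\<theta> h (fst A)))"
      by simp
    also have "\<dots> = FArr S (snd A g \<cdot> FArr (F g) (snd A h)) \<cdot> (\<theta> g (FObj (F h) (fst A)) \<cdot> FArr (F g) (\<theta> h (fst A)))"
      by (subst \<theta>_natural) auto
    also have "\<dots> = FArr S (snd A (h \<otimes>\<^bsub>G\<^esub> g)) \<cdot>
        (FArr S (\<delta> g h (fst A)) \<cdot> \<theta> g (FObj (F h) (fst A)) \<cdot> FArr (F g) (\<theta> h (fst A)))"
      by (simp add: Obj_EC_coherence)
    also have "\<dots> = ?\<phi> (h \<otimes>\<^bsub>G\<^esub> g) \<cdot> \<delta> g h (FObj S (fst A))"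
      by (subst \<theta>_\<delta>_compat[symmetric]) auto
    finally show "?\<phi> g \<cdot> FArr (F g) (?\<phi> h) = ?\<phi> (h \<otimes>\<^bsub>G\<^esub> g) \<cdot> \<delta> g h (FObj S (fst A))" .
  qed auto
  then show ?thesis
    by (cases A) (simp add: equivariant_susp_def equivariant_susp_obj_def)
qed

text \<open>By naturality of \<open>\<theta>\<close> the suspended square is the suspension of the
  original one precomposed with an isomorphism, and the suspension is faithful. Fullness of
  \<open>ES\<close> rests on the reflecting direction.\<close>

lemma ES_Arr_iff:
  assumes [simp]: "A \<in> Obj EC" "B \<in> Obj EC" "a \<in> Arr C" "Dom C a = fst A" "Cod C a = fst B"
  shows "(FObj ES A, FArr S a, FObj ES B) \<in> Arr EC \<longleftrightarrow> (A, a, B) \<in> Arr EC"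
proof -
  have "FArr S a \<cdot> snd (FObj ES A) g = snd (FObj ES B) g \<cdot> FArr (F g) (FArr S a) \<longleftrightarrow>
      a \<cdot> snd A g = snd B g \<cdot> FArr (F g) a" (is "?l = ?r \<longleftrightarrow> _") if [simp]: "g \<in> carrier G" for g
  proof -
    have l: "?l = FArr S (a \<cdot> snd A g) \<cdot> \<theta> g (fst A)" by simp
    have "?r = FArr S (snd B g) \<cdot> (\<theta> g (Cod C a) \<cdot> FArr (F g) (FArr S a))" by simp
    also have "\<dots> = FArr S (snd B g \<cdot> FArr (F g) a) \<cdot> \<theta> g (fst A)"
      by (subst \<theta>_natural) auto
    finally have r: "?r = FArr S (snd B g \<cdot> FArr (F g) a) \<cdot> \<theta> g (fst A)" .
    have "?l = ?r \<longleftrightarrow> FArr S (a \<cdot> snd A g) = FArr S (snd B g \<cdot> FArr (F g) a)"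
      unfolding l r using iso_cancel_right[of "\<theta> g (fst A)" "FArr S (a \<cdot> snd A g)" "FArr S (snd B g \<cdot> FArr (F g) a)"]
      by (auto simp del: S_simps(6))
    also have "\<dots> \<longleftrightarrow> a \<cdot> snd A g = snd B g \<cdot> FArr (F g) a"
      using S_faithful[of "a \<cdot> snd A g" "snd B g \<cdot> FArr (F g) a"] by (auto simp del: S_simps(6))
    finally show ?thesis .
  qed
  then show ?thesis by (simp add: Arr_EC_iff del: ES_simps(2))
qed

lemma ES_Arr: "(A, a, B) \<in> Arr EC \<Longrightarrow> (FObj ES A, FArr S a, FObj ES B) \<in> Arr EC"
  using Arr_EC_D[of A a B] by (simp add: ES_Arr_iff)

lemma is_iso_EC:
  assumes "(A, a, B) \<in> Arr EC"
  shows "is_iso EC (A, a, B) \<longleftrightarrow> is_iso C a"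
proof
  note [simp] = Arr_EC_D[OF assms]
  assume "is_iso EC (A, a, B)"
  then obtain f where f: "f \<in> Hom EC B A" "Cmp EC f (A, a, B) = Idn EC A" "Cmp EC (A, a, B) f = Idn EC B"
    by (auto simp: is_iso_def)
  obtain b where b: "f = (B, b, A)" using f(1) by (cases f) auto
  have "(B, b, A) \<in> Arr EC" using f(1) b by simp
  from Arr_EC_D[OF this] show "is_iso C a"
    using f(2,3) b by (intro is_isoI[of _ b]) auto
next
  note [simp] = Arr_EC_D[OF assms]
  assume "is_iso C a"
  then show "is_iso EC (A, a, B)"
    using assms equivariant_is_iso[OF assms] by (intro EC.is_isoI[of _ "(B, Inv a, A)"]) auto
qed

lemma S_reflects_iso:
  assumes [simp]: "f \<in> Arr C" and "is_iso C (FArr S f)"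
  shows "is_iso C f"
proof -
  obtain r where r: "r \<in> Hom C (Cod C f) (Dom C f)" "FArr S r = Inv (FArr S f)"
    using S_full[of "Cod C f" "Dom C f" "Inv (FArr S f)"] assms by auto
  then have [simp]: "r \<in> Arr C" "Dom C r = Cod C f" "Cod C r = Dom C f" by auto
  show ?thesis
  proof (rule is_isoI[of _ r])
    show "r \<cdot> f = Idn C (Dom C f)" by (rule S_faithful) (use assms r(2) in auto)
    show "f \<cdot> r = Idn C (Cod C f)" by (rule S_faithful) (use assms r(2) in auto)
  qed auto
qed

text \<open>Transport of structure: \<open>fst B\<close> is only isomorphic to some
  \<open>\<Sigma>X\<close>, so the structure maps of \<open>B\<close> are carried along
  \<open>e\<close>, freed of \<open>\<theta>\<close>, and lifted to \<open>X\<close> by fullness of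
  the suspension.\<close>

lemma ES_essentially_surjective:
  assumes B [simp]: "B \<in> Obj EC"
  shows "\<exists>A\<in>Obj EC. \<exists>e\<in>Hom EC (FObj ES A) B. is_iso EC e"
proof -
  obtain X e where [simp]: "X \<in> Obj C" "e \<in> Arr C" "Dom C e = FObj S X" "Cod C e = fst B" "is_iso C e"
    using equivalence_surj[OF category_axioms category_axioms susp_equivalence, of "fst B"] by auto
  let ?h = "\<lambda>g. Inv e \<cdot> (snd B g \<cdot> (FArr (F g) e \<cdot> Inv (\<theta> g X)))"
  have "\<exists>f. f \<in> Hom C (FObj (F g) X) X \<and> FArr S f = ?h g" if [simp]: "g \<in> carrier G" for g
    using S_full[of "FObj (F g) X" X "?h g"] by auto
  then obtain \<phi> where \<phi>: "\<phi> g \<in> Hom C (FObj (F g) X) X" "FArr S (\<phi> g) = ?h g" if "g \<in> carrier G" for g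
    by metis
  have [simp]: "\<phi> g \<in> Arr C" "Dom C (\<phi> g) = FObj (F g) X" "Cod C (\<phi> g) = X" if "g \<in> carrier G" for g
    using \<phi>(1)[OF that] by auto
  have e\<phi>: "e \<cdot> (FArr S (\<phi> g) \<cdot> \<theta> g X) = snd B g \<cdot> FArr (F g) e" if [simp]: "g \<in> carrier G" for g
    by (simp add: \<phi>(2))
  let ?A = "(X, restrict \<phi> (carrier G))"
  have A [simp]: "?A \<in> Obj EC"
  proof (rule Obj_EC_I)
    fix g assume [simp]: "g \<in> carrier G"
    show "is_iso C (\<phi> g)"
      by (rule S_reflects_iso) (auto simp: \<phi>(2) intro!: is_iso_Cmp is_iso_Inv)
    fix h assume [simp]: "h \<in> carrier G"
    have [simp]: "h \<otimes>\<^bsub>G\<^esub> g \<in> carrier G" by simp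
    \<comment> \<open>Coherence is tested after suspending, composing with \<open>e\<close> and
      precomposing with \<open>?\<tau>\<close>. All three operations are injective, and in this form
      the claim becomes coherence of \<open>B\<close>.\<close>
    let ?\<tau> = "\<theta> g (FObj (F h) X) \<cdot> FArr (F g) (\<theta> h X)"
    have \<tau>: "is_iso C ?\<tau>" by (intro is_iso_Cmp) auto
    have "e \<cdot> (FArr S (\<phi> g \<cdot> FArr (F g) (\<phi> h)) \<cdot> ?\<tau>) =
       e \<cdot> (FArr S (\<phi> g) \<cdot> ((FArr S (FArr (F g) (\<phi> h)) \<cdot> \<theta> g (Dom C (\<phi> h))) \<cdot> FArr (F g) (\<theta> h X)))"
      by simp
    also have "\<dots> = (e \<cdot> (FArr S (\<phi> g) \<cdot> \<theta> g X)) \<cdot> (FArr (F g) (FArr S (\<phi> h)) \<cdot> FArr (F g) (\<theta> h X))"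
      by (subst \<theta>_natural[symmetric]) auto
    also have "\<dots> = snd B g \<cdot> FArr (F g) (e \<cdot> (FArr S (\<phi> h) \<cdot> \<theta> h X))"
      by (subst e\<phi>) auto
    also have "\<dots> = snd B g \<cdot> FArr (F g) (snd B h) \<cdot> FArr (F g) (FArr (F h) e)"
      by (subst e\<phi>) auto
    also have "\<dots> = snd B (h \<otimes>\<^bsub>G\<^esub> g) \<cdot> (\<delta> g h (Cod C e) \<cdot> FArr (F g) (FArr (F h) e))"
      by (subst Obj_EC_coherence) auto
    also have "\<dots> = (snd B (h \<otimes>\<^bsub>G\<^esub> g) \<cdot> FArr (F (h \<otimes>\<^bsub>G\<^esub> g)) e) \<cdot> \<delta> g h (FObj S X)"
      by (subst \<delta>_natural) auto
    also have "\<dots> = e \<cdot> (FArr S (\<phi> (h \<otimes>\<^bsub>G\<^esub> g)) \<cdot> (\<theta> (h \<otimes>\<^bsub>G\<^esub> g) X \<cdot> \<delta> g h (FObj S X)))"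
      by (subst e\<phi>[symmetric]) auto
    also have "\<dots> = e \<cdot> (FArr S (\<phi> (h \<otimes>\<^bsub>G\<^esub> g) \<cdot> \<delta> g h X) \<cdot> ?\<tau>)"
      by (subst \<theta>_\<delta>_compat) auto
    finally have "FArr S (\<phi> g \<cdot> FArr (F g) (\<phi> h)) \<cdot> ?\<tau> = FArr S (\<phi> (h \<otimes>\<^bsub>G\<^esub> g) \<cdot> \<delta> g h X) \<cdot> ?\<tau>"
      by (rule iso_cancel_left[rotated]) (auto simp del: S_simps(6) Cmp_assoc_simp)
    then have "FArr S (\<phi> g \<cdot> FArr (F g) (\<phi> h)) = FArr S (\<phi> (h \<otimes>\<^bsub>G\<^esub> g) \<cdot> \<delta> g h X)"
      by (rule iso_cancel_right[OF \<tau>]) (auto simp del: S_simps(6) Cmp_assoc_simp)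
    then show "\<phi> g \<cdot> FArr (F g) (\<phi> h) = \<phi> (h \<otimes>\<^bsub>G\<^esub> g) \<cdot> \<delta> g h X"
      by (rule S_faithful[rotated 4]) (auto simp del: S_simps(6))
  qed auto
  have "(FObj ES ?A, e, B) \<in> Arr EC" by (simp add: Arr_EC_iff e\<phi>)
  then show ?thesis
    by (intro bexI[of _ ?A] bexI[of _ "(FObj ES ?A, e, B)"]) (auto simp: is_iso_EC)
qed

lemma ES_is_functor: "is_functor EC EC ES"
  unfolding is_functor_def
proof (intro conjI ballI impI)
  fix f assume "f \<in> Arr EC"
  then show "FArr ES f \<in> Hom EC (FObj ES (Dom EC f)) (FObj ES (Cod EC f))"
    by (cases f) (simp add: ES_Arr)
next
  fix f g assume "f \<in> Arr EC" "g \<in> Arr EC" "Cod EC f = Dom EC g"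
  then show "FArr ES (Cmp EC g f) = Cmp EC (FArr ES g) (FArr ES f)"
    by (cases f; cases g) (auto simp: Arr_EC_iff)
qed auto

lemma ES_additive: "is_additive_functor EC EC ES"
  unfolding is_additive_functor_def
proof (intro conjI ballI ES_is_functor)
  fix A B assume "A \<in> Obj EC" "B \<in> Obj EC"
  show "FArr ES \<in> hom (hom_group EC A B) (hom_group EC (FObj ES A) (FObj ES B))"
  proof (rule homI)
    fix f assume "f \<in> carrier (hom_group EC A B)"
    then show "FArr ES f \<in> carrier (hom_group EC (FObj ES A) (FObj ES B))"
      by (cases f) (auto simp: ES_Arr)
  next
    fix f f' assume "f \<in> carrier (hom_group EC A B)" "f' \<in> carrier (hom_group EC A B)"
    then show "FArr ES (f \<otimes>\<^bsub>hom_group EC A B\<^esub> f') = FArr ES f \<otimes>\<^bsub>hom_group EC (FObj ES A) (FObj ES B)\<^esub> FArr ES f'"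
      by (cases f; cases f') (auto simp: Arr_EC_iff)
  qed
qed

lemma ES_equivalence: "is_equivalence EC EC ES"
proof (rule is_equivalenceI[OF EC.category_axioms EC.category_axioms ES_is_functor])
  fix f g assume "f \<in> Arr EC" "g \<in> Arr EC" "Dom EC f = Dom EC g" "Cod EC f = Cod EC g" "FArr ES f = FArr ES g"
  then show "f = g"
    by (cases f; cases g) (auto simp: Arr_EC_iff intro: S_faithful)
next
  fix A B f assume [simp]: "A \<in> Obj EC" "B \<in> Obj EC" and f: "f \<in> Hom EC (FObj ES A) (FObj ES B)"
  obtain h where h: "f = (FObj ES A, h, FObj ES B)" using f by (cases f) auto
  have hA: "(FObj ES A, h, FObj ES B) \<in> Arr EC" using f h by simp
  obtain a where a: "a \<in> Hom C (fst A) (fst B)" "FArr S a = h"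
    using S_full[of "fst A" "fst B" h] Arr_EC_D(1-5)[OF hA] by auto
  then have "(A, a, B) \<in> Arr EC" using hA ES_Arr_iff[of A B a] by auto
  then show "\<exists>e\<in>Hom EC A B. FArr ES e = f"
    using a h by (intro bexI[of _ "(A, a, B)"]) auto
qed (rule ES_essentially_surjective)

end

section \<open>Conjugation and averaging\<close>

context admissible_action
begin

text \<open>Inverting the structure map of the source turns the square that defines equivariance
  into a fixed-point equation.\<close>

definition conjugate :: "('o \<times> ('g \<Rightarrow> 'm)) \<Rightarrow> ('o \<times> ('g \<Rightarrow> 'm)) \<Rightarrow> 'g \<Rightarrow> 'm \<Rightarrow> 'm" where
  "conjugate A B g a = snd B g \<cdot> (FArr (F g) a \<cdot> Inv (snd A g))"

context
  fixes A B g a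
  assumes AB [simp]: "A \<in> Obj EC" "B \<in> Obj EC" and g [simp]: "g \<in> carrier G"
    and a [simp]: "a \<in> Arr C" "Dom C a = fst A" "Cod C a = fst B"
begin

lemma conj_simps [simp]: "conjugate A B g a \<in> Arr C" "Dom C (conjugate A B g a) = fst A" "Cod C (conjugate A B g a) = fst B"
  by (simp_all add: conjugate_def)

lemma conj_Cmp_structure: "conjugate A B g a \<cdot> snd A g = snd B g \<cdot> FArr (F g) a"
  by (simp add: conjugate_def)

lemma conj_eqI:
  assumes "c \<in> Arr C" "Dom C c = fst A" "Cod C c = fst B" "c \<cdot> snd A g = snd B g \<cdot> FArr (F g) a"
  shows "conjugate A B g a = c"
  by (rule iso_cancel_right[of "snd A g"]) (use assms in \<open>auto simp: conj_Cmp_structure\<close>)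

end

lemma conj_equivariant: "(A, a, B) \<in> Arr EC \<Longrightarrow> g \<in> carrier G \<Longrightarrow> conjugate A B g a = a"
  using Arr_EC_D(1-5)[of A a B] Arr_EC_D(6)[of A a B g] by (intro conj_eqI) auto

lemma Arr_EC_conjI:
  assumes [simp]: "A \<in> Obj EC" "B \<in> Obj EC" "a \<in> Arr C" "Dom C a = fst A" "Cod C a = fst B"
    and eq: "\<And>g. g \<in> carrier G \<Longrightarrow> conjugate A B g a = a"
  shows "(A, a, B) \<in> Arr EC"
  using conj_Cmp_structure[of A B _ a] by (simp add: Arr_EC_iff eq)

lemma conj_Cmp:
  assumes [simp]: "A \<in> Obj EC" "B \<in> Obj EC" "D \<in> Obj EC" "g \<in> carrier G"
    "a \<in> Arr C" "Dom C a = fst A" "Cod C a = fst B" "b \<in> Arr C" "Dom C b = fst B" "Cod C b = fst D"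
  shows "conjugate A D g (b \<cdot> a) = conjugate B D g b \<cdot> conjugate A B g a"
proof (rule conj_eqI)
  show "conjugate B D g b \<cdot> conjugate A B g a \<cdot> snd A g = snd D g \<cdot> FArr (F g) (b \<cdot> a)"
    by (simp add: conj_Cmp_structure Cmp_reassoc[OF conj_Cmp_structure])
qed auto

text \<open>Coherence of both objects and naturality of \<open>\<delta>\<close> meet after
  precomposing with the isomorphism \<open>\<delta> g h\<close>. The order
  \<open>h \<otimes> g\<close> is inherited from the target of \<open>\<delta> g h\<close>.\<close>

lemma conj_conj:
  assumes [simp]: "A \<in> Obj EC" "B \<in> Obj EC" "g \<in> carrier G" "h \<in> carrier G"
    "a \<in> Arr C" "Dom C a = fst A" "Cod C a = fst B"
  shows "conjugate A B g (conjugate A B h a) = conjugate A B (h \<otimes>\<^bsub>G\<^esub> g) a"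
proof (rule conj_eqI[symmetric])
  let ?c = "conjugate A B g (conjugate A B h a)"
  have [simp]: "h \<otimes>\<^bsub>G\<^esub> g \<in> carrier G" by simp
  have "(?c \<cdot> snd A (h \<otimes>\<^bsub>G\<^esub> g)) \<cdot> \<delta> g h (fst A) = (?c \<cdot> snd A g) \<cdot> FArr (F g) (snd A h)"
    by (simp add: Obj_EC_coherence)
  also have "\<dots> = snd B g \<cdot> FArr (F g) (conjugate A B h a \<cdot> snd A h)"
    by (subst conj_Cmp_structure[of A B g]) auto
  also have "\<dots> = (snd B g \<cdot> FArr (F g) (snd B h)) \<cdot> FArr (F g) (FArr (F h) a)"
    by (subst conj_Cmp_structure[of A B h a]) auto
  also have "\<dots> = snd B (h \<otimes>\<^bsub>G\<^esub> g) \<cdot> (\<delta> g h (Cod C a) \<cdot> FArr (F g) (FArr (F h) a))"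
    by (simp add: Obj_EC_coherence)
  also have "\<dots> = (snd B (h \<otimes>\<^bsub>G\<^esub> g) \<cdot> FArr (F (h \<otimes>\<^bsub>G\<^esub> g)) a) \<cdot> \<delta> g h (fst A)"
    by (subst \<delta>_natural) auto
  finally show "?c \<cdot> snd A (h \<otimes>\<^bsub>G\<^esub> g) = snd B (h \<otimes>\<^bsub>G\<^esub> g) \<cdot> FArr (F (h \<otimes>\<^bsub>G\<^esub> g)) a"
    by (rule iso_cancel_right[rotated]) auto
qed auto

lemma conj_hom:
  assumes [simp]: "A \<in> Obj EC" "B \<in> Obj EC" "g \<in> carrier G"
  shows "conjugate A B g \<in> hom (hom_group C (fst A) (fst B)) (hom_group C (fst A) (fst B))"
  by (rule homI) (auto simp: conjugate_def Cmp_Add Add_Cmp)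

text \<open>The structure maps form an isomorphism of triangles from the image under the exact
  functor \<open>F g\<close> to the conjugate triangle.\<close>

lemma conj_dist:
  assumes t: "(u, v, w) \<in> \<T>" and g [simp]: "g \<in> carrier G"
    and [simp]: "A \<in> Obj EC" "B \<in> Obj EC" "D \<in> Obj EC" "Dom C u = fst A" "Cod C u = fst B" "Cod C v = fst D"
  shows "(conjugate A B g u, conjugate B D g v, conjugate D (FObj ES A) g w) \<in> \<T>"
proof -
  note [simp] = dist_type[OF t, simplified]
  show ?thesis
    using conj_Cmp_structure[of D "FObj ES A" g w]
    by (intro TR1_iso[OF F_dist[OF t g], of _ "(snd A g, snd B g, snd D g)"])
      (auto simp: is_triangle_def is_triangle_iso_def is_triangle_morphism_def conj_Cmp_structure)
qed

end

section \<open>Averages over the group and equivariant cones\<close>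

locale averaging_action = admissible_action +
  assumes finite_group: "finite (carrier G)"
    and order_invertible: "int_invertible C (int (order G))"

sublocale averaging_action \<subseteq> averaging_pre_triangulated_category C S \<T> "carrier G"
proof
  show "finite (carrier G)" by (rule finite_group)
  fix X Y assume XY: "X \<in> Obj C" "Y \<in> Obj C"
  interpret XY: comm_group "hom_group C X Y" by (rule hom_comm_group[OF XY])
  have "(\<lambda>f. f [^]\<^bsub>hom_group C X Y\<^esub> int (order G)) \<in> iso (hom_group C X Y) (hom_group C X Y)"
    using order_invertible XY by (simp add: int_invertible_def)
  then show "XY.divisible_by (card (carrier G))"
    by (simp add: XY.divisible_by_def iso_def int_pow_int order_def)
qed

context averaging_action
begin

lemma bij_betw_mult_right: "h \<in> carrier G \<Longrightarrow> bij_betw (\<lambda>g. g \<otimes>\<^bsub>G\<^esub> h) (carrier G) (carrier G)"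
  by (rule bij_betw_byWitness[where f' = "\<lambda>g. g \<otimes>\<^bsub>G\<^esub> inv\<^bsub>G\<^esub> h"]) (auto simp: m_assoc)

text \<open>Conjugating by \<open>h\<close> permutes the conjugates through the right translation
  \<open>g \<mapsto> g \<otimes> h\<close>, which leaves their average unchanged.\<close>

lemma avg_conj_equivariant:
  assumes A [simp]: "A \<in> Obj EC" "B \<in> Obj EC" and a [simp]: "a \<in> Arr C" "Dom C a = fst A" "Cod C a = fst B"
  shows "(A, avg (fst A) (fst B) (\<lambda>g. conjugate A B g a), B) \<in> Arr EC"
proof (rule Arr_EC_conjI)
  let ?m = "avg (fst A) (fst B) (\<lambda>g. conjugate A B g a)"
  show "?m \<in> Arr C" "Dom C ?m = fst A" "Cod C ?m = fst B"
    using avg_simps[of "fst A" "fst B" "\<lambda>g. conjugate A B g a"] by auto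
  fix h assume [simp]: "h \<in> carrier G"
  have "conjugate A B h ?m = avg (fst A) (fst B) (\<lambda>g. conjugate A B h (conjugate A B g a))"
    by (intro avg_hom conj_hom) auto
  also have "\<dots> = avg (fst A) (fst B) (\<lambda>g. conjugate A B (g \<otimes>\<^bsub>G\<^esub> h) a)"
    by (intro avg_cong) (auto simp: conj_conj)
  also have "\<dots> = ?m"
    by (rule avg_reindex[where f = "\<lambda>g. conjugate A B g a", OF _ _ _ bij_betw_mult_right]) auto
  finally show "conjugate A B h ?m = ?m" .
qed auto

end

section \<open>Triangles of equivariant objects\<close>

context averaging_action
begin

text \<open>A cone of an equivariant map carries maps \<open>\<psi> g : F g Z \<rightarrow> Z\<close> by TR3, which need not be
  coherent.  Replacing \<open>\<psi> g\<close> by the average over \<open>h\<close> of \<open>\<psi> (h g) \<circ> \<delta> g h \<circ> (F g (\<psi> h))\<^sup>-\<^sup>1\<close> makes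
  them so: products of differences of compatible maps vanish, so composition of compatible maps
  commutes with averaging.\<close>

lemma equivariant_cone:
  assumes u: "(A, u, B) \<in> Arr EC"
  obtains D v w where "(B, v, D) \<in> Arr EC" "(D, w, FObj ES A) \<in> Arr EC" "(u, v, w) \<in> \<T>"
proof -
  note [simp] = Arr_EC_D(1-5)[OF u]
  note [simp del] = ES_simps(2)
  obtain v w where t: "(u, v, w) \<in> \<T>" using TR1_cone[of u] by auto
  define Z where "Z = Cod C v"
  have [simp]: "v \<in> Arr C" "w \<in> Arr C" "Dom C v = fst B" "Cod C v = Z" "Dom C w = Z" "Cod C w = FObj S (fst A)"
    using dist_type[OF t] by (simp_all add: Z_def)
  have [simp]: "Z \<in> Obj C" using Cod_in_Obj[of v] by simp
  \<comment> \<open>These are the third components of triangle morphisms over the structure maps of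
    \<open>A\<close> and \<open>B\<close>. Both equations are affine in \<open>c\<close>, so
    averages of compatible maps are compatible.\<close>
  define compat where "compat g c \<longleftrightarrow> c \<in> Hom C (FObj (F g) Z) Z \<and>
    c \<cdot> FArr (F g) v = v \<cdot> snd B g \<and> w \<cdot> c = snd (FObj ES A) g \<cdot> FArr (F g) w" for g c
  have compat_type: "c \<in> Arr C" "Dom C c = FObj (F g) Z" "Cod C c = Z" if "compat g c" for g c
    using that by (auto simp: compat_def)
  have compat_v: "c \<cdot> FArr (F g) v = v \<cdot> snd B g" and compat_w: "w \<cdot> c = snd (FObj ES A) g \<cdot> FArr (F g) w"
    if "compat g c" for g c
    using that by (auto simp: compat_def)
  have compat_iff: "compat g c \<longleftrightarrow> is_triangle_morphism C S
      (FArr (F g) u, FArr (F g) v, \<theta> g (fst A) \<cdot> FArr (F g) w) (u, v, w) (snd A g, snd B g, c)"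
    if [simp]: "g \<in> carrier G" for g c
    using Arr_EC_D(6)[OF u, of g] by (auto simp: compat_def is_triangle_morphism_def ES_simps(2))
  have compat_iso: "is_iso C c" if "compat g c" and [simp]: "g \<in> carrier G" for g c
    using triangle_morphism_iso_3[OF F_dist[OF t, of g] t] compat_iff[of g c] that by simp
  have "\<exists>c. compat g c" if [simp]: "g \<in> carrier G" for g
    using TR3[OF F_dist[OF t, of g] t, of "snd A g" "snd B g"] Arr_EC_D(6)[OF u, of g]
    by (simp add: compat_iff)
  then obtain \<psi> where \<psi>: "compat g (\<psi> g)" if "g \<in> carrier G" for g by metis
  note [simp] = compat_type[OF \<psi>] compat_iso[OF \<psi>]

  \<comment> \<open>\<open>Q g h\<close> is the coherence square of \<open>\<psi>\<close> solved for
    its left factor; it would equal \<open>\<psi> g\<close> if \<open>\<psi>\<close> were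
    coherent.\<close>
  define Q where "Q g h = \<psi> (h \<otimes>\<^bsub>G\<^esub> g) \<cdot> (\<delta> g h Z \<cdot> Inv (FArr (F g) (\<psi> h)))" for g h
  have Q: "compat g (Q g h)" if [simp]: "g \<in> carrier G" "h \<in> carrier G" for g h
  proof -
    have [simp]: "h \<otimes>\<^bsub>G\<^esub> g \<in> carrier G" by simp
    have [simp]: "Q g h \<in> Arr C" "Dom C (Q g h) = FObj (F g) Z" "Cod C (Q g h) = Z"
      by (simp_all add: Q_def)
    have Q\<psi>: "Q g h \<cdot> FArr (F g) (\<psi> h) = \<psi> (h \<otimes>\<^bsub>G\<^esub> g) \<cdot> \<delta> g h Z"
      by (simp add: Q_def)
    \<comment> \<open>Each equation is proved after precomposing with an isomorphism, here
      \<open>FArr (F g) (snd B h)\<close> and below \<open>FArr (F g) (\<psi> h)\<close>, so that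
      the defining equation of \<open>Q\<close> can be applied.\<close>
    have "(Q g h \<cdot> FArr (F g) v) \<cdot> FArr (F g) (snd B h) = Q g h \<cdot> FArr (F g) (\<psi> h \<cdot> FArr (F h) v)"
      by (subst compat_v[OF \<psi>]) auto
    also have "\<dots> = (Q g h \<cdot> FArr (F g) (\<psi> h)) \<cdot> FArr (F g) (FArr (F h) v)" by simp
    also have "\<dots> = \<psi> (h \<otimes>\<^bsub>G\<^esub> g) \<cdot> (\<delta> g h (Cod C v) \<cdot> FArr (F g) (FArr (F h) v))"
      by (subst Q\<psi>) auto
    also have "\<dots> = (\<psi> (h \<otimes>\<^bsub>G\<^esub> g) \<cdot> FArr (F (h \<otimes>\<^bsub>G\<^esub> g)) v) \<cdot> \<delta> g h (fst B)"
      by (subst \<delta>_natural) auto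
    also have "\<dots> = v \<cdot> (snd B (h \<otimes>\<^bsub>G\<^esub> g) \<cdot> \<delta> g h (fst B))"
      by (subst compat_v[OF \<psi>]) auto
    also have "\<dots> = (v \<cdot> snd B g) \<cdot> FArr (F g) (snd B h)"
      by (subst Obj_EC_coherence[symmetric]) auto
    finally have v: "Q g h \<cdot> FArr (F g) v = v \<cdot> snd B g"
      by (rule iso_cancel_right[rotated]) auto
    have "(w \<cdot> Q g h) \<cdot> FArr (F g) (\<psi> h) = (w \<cdot> \<psi> (h \<otimes>\<^bsub>G\<^esub> g)) \<cdot> \<delta> g h Z"
      using Q\<psi> by simp
    also have "\<dots> = snd (FObj ES A) (h \<otimes>\<^bsub>G\<^esub> g) \<cdot> (FArr (F (h \<otimes>\<^bsub>G\<^esub> g)) w \<cdot> \<delta> g h (Dom C w))"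
      by (subst compat_w[OF \<psi>]) auto
    also have "\<dots> = (snd (FObj ES A) (h \<otimes>\<^bsub>G\<^esub> g) \<cdot> \<delta> g h (FObj S (fst A))) \<cdot> FArr (F g) (FArr (F h) w)"
      by (subst \<delta>_natural[symmetric]) auto
    also have "\<dots> = snd (FObj ES A) g \<cdot> FArr (F g) (snd (FObj ES A) h \<cdot> FArr (F h) w)"
      using Obj_EC_coherence[of "FObj ES A" g h] by (simp flip: Cmp_assoc_simp)
    also have "\<dots> = (snd (FObj ES A) g \<cdot> FArr (F g) w) \<cdot> FArr (F g) (\<psi> h)"
      by (subst compat_w[OF \<psi>, symmetric]) auto
    finally have "w \<cdot> Q g h = snd (FObj ES A) g \<cdot> FArr (F g) w"
      by (rule iso_cancel_right[rotated]) auto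
    with v show ?thesis by (simp add: compat_def)
  qed
  note [simp] = compat_type[OF Q]

  define \<phi> where "\<phi> g = avg (FObj (F g) Z) Z (Q g)" for g
  have \<phi>: "compat g (\<phi> g)" if [simp]: "g \<in> carrier G" for g
  proof -
    have "\<phi> g \<in> Hom C (FObj (F g) Z) Z"
      using avg_simps[of "FObj (F g) Z" Z "Q g"] by (simp add: \<phi>_def)
    moreover have "\<phi> g \<cdot> FArr (F g) v = v \<cdot> snd B g"
    proof -
      have "\<phi> g \<cdot> FArr (F g) v = avg (FObj (F g) (fst B)) Z (\<lambda>h. Q g h \<cdot> FArr (F g) v)"
        unfolding \<phi>_def by (intro avg_Cmp) auto
      then show ?thesis by (simp add: avg_constI compat_v[OF Q])
    qed
    moreover have "w \<cdot> \<phi> g = snd (FObj ES A) g \<cdot> FArr (F g) w"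
    proof -
      have "w \<cdot> \<phi> g = avg (FObj (F g) Z) (FObj S (fst A)) (\<lambda>h. w \<cdot> Q g h)"
        unfolding \<phi>_def by (intro Cmp_avg) auto
      then show ?thesis by (simp add: avg_constI compat_w[OF Q])
    qed
    ultimately show ?thesis by (simp add: compat_def)
  qed
  note [simp] = compat_type[OF \<phi>] compat_iso[OF \<phi>]

  \<comment> \<open>The difference \<open>a - a'\<close> factors through the connecting map of the
    translated triangle, and \<open>w\<close> kills \<open>b - b'\<close>. So the product of the
    differences vanishes, and expanding it gives this identity.\<close>
  have bilinear: "a \<cdot> FArr (F g) b \<oplus> a' \<cdot> FArr (F g) b' = a \<cdot> FArr (F g) b' \<oplus> a' \<cdot> FArr (F g) b"
    if [simp]: "g \<in> carrier G" "h \<in> carrier G" and a: "compat g a" "compat g a'" and b: "compat h b" "compat h b'"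
    for g h a a' b b'
  proof -
    note [simp] = compat_type[OF a(1)] compat_type[OF a(2)] compat_type[OF b(1)] compat_type[OF b(2)]
    have "(a \<ominus> a') \<cdot> FArr (F g) v = Zero C (FObj (F g) (fst B)) Z"
      using compat_v[OF a(1)] compat_v[OF a(2)] by (simp add: Add_Cmp)
    then obtain n where [simp]: "n \<in> Arr C" "Dom C n = FObj S (FObj (F g) (fst A))" "Cod C n = Z"
      and n: "n \<cdot> (\<theta> g (fst A) \<cdot> FArr (F g) w) = a \<ominus> a'"
      using dist_coexact_2[OF F_dist[OF t, of g], of "a \<ominus> a'"] by auto
    have "w \<cdot> (b \<ominus> b') = Zero C (FObj (F h) Z) (FObj S (fst A))"
      using compat_w[OF b(1)] compat_w[OF b(2)] by (simp add: Cmp_Add)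
    then have "n \<cdot> (\<theta> g (fst A) \<cdot> FArr (F g) (w \<cdot> (b \<ominus> b'))) = Zero C (FObj (F g) (FObj (F h) Z)) Z"
      by simp
    then have "(n \<cdot> (\<theta> g (fst A) \<cdot> FArr (F g) w)) \<cdot> FArr (F g) (b \<ominus> b') = Zero C (FObj (F g) (FObj (F h) Z)) Z"
      by (simp del: F_simps(7,9))
    then have "(a \<ominus> a') \<cdot> FArr (F g) (b \<ominus> b') = Zero C (FObj (F g) (FObj (F h) Z)) Z"
      by (simp only: n)
    then have "(a \<cdot> FArr (F g) b \<oplus> a' \<cdot> FArr (F g) b') \<ominus> (a \<cdot> FArr (F g) b' \<oplus> a' \<cdot> FArr (F g) b) =
        Zero C (FObj (F g) (FObj (F h) Z)) Z"
      by (simp add: Cmp_Add Add_Cmp Neg_Add Add_assoc Add_lcomm Add_comm)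
    then show ?thesis by (rule sub_eq_ZeroD) auto
  qed

  \<comment> \<open>A cocycle identity for \<open>Q\<close> with a shift in one argument: the
    factors \<open>\<psi> (l \<otimes> h)\<close> contained in the two copies of \<open>Q\<close>
    cancel.\<close>
  have QQ: "Q g (l \<otimes>\<^bsub>G\<^esub> h) \<cdot> FArr (F g) (Q h l) = Q (h \<otimes>\<^bsub>G\<^esub> g) l \<cdot> \<delta> g h Z"
    if [simp]: "g \<in> carrier G" "h \<in> carrier G" "l \<in> carrier G" for g h l
  proof (rule iso_cancel_right)
    let ?hg = "h \<otimes>\<^bsub>G\<^esub> g" and ?lh = "l \<otimes>\<^bsub>G\<^esub> h"
    have [simp]: "?hg \<in> carrier G" "?lh \<in> carrier G" "l \<otimes>\<^bsub>G\<^esub> ?hg \<in> carrier G" "?lh \<otimes>\<^bsub>G\<^esub> g = l \<otimes>\<^bsub>G\<^esub> ?hg"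
      by (simp_all add: m_assoc)
    let ?x = "FArr (F g) (FArr (F h) (\<psi> l))"
    have Q\<psi>: "Q g' h' \<cdot> FArr (F g') (\<psi> h') = \<psi> (h' \<otimes>\<^bsub>G\<^esub> g') \<cdot> \<delta> g' h' Z"
      if "g' \<in> carrier G" "h' \<in> carrier G" for g' h'
      using that by (simp add: Q_def m_closed)
    have "(Q g ?lh \<cdot> FArr (F g) (Q h l)) \<cdot> ?x = Q g ?lh \<cdot> FArr (F g) (Q h l \<cdot> FArr (F h) (\<psi> l))"
      by simp
    also have "\<dots> = (Q g ?lh \<cdot> FArr (F g) (\<psi> ?lh)) \<cdot> FArr (F g) (\<delta> h l Z)"
      by (subst Q\<psi>) auto
    also have "\<dots> = \<psi> (l \<otimes>\<^bsub>G\<^esub> ?hg) \<cdot> (\<delta> g ?lh Z \<cdot> FArr (F g) (\<delta> h l Z))"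
      by (subst Q\<psi>) auto
    also have "\<dots> = (\<psi> (l \<otimes>\<^bsub>G\<^esub> ?hg) \<cdot> \<delta> ?hg l Z) \<cdot> \<delta> g h (FObj (F l) Z)"
      by (subst \<delta>_coherence[symmetric]) auto
    also have "\<dots> = Q ?hg l \<cdot> (FArr (F ?hg) (\<psi> l) \<cdot> \<delta> g h (Dom C (\<psi> l)))"
      by (subst Q\<psi>[symmetric]) auto
    also have "\<dots> = (Q ?hg l \<cdot> \<delta> g h Z) \<cdot> ?x"
      by (subst \<delta>_natural[symmetric]) auto
    finally show "(Q g ?lh \<cdot> FArr (F g) (Q h l)) \<cdot> ?x = (Q ?hg l \<cdot> \<delta> g h Z) \<cdot> ?x" .
  qed (auto simp: m_closed)

  let ?D = "(Z, restrict \<phi> (carrier G))"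
  have D: "?D \<in> Obj EC"
  proof (rule Obj_EC_I)
    fix g h assume [simp]: "g \<in> carrier G" "h \<in> carrier G"
    have [simp]: "h \<otimes>\<^bsub>G\<^esub> g \<in> carrier G" by simp
    let ?X = "FObj (F g) (FObj (F h) Z)"
    let ?p = "\<phi> g \<cdot> FArr (F g) (\<phi> h)"
    \<comment> \<open>Reindexing the average over \<open>l\<close> absorbs the shift by
      \<open>h\<close> that the cocycle identity introduces.\<close>
    have 1: "avg ?X Z (\<lambda>l. Q g (l \<otimes>\<^bsub>G\<^esub> h) \<cdot> FArr (F g) (\<phi> h)) = ?p"
    proof -
      have "?p = avg ?X Z (\<lambda>l. Q g l \<cdot> FArr (F g) (\<phi> h))"
        unfolding \<phi>_def[of g] by (intro avg_Cmp) auto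
      also have "\<dots> = avg ?X Z (\<lambda>l. Q g (l \<otimes>\<^bsub>G\<^esub> h) \<cdot> FArr (F g) (\<phi> h))"
        by (rule avg_reindex[where f = "\<lambda>l. Q g l \<cdot> FArr (F g) (\<phi> h)", OF _ _ _ bij_betw_mult_right, symmetric]) auto
      finally show ?thesis ..
    qed
    have 2: "avg ?X Z (\<lambda>l. \<phi> g \<cdot> FArr (F g) (Q h l)) = ?p"
    proof -
      have "FArr (F g) (\<phi> h) = avg ?X (FObj (F g) Z) (\<lambda>l. FArr (F g) (Q h l))"
        unfolding \<phi>_def[of h] by (intro functor_avg F_additive) auto
      moreover have "\<phi> g \<cdot> avg ?X (FObj (F g) Z) (\<lambda>l. FArr (F g) (Q h l)) = avg ?X Z (\<lambda>l. \<phi> g \<cdot> FArr (F g) (Q h l))"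
        by (intro Cmp_avg) auto
      ultimately show ?thesis by simp
    qed
    have "\<phi> (h \<otimes>\<^bsub>G\<^esub> g) \<cdot> \<delta> g h Z = avg ?X Z (\<lambda>l. Q (h \<otimes>\<^bsub>G\<^esub> g) l \<cdot> \<delta> g h Z)"
      unfolding \<phi>_def[of "h \<otimes>\<^bsub>G\<^esub> g"] by (intro avg_Cmp) auto
    also have "\<dots> = avg ?X Z (\<lambda>l. Q g (l \<otimes>\<^bsub>G\<^esub> h) \<cdot> FArr (F g) (Q h l))"
      by (intro avg_cong) (auto simp: QQ m_closed simp del: F_simps(6))
    finally have 3: "avg ?X Z (\<lambda>l. Q g (l \<otimes>\<^bsub>G\<^esub> h) \<cdot> FArr (F g) (Q h l)) = \<phi> (h \<otimes>\<^bsub>G\<^esub> g) \<cdot> \<delta> g h Z" ..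
    \<comment> \<open>The identity \<open>bilinear\<close> is applied to the pairs
      \<open>Q g (l \<otimes> h)\<close>, \<open>\<phi> g\<close> and \<open>Q h l\<close>,
      \<open>\<phi> h\<close>. Its average over \<open>l\<close> reads
      \<open>\<phi> (h \<otimes> g) \<delta> + ?p = ?p + ?p\<close>, and one \<open>?p\<close>
      cancels.\<close>
    have "\<phi> (h \<otimes>\<^bsub>G\<^esub> g) \<cdot> \<delta> g h Z \<oplus> ?p =
        avg ?X Z (\<lambda>l. Q g (l \<otimes>\<^bsub>G\<^esub> h) \<cdot> FArr (F g) (Q h l) \<oplus> ?p)"
      using avg_Add[of ?X Z "\<lambda>l. Q g (l \<otimes>\<^bsub>G\<^esub> h) \<cdot> FArr (F g) (Q h l)" "\<lambda>_. ?p"]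
      by (simp add: 3 avg_const m_closed)
    also have "\<dots> = avg ?X Z (\<lambda>l. Q g (l \<otimes>\<^bsub>G\<^esub> h) \<cdot> FArr (F g) (\<phi> h) \<oplus> \<phi> g \<cdot> FArr (F g) (Q h l))"
      by (intro avg_cong bilinear[of g h]) (auto intro!: Q \<phi> simp: m_closed)
    also have "\<dots> = ?p \<oplus> ?p"
      using avg_Add[of ?X Z "\<lambda>l. Q g (l \<otimes>\<^bsub>G\<^esub> h) \<cdot> FArr (F g) (\<phi> h)" "\<lambda>l. \<phi> g \<cdot> FArr (F g) (Q h l)"]
      by (simp add: 1 2 m_closed)
    finally have "(\<phi> (h \<otimes>\<^bsub>G\<^esub> g) \<cdot> \<delta> g h Z \<oplus> ?p) \<ominus> ?p = (?p \<oplus> ?p) \<ominus> ?p" by simp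
    then show "?p = \<phi> (h \<otimes>\<^bsub>G\<^esub> g) \<cdot> \<delta> g h Z"
      by (simp add: Add_assoc)
  qed auto
  show thesis
  proof (rule that[OF _ _ t])
    show "(B, v, ?D) \<in> Arr EC" using D by (simp add: Arr_EC_iff compat_v[OF \<phi>])
    show "(?D, w, FObj ES A) \<in> Arr EC" using D by (simp add: Arr_EC_iff compat_w[OF \<phi>])
  qed
qed

section \<open>Canonical triangles satisfy TR1 to TR3\<close>

abbreviation ET where "ET \<equiv> canonical_triangles C S \<T> G F \<theta> \<delta>"

lemma ET_iff:
  "((A, u, B), (B', v, D), (D', w, E)) \<in> ET \<longleftrightarrow>
     (A, u, B) \<in> Arr EC \<and> (B, v, D) \<in> Arr EC \<and> (D, w, FObj ES A) \<in> Arr EC \<and>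
     B' = B \<and> D' = D \<and> E = FObj ES A \<and> (u, v, w) \<in> \<T>"
  by (cases A; cases B) (auto simp: canonical_triangles_def is_triangle_def forgetful_image_def triangle_image_def
      forgetful_def Arr_EC_iff)

lemma ET_cases:
  assumes "t \<in> ET"
  obtains A u B v D w where "t = ((A, u, B), (B, v, D), (D, w, FObj ES A))"
    "(A, u, B) \<in> Arr EC" "(B, v, D) \<in> Arr EC" "(D, w, FObj ES A) \<in> Arr EC" "(u, v, w) \<in> \<T>"
  using assms by (cases t) (auto simp: ET_iff)

lemma is_triangle_EC_cases:
  assumes "is_triangle EC ES t"
  obtains A u B v D w where "t = ((A, u, B), (B, v, D), (D, w, FObj ES A))"
    "(A, u, B) \<in> Arr EC" "(B, v, D) \<in> Arr EC" "(D, w, FObj ES A) \<in> Arr EC"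
  using assms by (cases t) (auto simp: is_triangle_def)

lemma is_triangle_forget:
  assumes "(A, u, B) \<in> Arr EC" "(B, v, D) \<in> Arr EC" "(D, w, FObj ES A) \<in> Arr EC"
  shows "is_triangle C S (u, v, w)"
  using assms by (simp add: Arr_EC_iff is_triangle_def)

lemma triangle_morphism_EC_iff:
  assumes "(A, u, B) \<in> Arr EC" "(B, v, D) \<in> Arr EC" "(D, w, FObj ES A) \<in> Arr EC"
    and "(A', u', B') \<in> Arr EC" "(B', v', D') \<in> Arr EC" "(D', w', FObj ES A') \<in> Arr EC"
  shows "is_triangle_morphism EC ES ((A, u, B), (B, v, D), (D, w, FObj ES A))
      ((A', u', B'), (B', v', D'), (D', w', FObj ES A')) ((A\<^sub>1, a, A\<^sub>2), (B\<^sub>1, b, B\<^sub>2), (D\<^sub>1, c, D\<^sub>2)) \<longleftrightarrow>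
    (A\<^sub>1, a, A\<^sub>2) \<in> Hom EC A A' \<and> (B\<^sub>1, b, B\<^sub>2) \<in> Hom EC B B' \<and> (D\<^sub>1, c, D\<^sub>2) \<in> Hom EC D D' \<and>
    is_triangle_morphism C S (u, v, w) (u', v', w') (a, b, c)"
  using assms by (auto simp: is_triangle_morphism_def Arr_EC_iff)

sublocale EC: pre_triangulated_category EC ES ET
proof (intro pre_triangulated_category.intro EC.additive_category_axioms
    pre_triangulated_category_axioms.intro ES_equivalence ES_additive)
  show "is_triangle EC ES t" if "t \<in> ET" for t
    using that by (simp add: canonical_triangles_def)
next
  fix t t' m assume t: "t \<in> ET" and t': "is_triangle EC ES t'" and m: "is_triangle_iso EC ES t t' m"
  obtain A u B v D w where [simp]: "t = ((A, u, B), (B, v, D), (D, w, FObj ES A))"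
    and arr: "(A, u, B) \<in> Arr EC" "(B, v, D) \<in> Arr EC" "(D, w, FObj ES A) \<in> Arr EC" and uvw: "(u, v, w) \<in> \<T>"
    using t by (rule ET_cases)
  obtain A' u' B' v' D' w' where [simp]: "t' = ((A', u', B'), (B', v', D'), (D', w', FObj ES A'))"
    and arr': "(A', u', B') \<in> Arr EC" "(B', v', D') \<in> Arr EC" "(D', w', FObj ES A') \<in> Arr EC"
    using t' by (rule is_triangle_EC_cases)
  obtain A\<^sub>1 a A\<^sub>2 B\<^sub>1 b B\<^sub>2 D\<^sub>1 c D\<^sub>2 where [simp]: "m = ((A\<^sub>1, a, A\<^sub>2), (B\<^sub>1, b, B\<^sub>2), (D\<^sub>1, c, D\<^sub>2))"
    by (metis prod_cases3)
  have "is_triangle_iso C S (u, v, w) (u', v', w') (a, b, c)"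
    using m by (auto simp: is_triangle_iso_def triangle_morphism_EC_iff arr arr' is_iso_EC)
  then have "(u', v', w') \<in> \<T>"
    using TR1_iso[OF uvw] is_triangle_forget[OF arr'] by blast
  then show "t' \<in> ET" using arr' by (simp add: ET_iff)
next
  fix A Z assume [simp]: "A \<in> Obj EC" and Z: "zero_object EC Z"
  then have [simp]: "Z \<in> Obj EC" by (simp add: zero_object_def)
  have "Idn C (fst Z) = Zero C (fst Z) (fst Z)" using EC.zero_object_Idn[OF Z] by simp
  then have "zero_object C (fst Z)" by (intro zero_objectI preadditive_category_axioms) auto
  then have "(Idn C (fst A), Zero C (fst A) (fst Z), Zero C (fst Z) (FObj S (fst A))) \<in> \<T>"
    by (intro TR1_id) auto
  then show "(Idn EC A, Zero EC A Z, Zero EC Z (FObj ES A)) \<in> ET"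
    using Arr_EC_Zero[of A Z] Arr_EC_Zero[of Z "FObj ES A"] by (simp add: ET_iff Arr_EC_iff)
next
  fix f assume "f \<in> Arr EC"
  then obtain A u B where f: "f = (A, u, B)" and u: "(A, u, B) \<in> Arr EC" by (cases f) auto
  obtain D v w where "(B, v, D) \<in> Arr EC" "(D, w, FObj ES A) \<in> Arr EC" "(u, v, w) \<in> \<T>"
    using u by (rule equivariant_cone)
  then have "(f, (B, v, D), (D, w, FObj ES A)) \<in> ET" using u by (simp add: ET_iff f)
  then show "\<exists>v w. (f, v, w) \<in> ET" by blast
next
  fix f g h assume "is_triangle EC ES (f, g, h)"
  then obtain A u B v D w where [simp]: "f = (A, u, B)" "g = (B, v, D)" "h = (D, w, FObj ES A)"
    and arr [simp]: "(A, u, B) \<in> Arr EC" "(B, v, D) \<in> Arr EC" "(D, w, FObj ES A) \<in> Arr EC"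
    by (rule is_triangle_EC_cases) auto
  have Su: "(FObj ES A, FArr S u, FObj ES B) \<in> Arr EC" using ES_Arr arr by blast
  show "(f, g, h) \<in> ET \<longleftrightarrow> (g, h, Neg EC (FArr ES f)) \<in> ET"
    using TR2[OF is_triangle_forget[OF arr]] Arr_EC_Neg[OF Su] by (simp add: ET_iff Su)
next
  fix f g h f' g' h' \<alpha> \<beta>
  assume t: "(f, g, h) \<in> ET" and t': "(f', g', h') \<in> ET" and \<alpha>: "\<alpha> \<in> Hom EC (Dom EC f) (Dom EC f')"
    and \<beta>: "\<beta> \<in> Hom EC (Cod EC f) (Cod EC f')" and eq: "Cmp EC \<beta> f = Cmp EC f' \<alpha>"
  obtain A u B v D w where [simp]: "f = (A, u, B)" "g = (B, v, D)" "h = (D, w, FObj ES A)"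
    and arr: "(A, u, B) \<in> Arr EC" "(B, v, D) \<in> Arr EC" "(D, w, FObj ES A) \<in> Arr EC" and uvw: "(u, v, w) \<in> \<T>"
    using t by (rule ET_cases) auto
  obtain A' u' B' v' D' w' where [simp]: "f' = (A', u', B')" "g' = (B', v', D')" "h' = (D', w', FObj ES A')"
    and arr': "(A', u', B') \<in> Arr EC" "(B', v', D') \<in> Arr EC" "(D', w', FObj ES A') \<in> Arr EC"
    and uvw': "(u', v', w') \<in> \<T>"
    using t' by (rule ET_cases) auto
  obtain a b where [simp]: "\<alpha> = (A, a, A')" "\<beta> = (B, b, B')" using \<alpha> \<beta> by (cases \<alpha>; cases \<beta>) auto
  have a: "(A, a, A') \<in> Arr EC" and b: "(B, b, B') \<in> Arr EC" using \<alpha> \<beta> by auto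
  note [simp] = Arr_EC_D(1-5)[OF arr(1)] Arr_EC_D(1-5)[OF arr(2)] Arr_EC_D(1-5)[OF arr(3)]
    Arr_EC_D(1-5)[OF arr'(1)] Arr_EC_D(1-5)[OF arr'(2)] Arr_EC_D(1-5)[OF arr'(3)]
    Arr_EC_D(1-5)[OF a] Arr_EC_D(1-5)[OF b]
  obtain c where m: "is_triangle_morphism C S (u, v, w) (u', v', w') (a, b, c)"
    using TR3[OF uvw uvw', of a b] eq by auto
  note [simp] = triangle_morphismD(3,8,9)[OF m, simplified]
  \<comment> \<open>Only the third map needs repair. Both squares say that \<open>c\<close> composed
    with an equivariant map is equivariant, so every conjugate of \<open>c\<close> satisfies them,
    and with it the mean.\<close>
  define c' where "c' = avg (fst D) (fst D') (\<lambda>g. conjugate D D' g c)"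
  have c': "(D, c', D') \<in> Arr EC"
    unfolding c'_def by (intro avg_conj_equivariant) auto
  note [simp] = Arr_EC_D(1-5)[OF c']
  have "c' \<cdot> v = v' \<cdot> b"
  proof -
    have "conjugate D D' g c \<cdot> v = v' \<cdot> b" if [simp]: "g \<in> carrier G" for g
    proof -
      have "conjugate D D' g c \<cdot> v = conjugate D D' g c \<cdot> conjugate B D g v" by (simp add: conj_equivariant[OF arr(2)])
      also have "\<dots> = conjugate B D' g (v' \<cdot> b)"
        by (simp add: conj_Cmp[of B D D', symmetric] triangle_morphismD(11)[OF m])
      also have "\<dots> = v' \<cdot> b"
        by (simp add: conj_Cmp[of B B' D'] conj_equivariant[OF arr'(2)] conj_equivariant[OF b])
      finally show ?thesis .
    qed
    moreover have "c' \<cdot> v = avg (fst B) (fst D') (\<lambda>g. conjugate D D' g c \<cdot> v)"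
      unfolding c'_def by (intro avg_Cmp) auto
    ultimately show ?thesis by (simp add: avg_constI)
  qed
  moreover have "FArr S a \<cdot> w = w' \<cdot> c'"
  proof -
    note Sa = ES_Arr[OF a]
    have "w' \<cdot> conjugate D D' g c = FArr S a \<cdot> w" if [simp]: "g \<in> carrier G" for g
    proof -
      have "w' \<cdot> conjugate D D' g c = conjugate D' (FObj ES A') g w' \<cdot> conjugate D D' g c"
        by (simp add: conj_equivariant[OF arr'(3)])
      also have "\<dots> = conjugate D (FObj ES A') g (FArr S a \<cdot> w)"
        by (simp add: conj_Cmp[of D D' "FObj ES A'", symmetric] triangle_morphismD(12)[OF m])
      also have "\<dots> = FArr S a \<cdot> w"
        by (simp add: conj_Cmp[of D "FObj ES A" "FObj ES A'"] conj_equivariant[OF arr(3)] conj_equivariant[OF Sa])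
      finally show ?thesis .
    qed
    moreover have "w' \<cdot> c' = avg (fst D) (FObj S (fst A')) (\<lambda>g. w' \<cdot> conjugate D D' g c)"
      unfolding c'_def by (intro Cmp_avg) auto
    moreover have "avg (fst D) (FObj S (fst A')) (\<lambda>g. FArr S a \<cdot> w) = FArr S a \<cdot> w"
      by (intro avg_const) auto
    moreover have "avg (fst D) (FObj S (fst A')) (\<lambda>g. w' \<cdot> conjugate D D' g c) =
        avg (fst D) (FObj S (fst A')) (\<lambda>g. FArr S a \<cdot> w)"
      using calculation(1) by (intro avg_cong) auto
    ultimately show ?thesis by simp
  qed
  ultimately have "is_triangle_morphism C S (u, v, w) (u', v', w') (a, b, c')"
    using triangle_morphismD(10)[OF m] by (simp add: is_triangle_morphism_def)
  then have "is_triangle_morphism EC ES (f, g, h) (f', g', h') (\<alpha>, \<beta>, (D, c', D'))"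
    using a b c' by (simp add: triangle_morphism_EC_iff arr arr')
  then show "\<exists>\<gamma>. is_triangle_morphism EC ES (f, g, h) (f', g', h') (\<alpha>, \<beta>, \<gamma>)" by blast
qed

end

section \<open>The octahedral axiom\<close>

context averaging_action
begin

text \<open>Makes the middle map of a triangle equivariant without disturbing its neighbours. Each
  conjugate of \<open>g\<close> agrees with \<open>g\<close> on \<open>t\<close> and after
  \<open>m\<close>. Exactness at \<open>L\<close> writes their difference as
  \<open>g \<cdot> (t \<cdot> (y \<cdot> e k))\<close>, and any further difference kills the factor
  \<open>t\<close>; this is the vanishing required by \<open>avg_dist_middle\<close>.\<close>

lemma equivariant_middle:
  assumes f: "(K, f, M) \<in> Arr EC" and h: "(L, h, FObj ES K) \<in> Arr EC" and fgh: "(f, g, h) \<in> \<T>"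
    and t: "(P, t, M) \<in> Arr EC" and gt: "(P, g \<cdot> t, L) \<in> Arr EC"
    and m: "(L, m, R) \<in> Arr EC" and mg: "(M, m \<cdot> g, R) \<in> Arr EC"
    and y: "y \<in> Arr C" "Cod C y = fst P" and exact: "(g \<cdot> (t \<cdot> y), m, n) \<in> \<T>"
  obtains g' where "(M, g', L) \<in> Arr EC" "g' \<cdot> t = g \<cdot> t" "m \<cdot> g' = m \<cdot> g" "(f, g', h) \<in> \<T>"
proof -
  note [simp] = Arr_EC_D(1-5)[OF f] Arr_EC_D(1-5)[OF h] Arr_EC_D(1-5)[OF t] Arr_EC_D(1-2)[OF gt]
    Arr_EC_D(1-5)[OF m] Arr_EC_D(1-2)[OF mg] y
  have [simp]: "g \<in> Arr C" "Dom C g = fst M" "Cod C g = fst L"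
    using dist_type[OF fgh] by auto
  let ?c = "\<lambda>k. conjugate M L k g"
  have ct: "?c k \<cdot> t = g \<cdot> t" and mc: "m \<cdot> ?c k = m \<cdot> g" if [simp]: "k \<in> carrier G" for k
  proof -
    have "?c k \<cdot> t = ?c k \<cdot> conjugate P M k t" by (simp add: conj_equivariant[OF t])
    also have "\<dots> = g \<cdot> t" by (simp add: conj_Cmp[symmetric] conj_equivariant[OF gt])
    finally show "?c k \<cdot> t = g \<cdot> t" .
    have "m \<cdot> ?c k = conjugate L R k m \<cdot> ?c k" by (simp add: conj_equivariant[OF m])
    also have "\<dots> = m \<cdot> g" by (simp add: conj_Cmp[symmetric] conj_equivariant[OF mg])
    finally show "m \<cdot> ?c k = m \<cdot> g" .
  qed
  define g' where "g' = avg (fst M) (fst L) ?c"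
  have g': "(M, g', L) \<in> Arr EC" unfolding g'_def by (intro avg_conj_equivariant) auto
  have "\<exists>e. e \<in> Arr C \<and> Dom C e = fst M \<and> Cod C e = Dom C y \<and> g \<cdot> (t \<cdot> (y \<cdot> e)) = ?c k \<ominus> g"
    if [simp]: "k \<in> carrier G" for k
  proof -
    have "m \<cdot> (?c k \<ominus> g) = Zero C (fst M) (fst R)" by (simp add: Cmp_Add mc)
    then obtain e where "e \<in> Arr C" "Cod C e = Dom C y" "Dom C e = fst M" "(g \<cdot> (t \<cdot> y)) \<cdot> e = ?c k \<ominus> g"
      using dist_exact_1[OF exact, of "?c k \<ominus> g"] by auto
    then show ?thesis by (intro exI[of _ e]) auto
  qed
  then obtain e where e [simp]: "e k \<in> Arr C" "Dom C (e k) = fst M" "Cod C (e k) = Dom C y"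
    and ge: "g \<cdot> (t \<cdot> (y \<cdot> e k)) = ?c k \<ominus> g" if "k \<in> carrier G" for k
    by metis
  have "(f, avg (Cod C f) (Cod C g) ?c, h) \<in> \<T>"
  proof (rule avg_dist_middle[OF fgh, where c = "\<lambda>k. t \<cdot> (y \<cdot> e k)"])
    fix k assume [simp]: "k \<in> carrier G"
    have "(conjugate K M k f, ?c k, conjugate L (FObj ES K) k h) \<in> \<T>"
      by (rule conj_dist[OF fgh]) auto
    then show "(f, ?c k, h) \<in> \<T>"
      by (simp add: conj_equivariant[OF f] conj_equivariant[OF h])
    fix k' assume [simp]: "k' \<in> carrier G"
    have "((?c k' \<ominus> g) \<cdot> t) \<cdot> (y \<cdot> e k) = Zero C (fst M) (fst L)"
      by (simp add: Add_Cmp ct del: Cmp_assoc_simp)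
    then show "(?c k' \<ominus> g) \<cdot> (t \<cdot> (y \<cdot> e k)) = Zero C (Cod C f) (Cod C g)"
      by simp
  qed (auto simp: ge)
  then have "(f, g', h) \<in> \<T>" by (simp add: g'_def)
  moreover have "g' \<cdot> t = g \<cdot> t"
  proof -
    have "g' \<cdot> t = avg (fst P) (fst L) (\<lambda>k. ?c k \<cdot> t)"
      unfolding g'_def by (intro avg_Cmp) auto
    also have "\<dots> = g \<cdot> t" by (rule avg_constI) (auto simp: ct)
    finally show ?thesis .
  qed
  moreover have "m \<cdot> g' = m \<cdot> g"
  proof -
    have "m \<cdot> g' = avg (fst M) (fst R) (\<lambda>k. m \<cdot> ?c k)"
      unfolding g'_def by (intro Cmp_avg) auto
    also have "\<dots> = m \<cdot> g" by (rule avg_constI) (auto simp: mc)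
    finally show ?thesis .
  qed
  ultimately show thesis using g' that by blast
qed

lemma EC_biproduct:
  assumes "A \<in> Obj EC" "B \<in> Obj EC"
  obtains P i j p q where "(A, i, P) \<in> Arr EC" "(B, j, P) \<in> Arr EC" "(P, p, A) \<in> Arr EC" "(P, q, B) \<in> Arr EC"
    "is_biproduct C (fst A) (fst B) (fst P) i j p q"
proof -
  obtain P i' j' p' q' where P: "is_biproduct EC A B P i' j' p' q'"
    using EC.biproduct_exists[OF assms] by blast
  note P' = EC.is_biproductD[OF P]
  obtain i j p q where [simp]: "i' = (A, i, P)" "j' = (B, j, P)" "p' = (P, p, A)" "q' = (P, q, B)"
    using P'(8-15) by (cases i'; cases j'; cases p'; cases q') auto
  show thesis
  proof (rule that[of i P j p q])
    show "is_biproduct C (fst A) (fst B) (fst P) i j p q"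
      using P unfolding is_biproduct_def by (auto simp: Arr_EC_iff)
  qed (use P'(4-7) in auto)
qed

text \<open>The maps \<open>l\<close> and \<open>g\<close> of the octahedron in \<open>C\<close> are
  tied to each other only through the equivariant \<open>d\<close>, so they can be made equivariant
  one at a time: each repair keeps the composite of its map with \<open>t\<close> and the equation
  with \<open>d\<close>.\<close>

lemma EC_octahedron:
  assumes u: "(A, u, B) \<in> Arr EC" and v: "(B, v, D) \<in> Arr EC"
    and i: "(B, i, K) \<in> Arr EC" and i': "(K, i', FObj ES A) \<in> Arr EC" and ui: "(u, i, i') \<in> \<T>"
    and j: "(D, j, L) \<in> Arr EC" and j': "(L, j', FObj ES B) \<in> Arr EC" and vj: "(v, j, j') \<in> \<T>"
  obtains M k k' f g where "(D, k, M) \<in> Arr EC" "(M, k', FObj ES A) \<in> Arr EC" "(K, f, M) \<in> Arr EC"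
    "(M, g, L) \<in> Arr EC" "(v \<cdot> u, k, k') \<in> \<T>" "(f, g, FArr S i \<cdot> j') \<in> \<T>"
    "f \<cdot> i = k \<cdot> v" "k' \<cdot> f = i'" "g \<cdot> k = j" "FArr S u \<cdot> k' = j' \<cdot> g"
proof -
  note [simp] = Arr_EC_D(1-5)[OF u] Arr_EC_D(1-5)[OF v] Arr_EC_D(1-5)[OF i] Arr_EC_D(1-5)[OF i']
    Arr_EC_D(1-5)[OF j] Arr_EC_D(1-5)[OF j']
  note [simp del] = ES_simps(2)
  obtain P in\<^sub>1 in\<^sub>2 p\<^sub>1 p\<^sub>2 where in1: "(D, in\<^sub>1, P) \<in> Arr EC" and in2: "(K, in\<^sub>2, P) \<in> Arr EC"
    and p1: "(P, p\<^sub>1, D) \<in> Arr EC" and p2: "(P, p\<^sub>2, K) \<in> Arr EC"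
    and P: "is_biproduct C (fst D) (fst K) (fst P) in\<^sub>1 in\<^sub>2 p\<^sub>1 p\<^sub>2"
    by (rule EC_biproduct[of D K]) auto
  note [simp] = biproduct_simps[OF P] Arr_EC_D(2)[OF in1]
  have Cmp_Arr: "(X, b \<cdot> a, Z) \<in> Arr EC" if "(X, a, Y) \<in> Arr EC" "(Y, b, Z) \<in> Arr EC" for X Y Z a b
    using EC.Cmp_simps(1)[OF that] by simp
  let ?s = "in\<^sub>1 \<cdot> v \<oplus> in\<^sub>2 \<cdot> Neg C i"
  have s: "(B, ?s, P) \<in> Arr EC"
    using Arr_EC_Add[OF Cmp_Arr[OF v in1] Cmp_Arr[OF Arr_EC_Neg[OF i] in2]] by simp
  obtain M t d where t: "(P, t, M) \<in> Arr EC" and d: "(M, d, FObj ES B) \<in> Arr EC" and st: "(?s, t, d) \<in> \<T>"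
    using s by (rule equivariant_cone)
  note [simp] = Arr_EC_D(1-5)[OF t] Arr_EC_D(1-5)[OF d]
  obtain l g where vul: "(v \<cdot> u, t \<cdot> in\<^sub>1, l) \<in> \<T>" and tg: "(t \<cdot> in\<^sub>2, g, FArr S i \<cdot> j') \<in> \<T>"
    and lt: "l \<cdot> t = i' \<cdot> p\<^sub>2" and ul: "FArr S u \<cdot> l = d" and gt: "g \<cdot> t = j \<cdot> p\<^sub>1" and jg: "j' \<cdot> g = d"
    by (rule octahedron_on_homotopy_pushout[OF P _ _ _ ui vj st]) auto
  have [simp]: "l \<in> Arr C" "Dom C l = fst M" "Cod C l = FObj S (fst A)"
    "g \<in> Arr C" "Dom C g = fst M" "Cod C g = fst L"
    using dist_type[OF vul] dist_type[OF tg] by auto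
  have k: "(D, t \<cdot> in\<^sub>1, M) \<in> Arr EC" and f: "(K, t \<cdot> in\<^sub>2, M) \<in> Arr EC"
    using Cmp_Arr[OF in1 t] Cmp_Arr[OF in2 t] .

  have gtin: "g \<cdot> (t \<cdot> in\<^sub>1) = j" and ltin: "l \<cdot> (t \<cdot> in\<^sub>2) = i'"
    by (simp_all add: Cmp_reassoc[OF gt] Cmp_reassoc[OF lt])
  \<comment> \<open>Here \<open>m = j'\<close> and \<open>y = in\<^sub>1\<close>. Since
    \<open>g \<cdot> (t \<cdot> in\<^sub>1) = j\<close>, the exactness required is that of the
    rotated triangle on \<open>v\<close>.\<close>
  obtain g' where g': "(M, g', L) \<in> Arr EC" "g' \<cdot> t = j \<cdot> p\<^sub>1" "j' \<cdot> g' = d" "(t \<cdot> in\<^sub>2, g', FArr S i \<cdot> j') \<in> \<T>"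
  proof (rule equivariant_middle[OF f _ tg t _ j'])
    show "(L, FArr S i \<cdot> j', FObj ES K) \<in> Arr EC" using Cmp_Arr[OF j' ES_Arr[OF i]] .
    show "(P, g \<cdot> t, L) \<in> Arr EC" unfolding gt using Cmp_Arr[OF p1 j] .
    show "(M, j' \<cdot> g, FObj ES B) \<in> Arr EC" unfolding jg by (rule d)
    show "(g \<cdot> (t \<cdot> in\<^sub>1), j', Neg C (FArr S v)) \<in> \<T>" unfolding gtin by (rule rotate[OF vj])
  qed (use gt jg in auto)
  have Su: "(FObj ES A, Neg C (FArr S u), FObj ES B) \<in> Arr EC"
    by (rule Arr_EC_Neg[OF ES_Arr[OF u]])
  \<comment> \<open>Here \<open>m = -\<Sigma>u\<close> and \<open>y = in\<^sub>2\<close>. Since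
    \<open>l \<cdot> (t \<cdot> in\<^sub>2) = i'\<close>, the exactness required is that of the
    triangle on \<open>u\<close> rotated twice, which also explains the sign.\<close>
  obtain l' where l': "(M, l', FObj ES A) \<in> Arr EC" "l' \<cdot> t = i' \<cdot> p\<^sub>2"
    "Neg C (FArr S u) \<cdot> l' = Neg C (FArr S u) \<cdot> l" "(t \<cdot> in\<^sub>1, l', Neg C (FArr S (v \<cdot> u))) \<in> \<T>"
  proof (rule equivariant_middle[OF k _ rotate[OF vul] t _ Su])
    show "(FObj ES A, Neg C (FArr S (v \<cdot> u)), FObj ES D) \<in> Arr EC"
      by (rule Arr_EC_Neg[OF ES_Arr[OF Cmp_Arr[OF u v]]])
    show "(P, l \<cdot> t, FObj ES A) \<in> Arr EC" unfolding lt using Cmp_Arr[OF p2 i'] .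
    show "(M, Neg C (FArr S u) \<cdot> l, FObj ES B) \<in> Arr EC"
      using Arr_EC_Neg[OF d] by (simp add: ul)
    show "(l \<cdot> (t \<cdot> in\<^sub>2), Neg C (FArr S u), Neg C (FArr S i)) \<in> \<T>"
      unfolding ltin by (rule rotate[OF rotate[OF ui]])
  qed (use lt in auto)
  note [simp] = Arr_EC_D(1-5)[OF g'(1)] Arr_EC_D(1-5)[OF l'(1)]
  have "Neg C (Neg C (FArr S u \<cdot> l')) = Neg C (Neg C (FArr S u \<cdot> l))" using l'(3) by simp
  then have ul': "FArr S u \<cdot> l' = d" by (simp add: ul)
  show thesis
  proof (rule that[OF k l'(1) f g'(1) _ g'(4)])
    show "(v \<cdot> u, t \<cdot> in\<^sub>1, l') \<in> \<T>" by (rule unrotate[OF l'(4)]) auto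
    \<comment> \<open>Consecutive maps of the cone triangle compose to zero; by the sign of
      \<open>i\<close> this is the commutative square relating \<open>f\<close> and
      \<open>k\<close>.\<close>
    have "(t \<cdot> (in\<^sub>1 \<cdot> v)) \<ominus> (t \<cdot> (in\<^sub>2 \<cdot> i)) = Zero C (fst B) (fst M)"
      using dist_Cmp_12[OF st] by (simp add: Cmp_Add)
    then have "t \<cdot> (in\<^sub>1 \<cdot> v) = t \<cdot> (in\<^sub>2 \<cdot> i)" by (rule sub_eq_ZeroD) auto
    then show "t \<cdot> in\<^sub>2 \<cdot> i = t \<cdot> in\<^sub>1 \<cdot> v" by simp
    show "l' \<cdot> (t \<cdot> in\<^sub>2) = i'" "g' \<cdot> (t \<cdot> in\<^sub>1) = j"
      by (simp_all add: Cmp_reassoc[OF g'(2)] Cmp_reassoc[OF l'(2)])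
    show "FArr S u \<cdot> l' = j' \<cdot> g'" by (simp add: ul' g'(3))
  qed
qed

sublocale EC: triangulated_category EC ES ET
proof
  fix u A B v D i i' j j' k k'
  assume uA: "u \<in> Hom EC A B" and vA: "v \<in> Hom EC B D"
    and t1: "(u, i, i') \<in> ET" and t2: "(v, j, j') \<in> ET" and t3: "(Cmp EC v u, k, k') \<in> ET"
  obtain u\<^sub>0 i\<^sub>0 i\<^sub>0' K where [simp]: "u = (A, u\<^sub>0, B)" "i = (B, i\<^sub>0, K)" "i' = (K, i\<^sub>0', FObj ES A)"
    and a1: "(A, u\<^sub>0, B) \<in> Arr EC" "(B, i\<^sub>0, K) \<in> Arr EC" "(K, i\<^sub>0', FObj ES A) \<in> Arr EC" "(u\<^sub>0, i\<^sub>0, i\<^sub>0') \<in> \<T>"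
    using t1 uA by (auto elim!: ET_cases)
  obtain v\<^sub>0 j\<^sub>0 j\<^sub>0' L where [simp]: "v = (B, v\<^sub>0, D)" "j = (D, j\<^sub>0, L)" "j' = (L, j\<^sub>0', FObj ES B)"
    and a2: "(B, v\<^sub>0, D) \<in> Arr EC" "(D, j\<^sub>0, L) \<in> Arr EC" "(L, j\<^sub>0', FObj ES B) \<in> Arr EC" "(v\<^sub>0, j\<^sub>0, j\<^sub>0') \<in> \<T>"
    using t2 vA by (auto elim!: ET_cases)
  obtain M l l' f g where l: "(D, l, M) \<in> Arr EC" "(M, l', FObj ES A) \<in> Arr EC" and f: "(K, f, M) \<in> Arr EC"
    and g: "(M, g, L) \<in> Arr EC" and vul: "(v\<^sub>0 \<cdot> u\<^sub>0, l, l') \<in> \<T>" and fg: "(f, g, FArr S i\<^sub>0 \<cdot> j\<^sub>0') \<in> \<T>"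
    and eqs: "f \<cdot> i\<^sub>0 = l \<cdot> v\<^sub>0" "l' \<cdot> f = i\<^sub>0'" "g \<cdot> l = j\<^sub>0" "FArr S u\<^sub>0 \<cdot> l' = j\<^sub>0' \<cdot> g"
    by (rule EC_octahedron[OF a1(1) a2(1) a1(2-4) a2(2-4)])
  have vu: "(A, v\<^sub>0 \<cdot> u\<^sub>0, D) \<in> Arr EC" using EC.Cmp_simps(1)[OF a1(1) a2(1)] by simp
  have ij: "(L, FArr S i\<^sub>0 \<cdot> j\<^sub>0', FObj ES K) \<in> Arr EC"
    using EC.Cmp_simps(1)[OF a2(3) ES_Arr[OF a1(2)]] by simp
  note [simp] = Arr_EC_D(1-5)[OF a1(1)] Arr_EC_D(1-5)[OF a1(2)] Arr_EC_D(1-5)[OF a1(3)]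
    Arr_EC_D(1-5)[OF a2(1)] Arr_EC_D(1-5)[OF a2(2)] Arr_EC_D(1-5)[OF a2(3)]
    Arr_EC_D(1-5)[OF l(1)] Arr_EC_D(1-5)[OF l(2)] Arr_EC_D(1-5)[OF f] Arr_EC_D(1-5)[OF g]
  have t4: "(Cmp EC v u, (D, l, M), (M, l', FObj ES A)) \<in> ET"
    using vu l vul by (simp add: ET_iff)
  have m1: "is_triangle_morphism EC ES (u, i, i') (Cmp EC v u, (D, l, M), (M, l', FObj ES A)) (Idn EC A, v, (K, f, M))"
    using eqs f a2(1) EC.Idn_simps(1)[of A]
    by (simp add: triangle_morphism_EC_iff a1 vu l is_triangle_morphism_def[of C])
  have m2: "is_triangle_morphism EC ES (Cmp EC v u, (D, l, M), (M, l', FObj ES A)) (v, j, j') (u, Idn EC D, (M, g, L))"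
    using eqs g a1(1) EC.Idn_simps(1)[of D]
    by (simp add: triangle_morphism_EC_iff a2 vu l is_triangle_morphism_def[of C])
  have "((K, f, M), (M, g, L), Cmp EC (FArr ES i) j') \<in> ET"
    using f g fg ij by (simp add: ET_iff)
  then show "\<exists>f g. is_triangle_morphism EC ES (u, i, i') (Cmp EC v u, k, k') (Idn EC A, v, f) \<and>
      is_triangle_morphism EC ES (Cmp EC v u, k, k') (v, j, j') (u, Idn EC D, g) \<and>
      (f, g, Cmp EC (FArr ES i) j') \<in> ET"
    by (rule EC.TR4_change_third[OF uA vA t1 t2 t3 t4 m1 m2])
qed

end

theorem proposition6p10:
  fixes C :: "('o, 'm, 'x) additive_cat_scheme"
    and S :: "('o, 'm, 'o, 'm) func"
    and \<T> :: "'m triangle set"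
    and G :: "('g, 'y) monoid_scheme"
    and F :: "'g \<Rightarrow> ('o, 'm, 'o, 'm) func"
    and \<theta> :: "'g \<Rightarrow> 'o \<Rightarrow> 'm"
    and \<delta> :: "'g \<Rightarrow> 'g \<Rightarrow> 'o \<Rightarrow> 'm"
  assumes "triangulated_category C S \<T>"
    and "group G" and "finite (carrier G)"
    and "admissible_action C S \<T> G F \<theta> \<delta>"
    and "int_invertible C (int (order G))"
  shows "triangulated_category (equivariant_category C G F \<delta>) (equivariant_susp C S G \<theta>)
           (canonical_triangles C S \<T> G F \<theta> \<delta>)
         \<and> (\<forall>t. is_triangle (equivariant_category C G F \<delta>) (equivariant_susp C S G \<theta>) t \<longrightarrow>
              (t \<in> canonical_triangles C S \<T> G F \<theta> \<delta> \<longleftrightarrow> forgetful_image C S G F \<delta> t \<in> \<T>))"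
proof -
  interpret averaging_action C S \<T> G F \<theta> \<delta>
    using assms(3-5) by (simp add: averaging_action_def averaging_action_axioms_def)
  show ?thesis
    using EC.triangulated_category_axioms by (auto simp: canonical_triangles_def)
qed

end
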